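(* Let $\mathbf K$ be an algebraically closed field and let $X\subset\mathbf P^N$ be a projective toric variety over $\mathbf K$ of dimension $n$. Then $$\deg(X)\;\le\;\omega_1(X;(\mathbf P^N)^\circ)\cdots\omega_{N-n}(X;(\mathbf P^N)^\circ)\;\le\;(N+1)^{N-n}\,\deg(X).$$
   Context: $(\mathbf P^N)^\circ:=\mathbf P^N\setminus\{x_0\cdots x_N=0\}$. A projective toric variety $X\subset\mathbf P^N$ is the Zariski closure $X_{\mathcal A,\alpha}$ of the image of a monomial map $(\mathbf K^\times)^n\to\mathbf P^N$, $s\mapsto(\alpha_0s^{a_0}:\cdots:\alpha_Ns^{a_N})$, where $\mathcal A=(a_0,\dots,a_N)\in(\mathbf Z^n)^{N+1}$ and $\alpha\in(\mathbf K^\times)^{N+1}$ (all $\alpha_i\neq0$). One may always choose $\mathcal A$ such that the differences of the $a_i$ generate $\mathbf Z^n$, in which case $\dim X=n$. For a projective variety $X\subset\mathbf P^N$ of dimension $n$ with homogeneous ideal $I(X)\subset\mathbf K[x_0,\dots,x_N]$, an open set $U\subset\mathbf P^N$ and $1\le i\le N-n$, the $i$-th successive obstruction index of $X$ relative to $U$ is $$\omega_i(X;U):=\min\{D\in\mathbf N:\ \dim(Z(f: f\in I(X)_D)\cap U)\le N-i\},$$ where $I(X)_D$ is the degree $D$ part of $I(X)$ and $Z(\cdot)$ denotes the set of common zeros in $\mathbf P^N$. *)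

theory Defs
  imports
    "HOL-Analysis.Analysis"
    "HOL-Computational_Algebra.Computational_Algebra"
    "HOL-Library.Poly_Mapping"
begin

section \<open>Polynomials in $x_0, \ldots, x_N$\<close>

text \<open>
  A monomial is a finitely supported exponent vector, a polynomial a finitely supported
  coefficient function on monomials; the ring structure is the one of Poly-Mapping.
\<close>

type_synonym 'k mpoly = "(nat \<Rightarrow>\<^sub>0 nat) \<Rightarrow>\<^sub>0 'k"

definition mvar :: "nat \<Rightarrow> 'k::field mpoly" where
  "mvar i = Poly_Mapping.single (Poly_Mapping.single i 1) 1"

definition monom_degree :: "(nat \<Rightarrow>\<^sub>0 nat) \<Rightarrow> nat" where
  "monom_degree m = (\<Sum>i\<in>Poly_Mapping.keys m. Poly_Mapping.lookup m i)"

definition monom_eval :: "(nat \<Rightarrow> 'k::field) \<Rightarrow> (nat \<Rightarrow>\<^sub>0 nat) \<Rightarrow> 'k" where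
  "monom_eval v m = (\<Prod>i\<in>Poly_Mapping.keys m. v i ^ Poly_Mapping.lookup m i)"

definition mpoly_eval :: "(nat \<Rightarrow> 'k::field) \<Rightarrow> 'k mpoly \<Rightarrow> 'k" where
  "mpoly_eval v f = (\<Sum>m\<in>Poly_Mapping.keys f. Poly_Mapping.lookup f m * monom_eval v m)"

definition mpolys :: "nat \<Rightarrow> 'k::field mpoly set" where
  "mpolys N = {f. \<forall>m\<in>Poly_Mapping.keys f. Poly_Mapping.keys m \<subseteq> {..N}}"

definition forms :: "nat \<Rightarrow> nat \<Rightarrow> 'k::field mpoly set" where
  "forms N D = {f \<in> mpolys N. \<forall>m\<in>Poly_Mapping.keys f. monom_degree m = D}"

definition mpoly_scale :: "'k::field \<Rightarrow> 'k mpoly \<Rightarrow> 'k mpoly" where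
  "mpoly_scale c f = Poly_Mapping.single 0 c * f"

global_interpretation mpoly: vector_space "mpoly_scale :: 'k::field \<Rightarrow> 'k mpoly \<Rightarrow> 'k mpoly"
  defines mpoly_dim = "mpoly.dim"
  by unfold_locales
    (simp_all add: mpoly_scale_def algebra_simps single_add mult_single flip: mult.assoc)


section \<open>Projective space and its Zariski topology\<close>

text \<open>
  A vector of $K^{N+1}$ is a function on the naturals that vanishes beyond $N$; a point of
  projective space is the class of all its vectors of homogeneous coordinates.
\<close>

type_synonym 'k pt = "(nat \<Rightarrow> 'k) set"

definition nonzero_vecs :: "nat \<Rightarrow> (nat \<Rightarrow> 'k::field) set" where
  "nonzero_vecs N = {v. (\<forall>i>N. v i = 0) \<and> (\<exists>i. v i \<noteq> 0)}"

definition proj_rel :: "nat \<Rightarrow> ((nat \<Rightarrow> 'k::field) \<times> (nat \<Rightarrow> 'k)) set" where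
  "proj_rel N = {(v, w). v \<in> nonzero_vecs N \<and> w \<in> nonzero_vecs N \<and>
                         (\<exists>c. c \<noteq> 0 \<and> w = (\<lambda>i. c * v i))}"

definition proj_space :: "nat \<Rightarrow> 'k::field pt set" where
  "proj_space N = nonzero_vecs N // proj_rel N"

text \<open>The class \<open>(x\<^sub>0 : \<dots> : x\<^sub>N)\<close>; only the values \<open>x i\<close> with \<open>i \<le> N\<close> matter.\<close>

definition hom_coords :: "nat \<Rightarrow> (nat \<Rightarrow> 'k::field) \<Rightarrow> 'k pt" where
  "hom_coords N x = proj_rel N `` {\<lambda>i. if i \<le> N then x i else 0}"

definition zero_set :: "nat \<Rightarrow> 'k::field mpoly set \<Rightarrow> 'k pt set" where
  "zero_set N F = {p \<in> proj_space N. \<forall>f\<in>F. \<forall>v\<in>p. mpoly_eval v f = 0}"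

definition zariski :: "nat \<Rightarrow> 'k::field pt topology" where
  "zariski N = topology (\<lambda>U. \<exists>F \<subseteq> (\<Union>D. forms N D). U = proj_space N - zero_set N F)"

definition torus_part :: "nat \<Rightarrow> 'k::field pt set" where
  "torus_part N = proj_space N - zero_set N {\<Prod>i\<le>N. mvar i}"


subsection \<open>The open sets do form a topology\<close>

lemma equiv_proj_rel: "equiv (nonzero_vecs N) (proj_rel N :: ((nat \<Rightarrow> 'k::field) \<times> _) set)"
proof (rule equivI)
  show "proj_rel N \<subseteq> nonzero_vecs N \<times> nonzero_vecs N"
    by (auto simp: proj_rel_def)
  show "refl_on (nonzero_vecs N) (proj_rel N :: ((nat \<Rightarrow> 'k) \<times> _) set)"
    by (auto simp: refl_on_def proj_rel_def intro!: exI[of _ 1])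
  show "sym (proj_rel N :: ((nat \<Rightarrow> 'k) \<times> _) set)"
  proof (rule symI)
    fix v w :: "nat \<Rightarrow> 'k" assume "(v, w) \<in> proj_rel N"
    then obtain c where "v \<in> nonzero_vecs N" "w \<in> nonzero_vecs N" "c \<noteq> 0" "w = (\<lambda>i. c * v i)"
      by (auto simp: proj_rel_def)
    then show "(w, v) \<in> proj_rel N"
      by (auto simp: proj_rel_def intro!: exI[of _ "inverse c"])
  qed
  show "trans (proj_rel N :: ((nat \<Rightarrow> 'k) \<times> _) set)"
  proof (rule transI)
    fix u v w :: "nat \<Rightarrow> 'k" assume "(u, v) \<in> proj_rel N" "(v, w) \<in> proj_rel N"
    then obtain c d where "u \<in> nonzero_vecs N" "w \<in> nonzero_vecs N" "c \<noteq> 0" "d \<noteq> 0"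
      "v = (\<lambda>i. c * u i)" "w = (\<lambda>i. d * v i)"
      by (auto simp: proj_rel_def)
    then show "(u, w) \<in> proj_rel N"
      by (auto simp: proj_rel_def intro!: exI[of _ "d * c"])
  qed
qed

lemma monom_eval_superset:
  assumes "finite S" "Poly_Mapping.keys m \<subseteq> S"
  shows "monom_eval v m = (\<Prod>i\<in>S. v i ^ Poly_Mapping.lookup m i)"
  unfolding monom_eval_def
  by (rule prod.mono_neutral_left) (use assms in \<open>auto simp: in_keys_iff\<close>)

lemma monom_degree_superset:
  assumes "finite S" "Poly_Mapping.keys m \<subseteq> S"
  shows "monom_degree m = (\<Sum>i\<in>S. Poly_Mapping.lookup m i)"
  unfolding monom_degree_def
  by (rule sum.mono_neutral_left) (use assms in \<open>auto simp: in_keys_iff\<close>)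

lemma monom_eval_add: "monom_eval v (m + n) = monom_eval v m * monom_eval v n"
proof -
  let ?S = "Poly_Mapping.keys m \<union> Poly_Mapping.keys n"
  have "Poly_Mapping.keys (m + n) \<subseteq> ?S" by (rule keys_add)
  then show ?thesis
    by (simp add: monom_eval_superset[of ?S] lookup_add power_add prod.distrib)
qed

lemma monom_degree_add: "monom_degree (m + n) = monom_degree m + monom_degree n"
proof -
  let ?S = "Poly_Mapping.keys m \<union> Poly_Mapping.keys n"
  have "Poly_Mapping.keys (m + n) \<subseteq> ?S" by (rule keys_add)
  then show ?thesis
    by (simp add: monom_degree_superset[of ?S] lookup_add sum.distrib)
qed

lemma mpoly_eval_superset:
  assumes "finite S" "Poly_Mapping.keys f \<subseteq> S"
  shows "mpoly_eval v f = (\<Sum>m\<in>S. Poly_Mapping.lookup f m * monom_eval v m)"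
  unfolding mpoly_eval_def
  by (rule sum.mono_neutral_left) (use assms in \<open>auto simp: in_keys_iff\<close>)

lemma mpoly_eval_zero [simp]: "mpoly_eval v 0 = 0"
  by (simp add: mpoly_eval_def)

lemma mpoly_eval_add: "mpoly_eval v (f + g) = mpoly_eval v f + mpoly_eval v g"
proof -
  let ?S = "Poly_Mapping.keys f \<union> Poly_Mapping.keys g"
  have "Poly_Mapping.keys (f + g) \<subseteq> ?S" by (rule keys_add)
  then show ?thesis
    by (simp add: mpoly_eval_superset[of ?S] lookup_add sum.distrib ring_distribs)
qed

lemma mpoly_eval_sum: "mpoly_eval v (sum f A) = (\<Sum>a\<in>A. mpoly_eval v (f a))"
  by (induction A rule: infinite_finite_induct) (auto simp: mpoly_eval_add)

lemma mpoly_eval_single: "mpoly_eval v (Poly_Mapping.single m c) = c * monom_eval v m"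
  by (cases "c = 0") (auto simp: mpoly_eval_def)

lemma mpoly_sum_monomials:
  fixes f :: "'k::field mpoly"
  shows "f = (\<Sum>m\<in>Poly_Mapping.keys f. Poly_Mapping.single m (Poly_Mapping.lookup f m))"
proof (rule poly_mapping_eqI)
  fix n
  have "(\<Sum>m\<in>Poly_Mapping.keys f. Poly_Mapping.lookup f m when m = n) =
        (\<Sum>m\<in>Poly_Mapping.keys f. if m = n then Poly_Mapping.lookup f m else 0)"
    by (simp add: when_def)
  also have "\<dots> = Poly_Mapping.lookup f n"
    by (simp add: sum.delta in_keys_iff)
  finally show "Poly_Mapping.lookup f n =
      Poly_Mapping.lookup (\<Sum>m\<in>Poly_Mapping.keys f. Poly_Mapping.single m (Poly_Mapping.lookup f m)) n"
    by (simp add: lookup_sum lookup_single)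
qed

lemma mpoly_eval_mult: "mpoly_eval v (f * g) = mpoly_eval v f * mpoly_eval v g"
proof -
  have "f * g = (\<Sum>m\<in>Poly_Mapping.keys f. \<Sum>n\<in>Poly_Mapping.keys g.
      Poly_Mapping.single (m + n) (Poly_Mapping.lookup f m * Poly_Mapping.lookup g n))"
    by (subst (1) mpoly_sum_monomials[of f], subst (1) mpoly_sum_monomials[of g])
       (simp add: sum_product mult_single)
  then show ?thesis
    by (simp add: mpoly_eval_sum mpoly_eval_single monom_eval_add)
       (simp add: mpoly_eval_def sum_product mult_ac)
qed

lemma forms_mult:
  assumes "f \<in> forms N D" "g \<in> forms N E"
  shows "f * g \<in> forms N (D + E)"
proof -
  have "Poly_Mapping.keys k \<subseteq> {..N} \<and> monom_degree k = D + E"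
    if k: "k \<in> Poly_Mapping.keys (f * g)" for k
  proof -
    obtain m n where "m \<in> Poly_Mapping.keys f" "n \<in> Poly_Mapping.keys g" "k = m + n"
      using k keys_mult[of f g] by blast
    then show ?thesis
      using assms keys_add[of m n] by (fastforce simp: forms_def mpolys_def monom_degree_add)
  qed
  then show ?thesis by (auto simp: forms_def mpolys_def)
qed

lemma mpoly_eval_scale:
  assumes "f \<in> forms N D"
  shows "mpoly_eval (\<lambda>i. c * v i) f = c ^ D * mpoly_eval v f"
proof -
  have "monom_eval (\<lambda>i. c * v i) m = c ^ D * monom_eval v m" if "m \<in> Poly_Mapping.keys f" for m
  proof -
    have "monom_degree m = D" using assms that by (auto simp: forms_def)
    then show ?thesis
      by (auto simp: monom_eval_def monom_degree_def power_mult_distrib prod.distrib power_sum)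
  qed
  then show ?thesis
    by (simp add: mpoly_eval_def sum_distrib_left mult_ac)
qed

lemma zero_set_homogeneous:
  assumes "f \<in> forms N D" "p \<in> proj_space N" "v \<in> p" "w \<in> p" "mpoly_eval v f = 0"
  shows "mpoly_eval w f = 0"
proof -
  have "(v, w) \<in> proj_rel N"
    using quotient_eq_iff[OF equiv_proj_rel, of p N p v w] assms by (simp add: proj_space_def)
  then show ?thesis
    using mpoly_eval_scale[OF assms(1)] assms(5) by (auto simp: proj_rel_def)
qed

lemma proj_space_nonempty: "p \<in> proj_space N \<Longrightarrow> \<exists>v. v \<in> p"
  using in_quotient_imp_non_empty[OF equiv_proj_rel] by (fastforce simp: proj_space_def)

lemma zero_set_Un:
  assumes "F \<subseteq> (\<Union>D. forms N D)" "G \<subseteq> (\<Union>D. forms N D)"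
  shows "zero_set N F \<union> zero_set N G = zero_set N {f * g |f g. f \<in> F \<and> g \<in> G}" (is "_ = ?R")
proof
  show "zero_set N F \<union> zero_set N G \<subseteq> ?R"
    by (auto simp: zero_set_def mpoly_eval_mult)
  show "?R \<subseteq> zero_set N F \<union> zero_set N G"
  proof
    fix p assume p: "p \<in> ?R"
    then have P: "p \<in> proj_space N" by (simp add: zero_set_def)
    show "p \<in> zero_set N F \<union> zero_set N G"
    proof (rule ccontr)
      assume "\<not> ?thesis"
      then obtain f v g w where *: "f \<in> F" "v \<in> p" "mpoly_eval v f \<noteq> 0"
          "g \<in> G" "w \<in> p" "mpoly_eval w g \<noteq> 0"
        using P by (auto simp: zero_set_def)
      then have "mpoly_eval v g \<noteq> 0"
        using zero_set_homogeneous[OF _ P] assms(2) by blast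
      moreover have "mpoly_eval v (f * g) = 0"
        using p * by (auto simp: zero_set_def)
      ultimately show False using * by (simp add: mpoly_eval_mult)
    qed
  qed
qed

lemma istopology_zariski:
  "istopology (\<lambda>U::'k::field pt set.
      \<exists>F \<subseteq> (\<Union>D. forms N D). U = proj_space N - zero_set N F)"
  unfolding istopology_def
proof (intro conjI allI impI)
  fix U V :: "'k pt set"
  assume "\<exists>F \<subseteq> (\<Union>D. forms N D). U = proj_space N - zero_set N F"
    and "\<exists>F \<subseteq> (\<Union>D. forms N D). V = proj_space N - zero_set N F"
  then obtain F G where FG: "F \<subseteq> (\<Union>D. forms N D)" "U = proj_space N - zero_set N F"
    "G \<subseteq> (\<Union>D. forms N D)" "V = proj_space N - zero_set N G"
    by blast
  have "{f * g |f g. f \<in> F \<and> g \<in> G} \<subseteq> (\<Union>D. forms N D)"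
  proof (clarify, goal_cases)
    case (1 _ f g)
    then obtain D E where "f \<in> forms N D" "g \<in> forms N E" using FG by blast
    then show ?case using forms_mult by blast
  qed
  moreover have "U \<inter> V = proj_space N - zero_set N {f * g |f g. f \<in> F \<and> g \<in> G}"
    unfolding zero_set_Un[OF FG(1,3), symmetric] FG by blast
  ultimately show "\<exists>F \<subseteq> (\<Union>D. forms N D). U \<inter> V = proj_space N - zero_set N F"
    by blast
next
  fix \<U> :: "'k pt set set"
  assume *: "\<forall>U\<in>\<U>. \<exists>F \<subseteq> (\<Union>D. forms N D). U = proj_space N - zero_set N F"
  then obtain F where F: "\<And>U. U \<in> \<U> \<Longrightarrow> F U \<subseteq> (\<Union>D. forms N D)"
      "\<And>U. U \<in> \<U> \<Longrightarrow> U = proj_space N - zero_set N (F U)"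
    by metis
  have "zero_set N (\<Union>(F ` \<U>)) = {p \<in> proj_space N. \<forall>U\<in>\<U>. p \<in> zero_set N (F U)}"
    by (auto simp: zero_set_def)
  then have "\<Union>\<U> = proj_space N - zero_set N (\<Union>(F ` \<U>))"
    using F(2) by blast
  moreover have "\<Union>(F ` \<U>) \<subseteq> (\<Union>D. forms N D)" using F(1) by blast
  ultimately show "\<exists>F \<subseteq> (\<Union>D. forms N D). \<Union>\<U> = proj_space N - zero_set N F"
    by blast
qed

lemma openin_zariski:
  "openin (zariski N) U \<longleftrightarrow> (\<exists>F \<subseteq> (\<Union>D. forms N D). U = proj_space N - zero_set N F)"
  unfolding zariski_def by (simp add: topology_inverse' istopology_zariski)

lemma topspace_zariski: "topspace (zariski N) = (proj_space N :: 'k::field pt set)"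
proof
  show "topspace (zariski N) \<subseteq> (proj_space N :: 'k pt set)"
    by (auto simp: topspace_def openin_zariski)
  have "1 \<in> forms N 0"
    by (auto simp: forms_def mpolys_def monom_degree_def)
  moreover have "zero_set N {1 :: 'k mpoly} = {}"
    using proj_space_nonempty
    by (auto simp: zero_set_def mpoly_eval_def monom_eval_def)
  ultimately have "openin (zariski N) (proj_space N :: 'k pt set)"
    unfolding openin_zariski by (intro exI[of _ "{1}"]) auto
  then show "(proj_space N :: 'k pt set) \<subseteq> topspace (zariski N)"
    by (rule openin_subset)
qed

lemma closedin_zariski:
  "closedin (zariski N) C \<longleftrightarrow> (\<exists>F \<subseteq> (\<Union>D. forms N D). C = zero_set N F)"
proof -
  have "zero_set N F \<subseteq> proj_space N" for F :: "'a mpoly set"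
    by (auto simp: zero_set_def)
  then show ?thesis
    unfolding closedin_def openin_zariski topspace_zariski by (metis Diff_Diff_Int double_diff subset_refl
      Diff_subset)
qed


section \<open>Dimension\<close>

definition irreducible_closedin :: "'a topology \<Rightarrow> 'a set \<Rightarrow> bool" where
  "irreducible_closedin T Z \<longleftrightarrow> closedin T Z \<and> Z \<noteq> {} \<and>
     (\<forall>A B. closedin T A \<longrightarrow> closedin T B \<longrightarrow> Z = A \<union> B \<longrightarrow> A = Z \<or> B = Z)"

text \<open>The empty space has dimension \<open>-\<infinity>\<close>, the supremum of the empty set.\<close>

definition krull_dim :: "'a topology \<Rightarrow> ereal" where
  "krull_dim T = Sup {ereal (real k) | k. \<exists>Z :: nat \<Rightarrow> 'a set.
      (\<forall>i\<le>k. irreducible_closedin T (Z i)) \<and> (\<forall>i<k. Z i \<subset> Z (Suc i))}"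

definition proj_dim :: "nat \<Rightarrow> 'k::field pt set \<Rightarrow> ereal" where
  "proj_dim N S = krull_dim (subtopology (zariski N) S)"


section \<open>Homogeneous ideal, degree and obstruction indices\<close>

text \<open>
  A polynomial lies in the ideal if it vanishes at all homogeneous coordinate vectors of all
  points of \<open>X\<close>. Over an infinite field this is the ideal generated by the forms that
  vanish on \<open>X\<close>.
\<close>

definition hom_ideal :: "nat \<Rightarrow> 'k::field pt set \<Rightarrow> 'k mpoly set" where
  "hom_ideal N X = {f \<in> mpolys N. \<forall>p\<in>X. \<forall>v\<in>p. mpoly_eval v f = 0}"

definition hom_ideal_part :: "nat \<Rightarrow> 'k::field pt set \<Rightarrow> nat \<Rightarrow> 'k mpoly set" where
  "hom_ideal_part N X D = hom_ideal N X \<inter> forms N D"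

text \<open>
  The dimension of the degree \<open>D\<close> part of the homogeneous coordinate ring. The space of forms
  of degree \<open>D\<close> is finite-dimensional and contains \<open>hom_ideal_part N X D\<close>, so the truncated
  subtraction computes the dimension of the quotient.
\<close>

definition hilbert_function :: "nat \<Rightarrow> 'k::field pt set \<Rightarrow> nat \<Rightarrow> nat" where
  "hilbert_function N X D = mpoly_dim (forms N D :: 'k mpoly set) - mpoly_dim (hom_ideal_part N X D)"

definition hilbert_polynomial :: "nat \<Rightarrow> 'k::field pt set \<Rightarrow> real poly" where
  "hilbert_polynomial N X =
     (THE P. \<forall>\<^sub>F D in sequentially. real (hilbert_function N X D) = poly P (real D))"

definition proj_degree :: "nat \<Rightarrow> 'k::field pt set \<Rightarrow> real" where
  "proj_degree N X = fact (degree (hilbert_polynomial N X)) * lead_coeff (hilbert_polynomial N X)"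

definition obstruction_index :: "nat \<Rightarrow> 'k::field pt set \<Rightarrow> 'k pt set \<Rightarrow> nat \<Rightarrow> nat" where
  "obstruction_index N X U i =
     (LEAST D. proj_dim N (zero_set N (hom_ideal_part N X D) \<inter> U) \<le> ereal (real N - real i))"


section \<open>Projective toric varieties\<close>

text \<open>
  The point $(\alpha_0 s^{a_0} : \cdots : \alpha_N s^{a_N})$ for \<open>s\<close> in the \<open>r\<close>-dimensional torus, where \<open>A i j\<close>
  is the \<open>j\<close>-th component of $a_i$. Only indices \<open>i \<le> N\<close> and \<open>j < r\<close> matter.
\<close>

definition monomial_map ::
  "nat \<Rightarrow> nat \<Rightarrow> (nat \<Rightarrow> nat \<Rightarrow> int) \<Rightarrow> (nat \<Rightarrow> 'k) \<Rightarrow> (nat \<Rightarrow> 'k) \<Rightarrow> 'k::field pt" where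
  "monomial_map N r A \<alpha> s = hom_coords N (\<lambda>i. \<alpha> i * (\<Prod>j<r. s j powi A i j))"

definition toric_variety_of ::
  "nat \<Rightarrow> nat \<Rightarrow> (nat \<Rightarrow> nat \<Rightarrow> int) \<Rightarrow> (nat \<Rightarrow> 'k) \<Rightarrow> 'k::field pt set" where
  "toric_variety_of N r A \<alpha> =
     zariski N closure_of (monomial_map N r A \<alpha> ` {s. \<forall>j<r. s j \<noteq> 0})"

text \<open>
  The differences of the exponents are not required to generate the lattice, so the rank \<open>r\<close>
  of the torus may exceed the dimension of the variety.
\<close>

definition projective_toric_variety :: "nat \<Rightarrow> 'k::field pt set \<Rightarrow> bool" where
  "projective_toric_variety N X \<longleftrightarrow>
     (\<exists>r A \<alpha>. (\<forall>i\<le>N. \<alpha> i \<noteq> 0) \<and> X = toric_variety_of N r A \<alpha>)"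

end

theory Submission
  imports Defs "HOL-Library.Function_Algebras"
begin

text \<open>
  In the torus, \<open>X\<close> is a coset of the subtorus dual to a saturated lattice \<open>L\<close> of rank
  \<open>k = N - n\<close>, and the forms of degree \<open>D\<close> in its ideal are spanned by the binomials
  attached to the \<open>u \<in> L\<close> of norm at most \<open>D\<close>, where the norm of \<open>u\<close> is the
  degree of that binomial. Hence \<open>\<omega>\<^sub>i\<close> is the \<open>i\<close>-th successive
  minimum \<open>\<lambda>\<^sub>i\<close> of \<open>L\<close>, and the Hilbert function counts the monomials of
  degree \<open>D\<close> modulo \<open>L\<close>.

  For the lower bound on \<open>\<lambda>\<^sub>1 \<dots> \<lambda>\<^sub>k\<close>, adding a vector of norm
  \<open>\<lambda>\<close> to a lattice turns the class count \<open>H\<close> into a function bounded by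
  \<open>H D - H (D - \<lambda>)\<close>, as in Bezout's theorem. The upper bound
  \<open>\<lambda>\<^sub>1 \<dots> \<lambda>\<^sub>k \<le> (N! / n!) deg X\<close> follows the proof of Minkowski's second
  theorem: below degree \<open>\<lambda>\<^bsub>i+1\<^esub>\<close> only the rank \<open>i\<close> part of
  \<open>L\<close> identifies monomials, and dilating the simplex by \<open>t\<close> multiplies the number of classes
  modulo that part by at least \<open>t ^ (N - i)\<close>, asymptotically for the finer lattices \<open>q L\<close>.
\<close>

section \<open>Exponent vectors\<close>

text \<open>Two obstacles shape the proof. The vectors \<open>u l\<close> realising the minima need
  not generate a saturated lattice, so the torus points cut out by their binomials may form several
  components that no single monomial map parametrises. Their dimension is therefore bounded by
  counting classes modulo the span of the \<open>u l\<close>: a chain of irreducible closed sets of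
  length m forces growth of order at least \<open>D ^ m\<close>. The count that controls the degree
  thus controls the dimension as well. Secondly, moving classes from one dilate of the simplex to
  another requires lattice vectors to be corrected to genuine monomials, at the cost of a bounded
  degree. For the lattice q L the relevant degrees grow with q while the cost does not, so it
  disappears as q tends to infinity; this replaces the passage from lattice points to volumes. The
  index \<open>q ^ k\<close> of q L in L is divided out at the end. The N! comes from counting about
  \<open>D ^ N / N!\<close> monomials, the n! from the normalisation of the degree. Their quotient
  is a product of N - n factors, each at most N + 1.\<close>

text \<open>
  Monomials of degree \<open>D\<close> are dehomogenised: the exponent of \<open>x\<^bsub>i+1\<^esub>\<close> is the
  \<open>i\<close>-th entry of a vector in \<open>pts N D\<close>, and the exponent of \<open>x\<^sub>0\<close> is determined by
  the degree. Accordingly \<open>nrm N u\<close> is the degree of the homogeneous binomial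
  \<open>x\<^bsup>u+\<^esup> - x\<^bsup>u-\<^esup>\<close>.
\<close>

type_synonym vec = "nat \<Rightarrow> int"

definition vecs :: "nat \<Rightarrow> vec set" where
  "vecs N = {v. \<forall>i\<ge>N. v i = 0}"

definition zmul :: "int \<Rightarrow> vec \<Rightarrow> vec" where
  "zmul c v = (\<lambda>i. c * v i)"

definition pts :: "nat \<Rightarrow> nat \<Rightarrow> vec set" where
  "pts N D = {v \<in> vecs N. (\<forall>i. 0 \<le> v i) \<and> (\<Sum>i<N. v i) \<le> int D}"

definition ppart :: "vec \<Rightarrow> vec" where
  "ppart v = (\<lambda>i. max (v i) 0)"

definition nrm :: "nat \<Rightarrow> vec \<Rightarrow> nat" where
  "nrm N v = nat (max (\<Sum>i<N. ppart v i) (\<Sum>i<N. ppart (- v) i))"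

definition subgrp :: "vec set \<Rightarrow> bool" where
  "subgrp R \<longleftrightarrow> 0 \<in> R \<and> (\<forall>u\<in>R. \<forall>v\<in>R. u - v \<in> R)"

definition additive :: "(vec \<Rightarrow> int) \<Rightarrow> bool" where
  "additive f \<longleftrightarrow> (\<forall>u v. f (u + v) = f u + f v)"

lemma uminus_fun_apply' [simp]: "(- v) i = - (v i)" for v :: vec
  by (simp add: fun_Compl_def)

lemma minus_fun_apply' [simp]: "(u - v) i = u i - v i" for u v :: vec
  by (simp add: fun_diff_def)

lemma zmul_apply: "zmul c v i = c * v i"
  by (simp add: zmul_def)

lemma zmul_simps [simp]: "zmul 0 v = 0" "zmul 1 v = v" "zmul c 0 = 0"
  by (auto simp: zmul_def)

lemma zmul_distrib:
  "zmul (a + b) v = zmul a v + zmul b v" "zmul (a - b) v = zmul a v - zmul b v"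
  "zmul a (v + w) = zmul a v + zmul a w" "zmul a (v - w) = zmul a v - zmul a w"
  by (auto simp: zmul_def fun_eq_iff algebra_simps)

lemma vecs_closed:
  "0 \<in> vecs N" "u \<in> vecs N \<Longrightarrow> v \<in> vecs N \<Longrightarrow> u + v \<in> vecs N"
  "u \<in> vecs N \<Longrightarrow> v \<in> vecs N \<Longrightarrow> u - v \<in> vecs N" "u \<in> vecs N \<Longrightarrow> zmul c u \<in> vecs N"
  by (auto simp: vecs_def zmul_apply)

lemma ppart_vecs: "v \<in> vecs N \<Longrightarrow> ppart v \<in> vecs N" "v \<in> vecs N \<Longrightarrow> ppart (- v) \<in> vecs N"
  by (auto simp: vecs_def ppart_def)

lemma ppart_diff: "ppart v - ppart (- v) = v"
  by (auto simp: ppart_def fun_eq_iff)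

lemma pts_vecs: "v \<in> pts N D \<Longrightarrow> v \<in> vecs N"
  by (simp add: pts_def)

lemma pts_mono: "D \<le> E \<Longrightarrow> pts N D \<subseteq> pts N E"
  by (auto simp: pts_def)

lemma pts_add: "u \<in> pts N D \<Longrightarrow> v \<in> pts N E \<Longrightarrow> u + v \<in> pts N (D + E)"
  by (auto simp: pts_def vecs_def sum.distrib)

lemma pts_component: "v \<in> pts N D \<Longrightarrow> v i \<le> int D"
proof (cases "i < N")
  case True
  assume v: "v \<in> pts N D"
  have "v i \<le> (\<Sum>i<N. v i)"
    by (rule member_le_sum) (use v True in \<open>auto simp: pts_def\<close>)
  then show ?thesis using v by (auto simp: pts_def)
qed (auto simp: pts_def vecs_def)

lemma finite_bounded_vecs: "finite {v \<in> vecs N. \<forall>i. \<bar>v i\<bar> \<le> B}"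
proof (rule finite_subset)
  show "{v \<in> vecs N. \<forall>i. \<bar>v i\<bar> \<le> B} \<subseteq>
      {v. \<forall>i. (i \<in> {..<N} \<longrightarrow> v i \<in> {-B..B}) \<and> (i \<notin> {..<N} \<longrightarrow> v i = 0)}"
    by (auto simp: vecs_def abs_le_iff) (smt (verit, best))
  show "finite {v. \<forall>i. (i \<in> {..<N} \<longrightarrow> v i \<in> {-B..B}) \<and> (i \<notin> {..<N} \<longrightarrow> v i = (0::int))}"
    by (rule finite_set_of_finite_funs) auto
qed

lemma finite_pts [simp]: "finite (pts N D)"
proof (rule finite_subset[OF _ finite_bounded_vecs[of N "int D"]])
  show "pts N D \<subseteq> {v \<in> vecs N. \<forall>i. \<bar>v i\<bar> \<le> int D}"
    using pts_component by (force simp: pts_def)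
qed

lemma nrm_parts:
  assumes "v \<in> vecs N"
  shows "ppart v \<in> pts N (nrm N v)" "ppart (- v) \<in> pts N (nrm N v)"
proof -
  have "0 \<le> (\<Sum>i<N. ppart v i)" by (intro sum_nonneg) (auto simp: ppart_def)
  then show "ppart v \<in> pts N (nrm N v)" "ppart (- v) \<in> pts N (nrm N v)"
    using assms by (auto simp: pts_def nrm_def ppart_vecs) (auto simp: ppart_def)
qed

text \<open>Subtraction only cancels: the positive part of \<open>u - v\<close> is at most
  \<open>u\<close> entrywise. With \<open>nrm_parts\<close> this makes \<open>nrm\<close> the norm
  of the difference body of the simplex: the vectors of \<open>vecs N\<close> of norm at most
  \<open>D\<close> are exactly the differences of two points of \<open>pts N D\<close>.\<close>

lemma nrm_diff_le:
  assumes "u \<in> pts N D" "v \<in> pts N D"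
  shows "nrm N (u - v) \<le> D"
proof -
  have "(\<Sum>i<N. ppart (u - v) i) \<le> (\<Sum>i<N. u i)" "(\<Sum>i<N. ppart (- (u - v)) i) \<le> (\<Sum>i<N. v i)"
    using assms by (auto intro!: sum_mono simp: ppart_def pts_def)
  then show ?thesis using assms by (auto simp: nrm_def pts_def)
qed

lemma nrm_zmul: "nrm N (zmul (int q) v) = q * nrm N v"
proof -
  have "ppart (zmul (int q) v) i = int q * ppart v i"
       "ppart (- zmul (int q) v) i = int q * ppart (- v) i" for i
    by (auto simp: ppart_def zmul_apply max_mult_distrib_left)
  then have "nrm N (zmul (int q) v) = nat (max (int q * (\<Sum>i<N. ppart v i)) (int q * (\<Sum>i<N. ppart (- v) i)))"
    by (simp add: nrm_def sum_distrib_left)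
  also have "\<dots> = nat (int q * max (\<Sum>i<N. ppart v i) (\<Sum>i<N. ppart (- v) i))"
    by (simp add: max_mult_distrib_left)
  finally show ?thesis by (simp add: nrm_def nat_mult_distrib)
qed

lemma nrm_pos:
  assumes "v \<in> vecs N" "v \<noteq> 0"
  shows "nrm N v > 0"
proof (rule ccontr)
  assume "\<not> ?thesis"
  then have "nrm N v = 0" by simp
  then have "ppart v \<in> pts N 0" "ppart (- v) \<in> pts N 0"
    using nrm_parts[OF assms(1)] by auto
  then have "ppart v i = 0 \<and> ppart (- v) i = 0" for i
    using pts_component[of "ppart v" N 0 i] pts_component[of "ppart (-v)" N 0 i]
    by (auto simp: pts_def intro: antisym)
  then have "v i = 0" for i
    by (metis (mono_tags, lifting) ppart_diff minus_fun_apply' diff_zero)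
  then show False using assms(2) by auto
qed

section \<open>Subgroups and additive functionals\<close>

lemma subgrpD:
  assumes "subgrp R"
  shows "0 \<in> R" "u \<in> R \<Longrightarrow> v \<in> R \<Longrightarrow> u - v \<in> R" "u \<in> R \<Longrightarrow> v \<in> R \<Longrightarrow> u + v \<in> R"
    "u \<in> R \<Longrightarrow> - u \<in> R" "u \<in> R \<Longrightarrow> zmul c u \<in> R"
proof -
  show 0: "0 \<in> R" and d: "\<And>u v. u \<in> R \<Longrightarrow> v \<in> R \<Longrightarrow> u - v \<in> R"
    using assms by (auto simp: subgrp_def)
  show m: "- u \<in> R" if "u \<in> R" for u using d[OF 0 that] by simp
  show a: "u + v \<in> R" if "u \<in> R" "v \<in> R" for u v using d[OF that(1) m[OF that(2)]] by simp
  have n: "zmul (int n) u \<in> R" if "u \<in> R" for n u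
  proof (induction n)
    case (Suc n)
    have "zmul (int (Suc n)) u = zmul (int n) u + u" by (simp add: fun_eq_iff algebra_simps zmul_apply)
    then show ?case using a[OF Suc that] by metis
  qed (use 0 in \<open>metis zmul_simps(1) of_nat_0\<close>)
  show "zmul c u \<in> R" if "u \<in> R"
  proof (cases "0 \<le> c")
    case True then show ?thesis using n[OF that, of "nat c"] by simp
  next
    case False
    have "zmul c u = - zmul (int (nat (- c))) u" using False by (auto simp: fun_eq_iff zmul_apply)
    then show ?thesis using m[OF n[OF that]] by metis
  qed
qed

lemma additiveD:
  assumes "additive f"
  shows "f (u + v) = f u + f v" "f 0 = 0" "f (- u) = - f u" "f (u - v) = f u - f v"
    "f (zmul c u) = c * f u"
proof -
  show a: "\<And>u v. f (u + v) = f u + f v" using assms by (auto simp: additive_def)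
  show 0: "f 0 = 0" using a[of 0 0] by simp
  show m: "f (- u) = - f u" for u using a[of u "- u"] 0 by simp
  show "f (u - v) = f u - f v" using a[of u "- v"] m by simp
  have n: "f (zmul (int n) u) = int n * f u" for n u
  proof (induction n)
    case (Suc n)
    have "zmul (int (Suc n)) u = zmul (int n) u + u" by (simp add: fun_eq_iff algebra_simps zmul_apply)
    then have "f (zmul (int (Suc n)) u) = f (zmul (int n) u) + f u" using a by metis
    then show ?case unfolding Suc.IH by (simp add: algebra_simps)
  qed (use 0 in \<open>metis zmul_simps(1) of_nat_0 mult_zero_left\<close>)
  show "f (zmul c u) = c * f u"
  proof (cases "0 \<le> c")
    case True then show ?thesis using n[of "nat c" u] by simp
  next
    case False
    have "zmul c u = - zmul (int (nat (- c))) u" using False by (auto simp: fun_eq_iff zmul_apply)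
    then show ?thesis using m n[of "nat (- c)" u] False by auto
  qed
qed

lemma additive_sum: "additive f \<Longrightarrow> f (\<Sum>i\<in>I. g i) = (\<Sum>i\<in>I. f (g i))"
  by (induction I rule: infinite_finite_induct) (auto simp: additiveD)

definition unit_vec :: "nat \<Rightarrow> vec" where
  "unit_vec i = (\<lambda>j. if j = i then 1 else 0)"

lemma vec_expand: "v \<in> vecs N \<Longrightarrow> v = (\<Sum>i<N. zmul (v i) (unit_vec i))"
proof (rule ext)
  fix j assume v: "v \<in> vecs N"
  have "(\<Sum>i<N. zmul (v i) (unit_vec i)) j = (\<Sum>i<N. v i * (if j = i then 1 else 0))"
    by (induction N) (auto simp: unit_vec_def zmul_apply)
  also have "\<dots> = v j" using v by (auto simp: vecs_def if_distrib sum.delta cong: if_cong)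
  finally show "v j = (\<Sum>i<N. zmul (v i) (unit_vec i)) j" by simp
qed

lemma additive_expand: "additive f \<Longrightarrow> v \<in> vecs N \<Longrightarrow> f v = (\<Sum>i<N. v i * f (unit_vec i))"
  by (subst vec_expand[of v N]) (auto simp: additive_sum additiveD)

section \<open>Adapted coordinates and successive minima\<close>

text \<open>Unimodularity is encoded as bijectivity of the coordinate map from \<open>vecs N\<close>
  to integer N-tuples, so no matrix has to be carried along; a change of basis is a sequence of
  swaps and shears.\<close>

definition coords :: "nat \<Rightarrow> (nat \<Rightarrow> vec \<Rightarrow> int) \<Rightarrow> bool" where
  "coords N \<Phi> \<longleftrightarrow> (\<forall>j. additive (\<Phi> j)) \<and> (\<forall>y. \<exists>v\<in>vecs N. \<forall>j<N. \<Phi> j v = y j) \<and>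
     (\<forall>v\<in>vecs N. (\<forall>j<N. \<Phi> j v = 0) \<longrightarrow> v = 0)"

text \<open>A kernel of integer functionals, hence saturated. Under \<open>coords N \<Phi>\<close>
  and \<open>i \<le> N\<close> it is spanned by the first \<open>i\<close> vectors of the basis dual
  to \<open>\<Phi>\<close>.\<close>

definition flag :: "nat \<Rightarrow> (nat \<Rightarrow> vec \<Rightarrow> int) \<Rightarrow> nat \<Rightarrow> vec set" where
  "flag N \<Phi> i = {v \<in> vecs N. \<forall>j. i \<le> j \<longrightarrow> j < N \<longrightarrow> \<Phi> j v = 0}"

lemma coordsD:
  assumes "coords N \<Phi>"
  shows "additive (\<Phi> j)" "\<exists>v\<in>vecs N. \<forall>j<N. \<Phi> j v = y j"
    "v \<in> vecs N \<Longrightarrow> (\<And>j. j < N \<Longrightarrow> \<Phi> j v = 0) \<Longrightarrow> v = 0"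
proof -
  note c = assms[unfolded coords_def]
  show "additive (\<Phi> j)" using c by simp
  show "\<exists>v\<in>vecs N. \<forall>j<N. \<Phi> j v = y j" using c by simp
  show "v \<in> vecs N \<Longrightarrow> (\<And>j. j < N \<Longrightarrow> \<Phi> j v = 0) \<Longrightarrow> v = 0" using c by simp
qed

lemma subgrp_flag: "coords N \<Phi> \<Longrightarrow> subgrp (flag N \<Phi> i)"
  by (auto simp: subgrp_def flag_def vecs_closed additiveD coordsD(1))

lemma coords_swap:
  assumes c: "coords N \<Phi>" and ab: "a < N" "b < N"
  shows "coords N (\<Phi>(a := \<Phi> b, b := \<Phi> a))" (is "coords N ?\<Psi>")
  unfolding coords_def
proof (intro conjI allI ballI impI)
  show "additive (?\<Psi> j)" for j using coordsD(1)[OF c] by auto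
  fix y :: "nat \<Rightarrow> int"
  obtain v where "v \<in> vecs N" "\<forall>j<N. \<Phi> j v = (y(a := y b, b := y a)) j"
    using coordsD(2)[OF c] by blast
  then show "\<exists>v\<in>vecs N. \<forall>j<N. ?\<Psi> j v = y j"
    using ab by (intro bexI[of _ v]) (auto split: if_splits)
next
  fix v assume v: "v \<in> vecs N" and z: "\<forall>j<N. ?\<Psi> j v = 0"
  show "v = 0"
  proof (rule coordsD(3)[OF c v])
    fix j assume "j < N"
    then show "\<Phi> j v = 0" using z[rule_format, of j] z[rule_format, OF ab(1)] z[rule_format, OF ab(2)]
      by (auto split: if_splits)
  qed
qed

lemma coords_shear:
  assumes c: "coords N \<Phi>" and ab: "a < N" "b < N" "a \<noteq> b"
  shows "coords N (\<Phi>(a := (\<lambda>v. \<Phi> a v + e * \<Phi> b v)))" (is "coords N ?\<Psi>")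
  unfolding coords_def
proof (intro conjI allI ballI impI)
  show "additive (?\<Psi> j)" for j
    using coordsD(1)[OF c] by (auto simp: additive_def algebra_simps)
  fix y :: "nat \<Rightarrow> int"
  obtain v where "v \<in> vecs N" "\<forall>j<N. \<Phi> j v = (y(a := y a - e * y b)) j"
    using coordsD(2)[OF c] by blast
  then show "\<exists>v\<in>vecs N. \<forall>j<N. ?\<Psi> j v = y j"
    using ab by (intro bexI[of _ v]) (auto split: if_splits)
next
  fix v assume v: "v \<in> vecs N" and z: "\<forall>j<N. ?\<Psi> j v = 0"
  show "v = 0"
  proof (rule coordsD(3)[OF c v])
    fix j assume "j < N"
    then show "\<Phi> j v = 0" using z[rule_format, of j] z[rule_format, OF ab(1)] z[rule_format, OF ab(2)] ab(3)
      by (auto split: if_splits)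
  qed
qed

text \<open>Euclid's algorithm on the coordinates of \<open>w\<close> from index \<open>i\<close> on.\<close>

lemma coords_reduce:
  assumes "coords N \<Phi>" "i < N"
  shows "\<exists>\<Psi>. coords N \<Psi> \<and> (\<forall>j<i. \<Psi> j = \<Phi> j) \<and> flag N \<Psi> i = flag N \<Phi> i \<and>
    (\<forall>j. i < j \<longrightarrow> j < N \<longrightarrow> \<Psi> j w = 0)"
  using assms(1)
proof (induction "nat (\<Sum>j\<in>{i..<N}. \<bar>\<Phi> j w\<bar>)" arbitrary: \<Phi> rule: less_induct)
  case less
  note c = less.prems
  consider (two) a b where "a \<in> {i..<N}" "b \<in> {i..<N}" "a \<noteq> b" "\<Phi> b w \<noteq> 0" "\<bar>\<Phi> b w\<bar> \<le> \<bar>\<Phi> a w\<bar>"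
    | (one) a where "a \<in> {i..<N}" "\<forall>j\<in>{i..<N}. j \<noteq> a \<longrightarrow> \<Phi> j w = 0"
  proof (cases "\<exists>a\<in>{i..<N}. \<exists>b\<in>{i..<N}. a \<noteq> b \<and> \<Phi> a w \<noteq> 0 \<and> \<Phi> b w \<noteq> 0")
    case True
    then obtain a b where "a\<in>{i..<N}" "b\<in>{i..<N}" "a \<noteq> b" "\<Phi> a w \<noteq> 0" "\<Phi> b w \<noteq> 0" by blast
    then show ?thesis using two[of a b] two[of b a] by (metis linear)
  next
    case False
    show ?thesis
    proof (cases "\<exists>a\<in>{i..<N}. \<Phi> a w \<noteq> 0")
      case True then show ?thesis using False one by blast
    next
      case F: False then show ?thesis using one[of i] assms(2) by auto
    qed
  qed
  then show ?case
  proof cases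
    case (two a b)
    \<comment> \<open>The sign makes the shear shrink \<open>\<Phi> a w\<close>, as
      \<open>\<Phi> b w\<close> is nonzero and not larger in absolute value. The sum of the absolute
      values is the termination measure.\<close>
    define e :: int where "e = (if sgn (\<Phi> a w) = sgn (\<Phi> b w) then -1 else 1)"
    let ?\<Psi> = "\<Phi>(a := (\<lambda>v. \<Phi> a v + e * \<Phi> b v))"
    have c': "coords N ?\<Psi>" using coords_shear[OF c] two by auto
    have lt: "\<bar>?\<Psi> a w\<bar> < \<bar>\<Phi> a w\<bar>"
      using two by (auto simp: e_def sgn_if split: if_splits)
    have "(\<Sum>j\<in>{i..<N}. \<bar>?\<Psi> j w\<bar>) < (\<Sum>j\<in>{i..<N}. \<bar>\<Phi> j w\<bar>)"
      by (rule sum_strict_mono_ex1) (use lt two in auto)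
    then have "nat (\<Sum>j\<in>{i..<N}. \<bar>?\<Psi> j w\<bar>) < nat (\<Sum>j\<in>{i..<N}. \<bar>\<Phi> j w\<bar>)"
      by (smt (verit) nat_mono_iff sum_nonneg abs_ge_zero)
    from less.hyps[OF this c'] obtain \<Psi> where \<Psi>: "coords N \<Psi>" "\<forall>j<i. \<Psi> j = ?\<Psi> j"
      "flag N \<Psi> i = flag N ?\<Psi> i" "\<forall>j. i < j \<longrightarrow> j < N \<longrightarrow> \<Psi> j w = 0" by blast
    have "flag N ?\<Psi> i = flag N \<Phi> i"
    proof (intro set_eqI iffI)
      fix v assume "v \<in> flag N \<Phi> i"
      then show "v \<in> flag N ?\<Psi> i" using two by (auto simp: flag_def)
    next
      fix v assume v: "v \<in> flag N ?\<Psi> i"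
      then have "?\<Psi> b v = 0" "?\<Psi> a v = 0" using two unfolding flag_def by (simp_all del: fun_upd_apply)
      then have "\<Phi> b v = 0" "\<Phi> a v = 0" using two by auto
      moreover have "\<Phi> j v = 0" if "i \<le> j" "j < N" "j \<noteq> a" for j
        using v that unfolding flag_def by auto
      ultimately show "v \<in> flag N \<Phi> i" using v by (auto simp: flag_def)
    qed
    moreover have "\<forall>j<i. \<Psi> j = \<Phi> j" using \<Psi>(2) two by auto
    ultimately show ?thesis using \<Psi> by metis
  next
    \<comment> \<open>At most one coordinate from \<open>i\<close> on is nonzero at
      \<open>w\<close>; a swap brings it to position \<open>i\<close>.\<close>
    case (one a)
    let ?\<Psi> = "\<Phi>(i := \<Phi> a, a := \<Phi> i)"
    have "coords N ?\<Psi>" using coords_swap[OF c] assms(2) one by auto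
    moreover have "\<forall>j<i. ?\<Psi> j = \<Phi> j" using one by auto
    moreover have "flag N ?\<Psi> i = flag N \<Phi> i"
    proof -
      have "(\<forall>j. i \<le> j \<longrightarrow> j < N \<longrightarrow> ?\<Psi> j v = 0) \<longleftrightarrow> (\<forall>j. i \<le> j \<longrightarrow> j < N \<longrightarrow> \<Phi> j v = 0)" for v
        using one(1) assms(2) by (smt (verit) atLeastLessThan_iff fun_upd_apply le_refl)
      then show ?thesis by (simp add: flag_def)
    qed
    moreover have "\<forall>j. i < j \<longrightarrow> j < N \<longrightarrow> ?\<Psi> j w = 0" using one by auto
    ultimately show ?thesis by blast
  qed
qed

text \<open>
  The vectors \<open>u 0, \<dots>, u (k - 1)\<close> realise the successive minima of \<open>L\<close>, and \<open>\<Phi>\<close> is a basis of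
  the dual lattice in which they are triangular.
\<close>

definition minima :: "nat \<Rightarrow> vec set \<Rightarrow> (nat \<Rightarrow> vec \<Rightarrow> int) \<Rightarrow> (nat \<Rightarrow> vec) \<Rightarrow> nat \<Rightarrow> bool" where
  "minima N L \<Phi> u k \<longleftrightarrow> coords N \<Phi> \<and> k \<le> N \<and>
     (\<forall>i<k. u i \<in> L \<and> \<Phi> i (u i) \<noteq> 0 \<and> (\<forall>j. i < j \<longrightarrow> j < N \<longrightarrow> \<Phi> j (u i) = 0) \<and>
        (\<forall>v\<in>L. nrm N v < nrm N (u i) \<longrightarrow> v \<in> flag N \<Phi> i))"

definition saturated :: "vec set \<Rightarrow> bool" where
  "saturated L \<longleftrightarrow> (\<forall>c v. c \<noteq> 0 \<longrightarrow> zmul c v \<in> L \<longrightarrow> v \<in> L)"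

lemma flag_zero: "coords N \<Phi> \<Longrightarrow> flag N \<Phi> 0 = {0}"
  using coordsD(3)[of N \<Phi>] by (auto simp: flag_def vecs_closed additiveD coordsD)

lemma flag_mono: "i \<le> j \<Longrightarrow> flag N \<Phi> i \<subseteq> flag N \<Phi> j"
  by (auto simp: flag_def)

text \<open>Elimination: a multiple of \<open>u i\<close> cancels the coordinate \<open>i\<close> of
  a nonzero multiple of \<open>v\<close>, so by induction that multiple of \<open>v\<close> lies in
  \<open>L\<close>, and saturation gives \<open>v\<close> itself.\<close>

lemma minima_flag_subset:
  assumes "minima N L \<Phi> u k" "subgrp L" "saturated L" "L \<subseteq> vecs N" "i \<le> k"
  shows "flag N \<Phi> i \<subseteq> L"
  using \<open>i \<le> k\<close>
proof (induction i)
  case 0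
  then show ?case using assms flag_zero[of N \<Phi>] subgrpD(1) by (auto simp: minima_def)
next
  case (Suc i)
  have u: "u i \<in> L" "\<Phi> i (u i) \<noteq> 0" "\<And>j. i < j \<Longrightarrow> j < N \<Longrightarrow> \<Phi> j (u i) = 0"
    and c: "\<And>j. additive (\<Phi> j)"
    using assms(1) Suc.prems by (auto simp: minima_def coords_def)
  show ?case
  proof
    fix v assume v: "v \<in> flag N \<Phi> (Suc i)"
    define w where "w = zmul (\<Phi> i (u i)) v - zmul (\<Phi> i v) (u i)"
    have "w \<in> flag N \<Phi> i"
      unfolding flag_def
    proof (intro CollectI conjI allI impI)
      show "w \<in> vecs N" using v u assms(4) by (auto simp: w_def flag_def intro!: vecs_closed)
      fix j assume "i \<le> j" "j < N"
      then show "\<Phi> j w = 0" using v u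
        by (cases "j = i") (auto simp: w_def additiveD[OF c] flag_def)
    qed
    then have "w \<in> L" using Suc by auto
    then have "w + zmul (\<Phi> i v) (u i) \<in> L" using subgrpD[OF assms(2)] u by auto
    then have "zmul (\<Phi> i (u i)) v \<in> L" by (simp add: w_def)
    then show "v \<in> L" using u(2) assms(3) by (auto simp: saturated_def)
  qed
qed

text \<open>The next minimum is attained by a shortest vector outside the current flag. Euclid's
  algorithm on the coordinates from \<open>k\<close> on makes it triangular without disturbing the
  flags up to \<open>k\<close>, on which the earlier conditions depend.\<close>

lemma minima_extend:
  assumes m: "minima N L \<Phi> u k" and L: "L \<subseteq> vecs N" "\<not> L \<subseteq> flag N \<Phi> k"
  shows "\<exists>\<Psi> w. minima N L \<Psi> (u(k := w)) (Suc k)"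
proof -
  have c: "coords N \<Phi>" and kN: "k \<le> N" using m by (auto simp: minima_def)
  have "k \<noteq> N" using L by (auto simp: flag_def)
  then have kN: "k < N" using kN by simp
  define w where "w = arg_min (nrm N) (\<lambda>w. w \<in> L \<and> w \<notin> flag N \<Phi> k)"
  have w: "w \<in> L \<and> w \<notin> flag N \<Phi> k" and
    wmin: "\<And>v. v \<in> L \<and> v \<notin> flag N \<Phi> k \<Longrightarrow> nrm N w \<le> nrm N v"
    using arg_min_nat_lemma[of "\<lambda>w. w \<in> L \<and> w \<notin> flag N \<Phi> k"] L(2) unfolding w_def by blast+
  obtain \<Psi> where \<Psi>: "coords N \<Psi>" "\<forall>j<k. \<Psi> j = \<Phi> j" "flag N \<Psi> k = flag N \<Phi> k"
    "\<forall>j. k < j \<longrightarrow> j < N \<longrightarrow> \<Psi> j w = 0" using coords_reduce[OF c kN] by blast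
  \<comment> \<open>Such a flag is determined by the flag at \<open>k\<close> and the functionals
    below \<open>k\<close>, and both are preserved.\<close>
  have sub: "v \<in> flag N \<Psi> i \<longleftrightarrow> v \<in> flag N \<Phi> i" if "i \<le> k" for i v
  proof -
    have "v \<in> flag N \<Omega> i \<longleftrightarrow> v \<in> flag N \<Omega> k \<and> (\<forall>j. i \<le> j \<longrightarrow> j < k \<longrightarrow> \<Omega> j v = 0)" for \<Omega>
      using that kN by (auto simp: flag_def)
    then show ?thesis using \<Psi>(2,3) by simp
  qed
  have fl: "\<Psi> j v = 0" if "\<forall>j. i < j \<longrightarrow> j < N \<longrightarrow> \<Phi> j v = 0" "v \<in> L" "i < k" "i < j" "j < N" for i j v
  proof -
    have "v \<in> flag N \<Phi> (Suc i)" using that L by (auto simp: flag_def)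
    then have "v \<in> flag N \<Psi> (Suc i)" using sub that by auto
    then show ?thesis using that by (auto simp: flag_def)
  qed
  have "\<Psi> k w \<noteq> 0"
  proof
    assume "\<Psi> k w = 0"
    then have "w \<in> flag N \<Psi> k" using \<Psi>(4) w L by (auto simp: flag_def le_less)
    then show False using w sub by auto
  qed
  have "minima N L \<Psi> (u(k := w)) (Suc k)"
    unfolding minima_def
  proof (intro conjI allI impI)
    fix i assume i: "i < Suc k"
    let ?u = "(u(k := w)) i"
    show "?u \<in> L" using i w m by (auto simp: minima_def less_Suc_eq)
    show "\<Psi> i ?u \<noteq> 0" using i \<open>\<Psi> k w \<noteq> 0\<close> \<Psi>(2) m by (auto simp: minima_def less_Suc_eq)
    show "\<Psi> j ?u = 0" if "i < j" "j < N" for j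
      using i \<Psi>(4) that m fl[of i "u i" j] by (cases "i = k") (auto simp: minima_def less_Suc_eq)
    have "v \<in> flag N \<Psi> i" if v: "v \<in> L" "nrm N v < nrm N ?u" for v
    proof (cases "i = k")
      case True
      then show ?thesis using v wmin[of v] sub[of k v] by force
    next
      case False
      then show ?thesis using v i m sub[of i v] by (auto simp: minima_def)
    qed
    then show "\<forall>v\<in>L. nrm N v < nrm N ?u \<longrightarrow> v \<in> flag N \<Psi> i" by blast
  qed (use \<Psi>(1) kN in auto)
  then show ?thesis by blast
qed

text \<open>Extension stops because \<open>minima\<close> contains \<open>k \<le> N\<close>. Where
  it stops, \<open>L\<close> lies in the last flag, and saturation gives the reverse
  inclusion.\<close>

lemma minima_exist:
  assumes "subgrp L" "saturated L" "L \<subseteq> vecs N"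
  obtains \<Phi> u k where "minima N L \<Phi> u k" "L = flag N \<Phi> k"
proof -
  have "coords N (\<lambda>j v. v j)"
    by (auto simp: coords_def additive_def vecs_def fun_eq_iff intro!: exI[of _ "\<lambda>j. if j < N then y j else 0" for y])
      (meson not_le)
  then have 0: "\<exists>\<Phi> u. minima N L \<Phi> u 0" by (auto simp: minima_def)
  define P where "P k \<longleftrightarrow> (\<exists>\<Phi> u. minima N L \<Phi> u k)" for k
  have "P 0" using 0 P_def by simp
  moreover have "\<forall>k. P k \<longrightarrow> k \<le> N" by (auto simp: P_def minima_def)
  ultimately obtain k where k: "P k" "\<not> P (Suc k)"
    by (metis not_less_eq_eq full_nat_induct nat_induct)
  then obtain \<Phi> u where m: "minima N L \<Phi> u k" by (auto simp: P_def)
  then have "L \<subseteq> flag N \<Phi> k" using minima_extend[OF m assms(3)] k(2) unfolding P_def by blast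
  then have "L = flag N \<Phi> k" using minima_flag_subset[OF m assms order.refl] by blast
  then show ?thesis using that m by blast
qed

lemma minima_mono:
  assumes m: "minima N L \<Phi> u k" and "i \<le> j" "j < k"
  shows "nrm N (u i) \<le> nrm N (u j)"
proof (rule ccontr)
  assume "\<not> ?thesis"
  then have "u j \<in> flag N \<Phi> i" using assms by (auto simp: minima_def)
  then show False using assms by (auto simp: minima_def flag_def)
qed

section \<open>Counting classes of exponent vectors\<close>

definition cls :: "nat \<Rightarrow> vec set \<Rightarrow> nat \<Rightarrow> vec \<Rightarrow> vec set" where
  "cls N R D m = {m' \<in> pts N D. m' - m \<in> R}"

definition ncls :: "nat \<Rightarrow> vec set \<Rightarrow> nat \<Rightarrow> nat" where
  "ncls N R D = card (cls N R D ` pts N D)"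

lemma card_image_le_image:
  assumes "finite A" "\<And>x y. x \<in> A \<Longrightarrow> y \<in> A \<Longrightarrow> g x = g y \<Longrightarrow> f x = f y"
  shows "card (f ` A) \<le> card (g ` A)"
proof -
  define h where "h z = f (SOME x. x \<in> A \<and> g x = z)" for z
  have "h (g x) = f x" if "x \<in> A" for x
    unfolding h_def using someI[of "\<lambda>y. y \<in> A \<and> g y = g x" x] that assms(2) by blast
  then have "f ` A = (\<lambda>x. h (g x)) ` A" by (intro image_cong) auto
  then have "f ` A = h ` (g ` A)" by (simp add: image_image)
  then show ?thesis using assms(1) by (metis card_image_le finite_imageI)
qed

lemma cls_eq_iff:
  assumes "subgrp R" "m \<in> pts N D" "m' \<in> pts N D"
  shows "cls N R D m = cls N R D m' \<longleftrightarrow> m - m' \<in> R"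
proof
  assume "cls N R D m = cls N R D m'"
  moreover have "m \<in> cls N R D m" using assms subgrpD(1) by (simp add: cls_def)
  ultimately show "m - m' \<in> R" by (auto simp: cls_def)
next
  assume d: "m - m' \<in> R"
  have "x - m' \<in> R" if "x - m \<in> R" for x
    using subgrpD(3)[OF assms(1) that d] by simp
  moreover have "x - m \<in> R" if "x - m' \<in> R" for x
    using subgrpD(2)[OF assms(1) that d] by simp
  ultimately show "cls N R D m = cls N R D m'" by (auto simp: cls_def)
qed

lemma ncls_eq_card_image:
  assumes "subgrp R" "\<And>m m'. m \<in> pts N D \<Longrightarrow> m' \<in> pts N D \<Longrightarrow> f m = f m' \<longleftrightarrow> m - m' \<in> R"
  shows "ncls N R D = card (f ` pts N D)"
proof -
  have "f m = f m' \<longleftrightarrow> cls N R D m = cls N R D m'" if "m \<in> pts N D" "m' \<in> pts N D" for m m'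
    using that assms by (simp add: cls_eq_iff)
  then show ?thesis unfolding ncls_def by (intro antisym card_image_le_image) simp_all
qed

lemma pts_diff_vecs: "m \<in> pts N D \<Longrightarrow> m' \<in> pts N E \<Longrightarrow> m - m' \<in> vecs N"
  by (simp add: vecs_closed pts_vecs)

text \<open>Two monomials of degree \<open>D\<close> differ by a vector of norm at most
  \<open>D\<close>, so only the short vectors of \<open>R'\<close> matter. This is how a lattice is
  replaced by one of its flags in low degree.\<close>

lemma ncls_le:
  assumes "subgrp R" "subgrp R'"
    and "\<And>v. v \<in> R' \<Longrightarrow> v \<in> vecs N \<Longrightarrow> nrm N v \<le> D \<Longrightarrow> v \<in> R"
  shows "ncls N R D \<le> ncls N R' D"
  unfolding ncls_def
proof (rule card_image_le_image)
  fix x y assume "x \<in> pts N D" "y \<in> pts N D" "cls N R' D x = cls N R' D y"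
  then show "cls N R D x = cls N R D y"
    using assms(3)[of "x - y"] nrm_diff_le[of x N D y] pts_diff_vecs[of x N D y]
    by (simp add: cls_eq_iff assms(1,2))
qed simp

text \<open>
  In every class modulo \<open>R2\<close> there is a class modulo \<open>R1\<close> that is extremal in the direction of
  \<open>u\<close>; it is not hit by the injection \<open>m \<mapsto> m + u\<^sup>+\<close>.
\<close>

lemma ncls_chain:
  assumes R: "subgrp R1" "subgrp R2" "R1 \<subseteq> R2" and u: "u \<in> R2" "u \<in> vecs N"
    and inf: "\<And>c. c \<noteq> 0 \<Longrightarrow> zmul c u \<notin> R1" and D: "nrm N u \<le> D"
  shows "ncls N R2 D + ncls N R1 (D - nrm N u) \<le> ncls N R1 D"
proof -
  let ?E = "D - nrm N u"
  let ?g = "\<lambda>m. m + ppart u"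
  have g: "?g m \<in> pts N D" if "m \<in> pts N ?E" for m
    using pts_add[OF that nrm_parts(1)[OF u(2)]] D by simp
  have g': "m + ppart (- u) \<in> pts N D" if "m \<in> pts N ?E" for m
    using pts_add[OF that nrm_parts(2)[OF u(2)]] D by simp
  have 1: "ncls N R1 ?E = card ((\<lambda>m. cls N R1 D (?g m)) ` pts N ?E)"
    by (rule ncls_eq_card_image[OF R(1)]) (simp add: cls_eq_iff R(1) g)
  let ?B = "(\<lambda>m. cls N R1 D (?g m)) ` pts N ?E"
  let ?A = "cls N R1 D ` pts N D"
  have "?B \<subseteq> ?A" using g by auto
  then have "card (?A - ?B) = card ?A - card ?B" "card ?B \<le> card ?A"
    by (simp_all add: card_Diff_subset card_mono)
  then have 2: "card (?A - ?B) = ncls N R1 D - ncls N R1 ?E" "ncls N R1 ?E \<le> ncls N R1 D"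
    using 1 by (simp_all add: ncls_def)
  let ?T = "{m \<in> pts N D. cls N R1 D m \<notin> ?B}"
  have ex: "\<exists>m'\<in>?T. m' - m \<in> R2" if m: "m \<in> pts N D" for m
  proof -
    let ?P = "\<lambda>c m'. m' \<in> pts N D \<and> m' - (m - zmul (int c) u) \<in> R1"
    have P0: "?P 0 m" using m subgrpD(1)[OF R(1)] by simp
    \<comment> \<open>The multiples of \<open>u\<close> are distinct modulo \<open>R1\<close>, so
      distinct \<open>c\<close> need distinct points of the finite simplex.\<close>
    have fin: "finite {c. \<exists>m'. ?P c m'}"
    proof -
      define h where "h c = (SOME m'. ?P c m')" for c
      have h: "?P c (h c)" if "c \<in> {c. \<exists>m'. ?P c m'}" for c
        using that someI_ex[of "?P c"] unfolding h_def by blast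
      have "inj_on h {c. \<exists>m'. ?P c m'}"
      proof (rule inj_onI)
        fix c c' assume cc: "c \<in> {c. \<exists>m'. ?P c m'}" "c' \<in> {c. \<exists>m'. ?P c m'}" "h c = h c'"
        have "(h c - (m - zmul (int c) u)) - (h c' - (m - zmul (int c') u)) \<in> R1"
          using h cc subgrpD(2)[OF R(1)] by blast
        then have "zmul (int c - int c') u \<in> R1" using cc(3) by (simp add: zmul_distrib)
        then show "c = c'" using inf[of "int c - int c'"] by auto
      qed
      moreover have "h ` {c. \<exists>m'. ?P c m'} \<subseteq> pts N D" using h by auto
      ultimately show ?thesis by (meson finite_pts finite_imageD finite_subset)
    qed
    define c where "c = Max {c. \<exists>m'. ?P c m'}"
    have "c \<in> {c. \<exists>m'. ?P c m'}" unfolding c_def by (rule Max_in[OF fin]) (use P0 in blast)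
    then obtain m' where m': "?P c m'" by blast
    have max: "c' \<le> c" if "?P c' x" for c' x unfolding c_def by (rule Max_ge[OF fin]) (use that in blast)
    \<comment> \<open>If the class were hit by \<open>x + ppart u\<close>, then
      \<open>x + ppart (- u)\<close>, which has degree at most \<open>D\<close> too, would lie one
      step further along, against the maximality of \<open>c\<close>.\<close>
    have "cls N R1 D m' \<notin> ?B"
    proof
      assume "cls N R1 D m' \<in> ?B"
      then obtain x where x: "x \<in> pts N ?E" "cls N R1 D m' = cls N R1 D (?g x)" by blast
      then have d: "m' - ?g x \<in> R1" using cls_eq_iff[OF R(1)] m' g by blast
      have "x + ppart (- u) - (m - zmul (int (Suc c)) u) =
          (m' - (m - zmul (int c) u)) - (m' - ?g x) - (ppart u - ppart (- u)) + u"
        by (simp add: zmul_distrib algebra_simps)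
      also have "\<dots> = (m' - (m - zmul (int c) u)) - (m' - ?g x)" unfolding ppart_diff by simp
      finally have eq: "x + ppart (- u) - (m - zmul (int (Suc c)) u) = \<dots>" .
      have "?P (Suc c) (x + ppart (- u))"
        unfolding eq using subgrpD(2)[OF R(1)] m' d g'[OF x(1)] by blast
      then show False using max by fastforce
    qed
    moreover have "m' - m \<in> R2"
    proof -
      have "m' - (m - zmul (int c) u) \<in> R2" "zmul (int c) u \<in> R2"
        using m' R(3) u subgrpD(5)[OF R(2)] by auto
      from subgrpD(2)[OF R(2) this] show ?thesis by simp
    qed
    ultimately show ?thesis using m' by blast
  qed
  have "cls N R2 D ` pts N D \<subseteq> cls N R2 D ` ?T"
  proof
    fix C assume "C \<in> cls N R2 D ` pts N D"
    then obtain m m' where "m \<in> pts N D" "C = cls N R2 D m" "m' \<in> ?T" "m' - m \<in> R2" using ex by blast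
    then show "C \<in> cls N R2 D ` ?T" using cls_eq_iff[OF R(2), of m' N D m] by auto
  qed
  then have "ncls N R2 D \<le> card (cls N R2 D ` ?T)" unfolding ncls_def by (intro card_mono) auto
  also have "\<dots> \<le> card (cls N R1 D ` ?T)"
    by (rule card_image_le_image) (use R in \<open>auto simp: cls_eq_iff\<close>)
  also have "\<dots> \<le> card (?A - ?B)" by (intro card_mono) auto
  finally show ?thesis using 2 by simp
qed

section \<open>Multiples q L of a flag\<close>

lemma subgrp_zmul: "subgrp R \<Longrightarrow> subgrp (zmul q ` R)"
  by (auto simp: subgrp_def simp flip: zmul_distrib intro!: image_eqI[of 0 _ 0])

lemma zmul_flag_iff:
  assumes c: "coords N \<Phi>" and q: "q > 0" and v: "v \<in> vecs N"
  shows "v \<in> zmul (int q) ` flag N \<Phi> k \<longleftrightarrow> v \<in> flag N \<Phi> k \<and> (\<forall>j<N. int q dvd \<Phi> j v)"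
proof
  assume "v \<in> zmul (int q) ` flag N \<Phi> k"
  then obtain w where w: "w \<in> flag N \<Phi> k" "v = zmul (int q) w" by blast
  have "zmul (int q) w \<in> flag N \<Phi> k" by (rule subgrpD(5)[OF subgrp_flag[OF c] w(1)])
  then show "v \<in> flag N \<Phi> k \<and> (\<forall>j<N. int q dvd \<Phi> j v)"
    using w(2) additiveD(5)[OF coordsD(1)[OF c]] by simp
next
  assume *: "v \<in> flag N \<Phi> k \<and> (\<forall>j<N. int q dvd \<Phi> j v)"
  obtain w where w: "w \<in> vecs N" "\<forall>j<N. \<Phi> j w = \<Phi> j v div int q"
    using coordsD(2)[OF c, of "\<lambda>j. \<Phi> j v div int q"] by blast
  have "zmul (int q) w - v = 0"
  proof (rule coordsD(3)[OF c])
    show "zmul (int q) w - v \<in> vecs N" using w v by (simp add: vecs_closed)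
    show "\<Phi> j (zmul (int q) w - v) = 0" if "j < N" for j
      using w * that by (simp add: additiveD[OF coordsD(1)[OF c]])
  qed
  then have "v = zmul (int q) w" by simp
  moreover have "w \<in> flag N \<Phi> k" using w * by (auto simp: flag_def)
  ultimately show "v \<in> zmul (int q) ` flag N \<Phi> k" by blast
qed

text \<open>On the flag all coordinates from \<open>k\<close> on vanish, so the residues modulo
  \<open>q\<close> of the first \<open>k\<close> ones split each class into at most
  \<open>q ^ k\<close> classes.\<close>

lemma ncls_zmul_flag_le:
  assumes c: "coords N \<Phi>" and q: "q > 0" and k: "k \<le> N"
  shows "ncls N (zmul (int q) ` flag N \<Phi> k) D \<le> q ^ k * ncls N (flag N \<Phi> k) D"
proof -
  let ?L = "flag N \<Phi> k" and ?r = "\<lambda>m. restrict (\<lambda>j. \<Phi> j m mod int q) {..<k}"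
  have sg: "subgrp ?L" by (rule subgrp_flag[OF c])
  have "ncls N (zmul (int q) ` ?L) D \<le> card ((\<lambda>m. (?r m, cls N ?L D m)) ` pts N D)"
    unfolding ncls_def
  proof (rule card_image_le_image)
    fix m m' assume m: "m \<in> pts N D" "m' \<in> pts N D"
      and eq: "(?r m, cls N ?L D m) = (?r m', cls N ?L D m')"
    then have L: "m - m' \<in> ?L" using cls_eq_iff[OF sg m] by simp
    have "int q dvd \<Phi> j (m - m')" if "j < N" for j
    proof (cases "j < k")
      case True
      then have "?r m j = ?r m' j" using eq by simp
      then show ?thesis using True by (simp add: additiveD[OF coordsD(1)[OF c]] mod_eq_dvd_iff)
    qed (use L that in \<open>auto simp: flag_def\<close>)
    then have "m - m' \<in> zmul (int q) ` ?L"
      using L zmul_flag_iff[OF c q pts_diff_vecs[OF m]] by blast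
    then show "cls N (zmul (int q) ` ?L) D m = cls N (zmul (int q) ` ?L) D m'"
      using cls_eq_iff[OF subgrp_zmul[OF sg] m] by simp
  qed simp
  also have "\<dots> \<le> card (PiE {..<k} (\<lambda>_. {0..<int q}) \<times> cls N ?L D ` pts N D)"
    proof (rule card_mono)
    show "finite (PiE {..<k} (\<lambda>_. {0..<int q}) \<times> cls N ?L D ` pts N D)" by (simp add: finite_PiE)
    have "?r m \<in> PiE {..<k} (\<lambda>_. {0..<int q})" for m using q by auto
    then show "(\<lambda>m. (?r m, cls N ?L D m)) ` pts N D \<subseteq>
        PiE {..<k} (\<lambda>_. {0..<int q}) \<times> cls N ?L D ` pts N D" by blast
  qed
  also have "\<dots> = q ^ k * ncls N ?L D"
    by (simp add: card_cartesian_product card_PiE ncls_def)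
  finally show ?thesis .
qed

section \<open>Eventually polynomial counting functions\<close>

definition evpoly :: "(nat \<Rightarrow> nat) \<Rightarrow> bool" where
  "evpoly f \<longleftrightarrow> (\<exists>p::real poly. \<forall>\<^sub>F D in sequentially. real (f D) = poly p (real D))"

text \<open>The coefficient at a degree bound \<open>n\<close> is tracked, rather than the leading
  one, so that it may vanish.\<close>

lemma pcompose_linear_coeff:
  fixes p :: "real poly"
  assumes "degree p \<le> n"
  shows "degree (pcompose p [:b, a:]) \<le> n" "coeff (pcompose p [:b, a:]) n = a ^ n * coeff p n"
proof -
  have "degree (pcompose p [:b, a:]) \<le> n \<and> coeff (pcompose p [:b, a:]) n = a ^ n * coeff p n"
    using assms
  proof (induction n arbitrary: p)
    case 0
    then obtain c where "p = [:c:]" using degree_eq_zeroE by blast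
    then show ?case by simp
  next
    case (Suc n)
    obtain c p' where p: "p = pCons c p'" by (cases p)
    have "degree p' \<le> n" using Suc.prems by (auto simp: p split: if_splits)
    then have IH: "degree (pcompose p' [:b, a:]) \<le> n" "coeff (pcompose p' [:b, a:]) n = a ^ n * coeff p' n"
      using Suc.IH by auto
    have z: "coeff (pcompose p' [:b, a:]) (Suc n) = 0" using IH by (intro coeff_eq_0) auto
    have "degree ([:b, a:] * pcompose p' [:b, a:]) \<le> Suc n"
      by (rule order.trans[OF degree_mult_le]) (use IH in \<open>auto intro: order.trans[OF add_mono]\<close>)
    then have "degree (pcompose p [:b, a:]) \<le> Suc n"
      unfolding p pcompose_pCons by (intro degree_add_le) auto
    moreover have "coeff (pcompose p [:b, a:]) (Suc n) = a ^ Suc n * coeff p (Suc n)"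
      by (simp add: p pcompose_pCons z IH)
    ultimately show ?case by blast
  qed
  then show "degree (pcompose p [:b, a:]) \<le> n" "coeff (pcompose p [:b, a:]) n = a ^ n * coeff p n" by auto
qed

lemma pcompose_shift_second_coeff:
  fixes p :: "real poly"
  assumes "degree p \<le> Suc n"
  shows "coeff (pcompose p [:- a, 1:]) n = coeff p n - real (Suc n) * a * coeff p (Suc n)"
  using assms
proof (induction n arbitrary: p)
  case 0
  obtain c p' where p: "p = pCons c p'" by (cases p)
  then have "degree p' = 0" using 0 by (auto split: if_splits)
  then obtain d where "p' = [:d:]" using degree_eq_zeroE by blast
  then show ?case by (simp add: p pcompose_pCons)
next
  case (Suc n)
  obtain c p' where p: "p = pCons c p'" by (cases p)
  have d: "degree p' \<le> Suc n" using Suc.prems by (auto simp: p split: if_splits)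
  have "coeff (pcompose p [:- a, 1:]) (Suc n) =
      coeff (pcompose p' [:- a, 1:]) n - a * coeff (pcompose p' [:- a, 1:]) (Suc n)"
    by (simp add: p pcompose_pCons)
  also have "\<dots> = coeff p' n - real (Suc n) * a * coeff p' (Suc n) - a * coeff p' (Suc n)"
    unfolding Suc.IH[OF d] pcompose_linear_coeff(2)[OF d] by simp
  finally show ?case by (simp add: p algebra_simps)
qed

text \<open>The discrete derivative. The factor \<open>Suc n\<close> is absorbed by normalising the
  top coefficient with a factorial, which leaves the factor \<open>a\<close>: the degree of the new
  hypersurface in the Bezout estimate.\<close>

lemma backward_difference:
  fixes p :: "real poly" and a :: real
  assumes "degree p \<le> Suc n"
  defines "q \<equiv> p - pcompose p [:- a, 1:]"
  shows "degree q \<le> n" "coeff q n = real (Suc n) * a * coeff p (Suc n)"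
proof -
  have "degree q \<le> Suc n"
    unfolding q_def by (intro degree_diff_le assms pcompose_linear_coeff)
  moreover have "coeff q (Suc n) = 0"
    unfolding q_def by (simp add: pcompose_linear_coeff(2)[OF assms(1)])
  ultimately have "\<forall>i>n. coeff q i = 0"
    by (metis Suc_lessI coeff_eq_0 le_less_trans)
  then show "degree q \<le> n" by (rule degree_le)
  show "coeff q n = real (Suc n) * a * coeff p (Suc n)"
    unfolding q_def by (simp add: pcompose_shift_second_coeff[OF assms(1)])
qed

lemma exists_antidifference:
  fixes p :: "real poly"
  assumes "degree p \<le> n"
  shows "\<exists>P. P - pcompose P [:- 1, 1:] = p"
  using assms
proof (induction n arbitrary: p)
  case 0
  then obtain c where "p = [:c:]" using degree_eq_zeroE by blast
  then show ?case by (intro exI[of _ "[:0, c:]"]) (simp add: pcompose_pCons)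
next
  case (Suc n)
  \<comment> \<open>Dividing by \<open>Suc (Suc n)\<close> cancels the factor produced by
    \<open>backward_difference\<close>, so the difference of \<open>Q\<close> has the same top
    coefficient as \<open>p\<close>.\<close>
  define Q where "Q = monom (coeff p (Suc n) / real (Suc (Suc n))) (Suc (Suc n))"
  let ?q = "Q - pcompose Q [:- 1, 1:]"
  have "degree Q \<le> Suc (Suc n)" unfolding Q_def by (rule degree_monom_le)
  note q = backward_difference[OF this, of 1]
  have "coeff ?q (Suc n) = coeff p (Suc n)" unfolding q(2) by (simp add: Q_def)
  then have "\<forall>i>n. coeff (p - ?q) i = 0"
    using Suc.prems q(1) by (metis Suc_lessI coeff_diff coeff_eq_0 diff_self le_less_trans)
  then obtain P where P: "P - pcompose P [:- 1, 1:] = p - ?q" using Suc.IH degree_le by blast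
  have "(P + Q) - pcompose (P + Q) [:- 1, 1:] = (P - pcompose P [:- 1, 1:]) + ?q"
    by (simp add: pcompose_add)
  also have "\<dots> = p" unfolding P by simp
  finally show ?case by blast
qed

lemma poly_sum_poly: "\<exists>P::real poly. \<forall>D. (\<Sum>i\<le>D. poly p (real i)) = poly P (real D)"
proof -
  obtain P where P: "P - pcompose P [:- 1, 1:] = p" using exists_antidifference by blast
  \<comment> \<open>The telescoping sum starts at 0, whose predecessor is -1; hence the
    constant.\<close>
  have "(\<Sum>i\<le>D. poly p (real i)) = poly (P - [:poly P (- 1):]) (real D)" for D
    unfolding P[symmetric] by (induction D) (simp_all add: poly_pcompose)
  then show ?thesis by blast
qed

lemma evpoly_const: "evpoly (\<lambda>_. c)"
  unfolding evpoly_def by (intro exI[of _ "[:real c:]"]) simp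

lemma evpoly_add:
  assumes "evpoly f" "evpoly g"
  shows "evpoly (\<lambda>D. f D + g D)"
proof -
  obtain p q :: "real poly" where "\<forall>\<^sub>F D in sequentially. real (f D) = poly p (real D)"
    "\<forall>\<^sub>F D in sequentially. real (g D) = poly q (real D)" using assms by (auto simp: evpoly_def)
  then have "\<forall>\<^sub>F D in sequentially. real (f D + g D) = poly (p + q) (real D)"
    by eventually_elim simp
  then show ?thesis unfolding evpoly_def by blast
qed

lemma evpoly_sum: "finite A \<Longrightarrow> (\<And>a. a \<in> A \<Longrightarrow> evpoly (f a)) \<Longrightarrow> evpoly (\<lambda>D. \<Sum>a\<in>A. f a D)"
  by (induction A rule: finite_induct) (auto intro: evpoly_const evpoly_add)

lemma evpoly_cong:
  assumes "evpoly g" "\<And>D. D \<ge> n \<Longrightarrow> f D = g D"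
  shows "evpoly f"
proof -
  obtain p :: "real poly" where "\<forall>\<^sub>F D in sequentially. real (g D) = poly p (real D)"
    using assms(1) by (auto simp: evpoly_def)
  then have "\<forall>\<^sub>F D in sequentially. real (f D) = poly p (real D)"
    using eventually_ge_at_top[of n] by eventually_elim (simp add: assms(2))
  then show ?thesis unfolding evpoly_def by blast
qed

lemma evpoly_shift:
  assumes "evpoly f"
  shows "evpoly (\<lambda>D. f (D - j))"
proof -
  obtain p n where p: "\<And>D. D \<ge> n \<Longrightarrow> real (f D) = poly p (real D)"
    using assms by (auto simp: evpoly_def eventually_sequentially)
  have "real (f (D - j)) = poly (pcompose p [:- real j, 1:]) (real D)" if "D \<ge> n + j" for D
    using p[of "D - j"] that by (simp add: poly_pcompose of_nat_diff)
  then show ?thesis unfolding evpoly_def eventually_sequentially by blast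
qed

lemma evpoly_cumulative:
  assumes "evpoly f"
  shows "evpoly (\<lambda>D. \<Sum>i\<le>D. f i)"
proof -
  obtain p n where p: "\<And>D. D \<ge> n \<Longrightarrow> real (f D) = poly p (real D)"
    using assms by (auto simp: evpoly_def eventually_sequentially)
  obtain P :: "real poly" where P: "\<And>D. (\<Sum>i\<le>D. poly p (real i)) = poly P (real D)"
    using poly_sum_poly by metis
  \<comment> \<open>The finitely many arguments below \<open>n\<close>, where \<open>f\<close> need
    not agree with \<open>p\<close>, contribute a constant.\<close>
  let ?K = "\<Sum>i<n. real (f i) - poly p (real i)"
  have "real (\<Sum>i\<le>D. f i) = poly (P + [:?K:]) (real D)" if "D \<ge> n" for D
  proof -
    have "(\<Sum>i\<le>D. real (f i) - poly p (real i)) = ?K"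
      by (rule sum.mono_neutral_right) (use p that in auto)
    then show ?thesis using P[of D] by (simp add: sum_subtractf)
  qed
  then show ?thesis unfolding evpoly_def eventually_sequentially by blast
qed

section \<open>Down-sets of exponent vectors and Dickson's lemma\<close>

definition nvecs :: "nat \<Rightarrow> (nat \<Rightarrow> nat) set" where
  "nvecs N = {m. \<forall>i\<ge>N. m i = 0}"

definition downset :: "nat \<Rightarrow> (nat \<Rightarrow> nat) set \<Rightarrow> bool" where
  "downset N E \<longleftrightarrow> E \<subseteq> nvecs N \<and> (\<forall>m\<in>E. \<forall>m'. (\<forall>i. m' i \<le> m i) \<longrightarrow> m' \<in> E)"

definition slice :: "nat \<Rightarrow> (nat \<Rightarrow> nat) set \<Rightarrow> nat \<Rightarrow> (nat \<Rightarrow> nat) set" where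
  "slice N E j = {m \<in> nvecs N. m(N := j) \<in> E}"

definition dcount :: "nat \<Rightarrow> (nat \<Rightarrow> nat) set \<Rightarrow> nat \<Rightarrow> nat" where
  "dcount N E D = card {m \<in> E. (\<Sum>i<N. m i) \<le> D}"

lemma nvecs_le:
  assumes "m \<in> nvecs N" "\<forall>i. m' i \<le> m i"
  shows "m' \<in> nvecs N"
proof -
  have "m' i = 0" if "i \<ge> N" for i
    using assms(2)[rule_format, of i] assms(1) that by (simp add: nvecs_def)
  then show ?thesis by (simp add: nvecs_def)
qed

lemma downset_slice: "downset (Suc N) E \<Longrightarrow> downset N (slice N E j)"
proof -
  assume E: "downset (Suc N) E"
  have "m' \<in> slice N E j" if m: "m \<in> slice N E j" "\<forall>i. m' i \<le> m i" for m m'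
  proof -
    have "\<forall>i. (m'(N := j)) i \<le> (m(N := j)) i" using m by auto
    then have "m'(N := j) \<in> E" using E m by (auto simp: downset_def slice_def)
    moreover have "m' \<in> nvecs N" using nvecs_le[of m N m'] m by (simp add: slice_def)
    ultimately show ?thesis by (simp add: slice_def)
  qed
  moreover have "slice N E j \<subseteq> nvecs N" by (auto simp: slice_def)
  ultimately show ?thesis unfolding downset_def by blast
qed

lemma slice_antimono: "downset (Suc N) E \<Longrightarrow> j \<le> j' \<Longrightarrow> slice N E j' \<subseteq> slice N E j"
  by (fastforce simp: downset_def slice_def)

lemma eq_if_slices_eq:
  assumes "E \<subseteq> nvecs (Suc N)" "E' \<subseteq> nvecs (Suc N)" "\<And>j. slice N E j = slice N E' j"
  shows "E = E'"
proof -
  have "m \<in> F \<longleftrightarrow> m(N := 0) \<in> slice N F (m N)" if "F \<subseteq> nvecs (Suc N)" "m \<in> nvecs (Suc N)" for F m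
    using that by (auto simp: slice_def nvecs_def)
  then show ?thesis using assms by (metis subsetD subsetI subset_antisym)
qed

text \<open>
  Dickson's lemma for down-sets. The slices of the diagonal stabilise, which fixes all slices
  with large index; the remaining finitely many slices stabilise by induction.
\<close>

lemma downset_chain_stable:
  assumes "\<And>i. downset N (E i)" "\<And>i j. i \<le> j \<Longrightarrow> E j \<subseteq> E i"
  shows "\<exists>n::nat. \<forall>i\<ge>n. E i = E n"
  using assms
proof (induction N arbitrary: E)
  case 0
  have sub: "E i \<subseteq> {\<lambda>_. 0}" for i using 0(1)[of i] by (auto simp: downset_def nvecs_def)
  show ?case
  proof (cases "\<exists>n. E n = {}")
    case True
    then show ?thesis using 0(2) by (metis subset_empty)
  next
    case False
    then have "E i = {\<lambda>_. 0}" for i using sub by (metis subset_singletonD)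
    then show ?thesis by auto
  qed
next
  case (Suc N)
  note d = Suc.prems(1) and dec = Suc.prems(2)
  have sl: "slice N (E i') j' \<subseteq> slice N (E i) j" if "i \<le> i'" "j \<le> j'" for i i' j j'
    using dec[OF that(1)] slice_antimono[OF d that(2)] by (auto simp: slice_def)
  have "\<exists>n. \<forall>i\<ge>n. slice N (E i) i = slice N (E n) n"
    by (rule Suc.IH) (auto intro: downset_slice d sl[THEN subsetD])
  then obtain n where n: "\<And>i. i \<ge> n \<Longrightarrow> slice N (E i) i = slice N (E n) n" by blast
  \<comment> \<open>This slice is squeezed between the diagonal slices at \<open>n\<close> and at
    \<open>max i j\<close>, which agree.\<close>
  have big: "slice N (E i) j = slice N (E n) n" if "i \<ge> n" "j \<ge> n" for i j
    using sl[of n i n j] sl[of i "max i j" j "max i j"] n[of "max i j"] that by auto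
  have "\<exists>n. \<forall>i\<ge>n. slice N (E i) j = slice N (E n) j" for j
    by (rule Suc.IH) (auto intro: downset_slice d sl[THEN subsetD])
  then obtain h where h: "\<And>i j. i \<ge> h j \<Longrightarrow> slice N (E i) j = slice N (E (h j)) j" by metis
  define M where "M = Max (insert n (h ` {..<n}))"
  have M: "n \<le> M" "\<And>j. j < n \<Longrightarrow> h j \<le> M" by (auto simp: M_def)
  have "E i = E M" if "i \<ge> M" for i
  proof (rule eq_if_slices_eq)
    show "slice N (E i) j = slice N (E M) j" for j
      using big[of i j] big[of M j] h[of j i] h[of j M] M that by (cases "j < n") force+
  qed (use d in \<open>auto simp: downset_def\<close>)
  then show ?case by blast
qed

lemma finite_dcount: "E \<subseteq> nvecs N \<Longrightarrow> finite {m \<in> E. (\<Sum>i<N. m i) \<le> D}"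
proof (rule finite_subset)
  assume E: "E \<subseteq> nvecs N"
  show "{m \<in> E. (\<Sum>i<N. m i) \<le> D} \<subseteq>
     {m. \<forall>i. (i \<in> {..<N} \<longrightarrow> m i \<in> {..D}) \<and> (i \<notin> {..<N} \<longrightarrow> m i = 0)}"
  proof clarify
    fix m i assume m: "m \<in> E" "(\<Sum>i<N. m i) \<le> D"
    have "m i \<le> (\<Sum>i<N. m i)" if "i < N" by (rule member_le_sum) (use that in auto)
    then show "(i \<in> {..<N} \<longrightarrow> m i \<in> {..D}) \<and> (i \<notin> {..<N} \<longrightarrow> m i = 0)"
      using m E by (auto simp: nvecs_def)
  qed
  show "finite {m. \<forall>i. (i \<in> {..<N} \<longrightarrow> m i \<in> {..D}) \<and> (i \<notin> {..<N} \<longrightarrow> m i = (0::nat))}"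
    by (rule finite_set_of_finite_funs) auto
qed

lemma dcount_slices:
  assumes E: "E \<subseteq> nvecs (Suc N)"
  shows "dcount (Suc N) E D = (\<Sum>j\<le>D. dcount N (slice N E j) (D - j))"
proof -
  let ?S = "\<lambda>j. {m \<in> slice N E j. (\<Sum>i<N. m i) \<le> D - j}"
  have eq: "{m \<in> E. (\<Sum>i<Suc N. m i) \<le> D} = (\<Union>j\<le>D. (\<lambda>m. m(N := j)) ` ?S j)"
  proof (intro set_eqI iffI)
    fix m assume m: "m \<in> {m \<in> E. (\<Sum>i<Suc N. m i) \<le> D}"
    have "m(N := 0) \<in> ?S (m N)" using m E by (auto simp: slice_def nvecs_def)
    then have "m \<in> (\<lambda>x. x(N := m N)) ` ?S (m N)" by (intro image_eqI[of _ _ "m(N := 0)"]) auto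
    moreover have "m N \<le> D" using m by auto
    ultimately show "m \<in> (\<Union>j\<le>D. (\<lambda>m. m(N := j)) ` ?S j)" by blast
  qed (auto simp: slice_def)
  have inj: "inj_on (\<lambda>m. m(N := j)) (?S j)" for j
  proof (rule inj_onI)
    fix m m' assume m: "m \<in> ?S j" "m' \<in> ?S j" "m(N := j) = m'(N := j)"
    show "m = m'"
    proof
      fix i show "m i = m' i"
        using m(1,2) fun_cong[OF m(3), of i]
        by (cases "i = N") (simp_all add: slice_def nvecs_def)
    qed
  qed
  have "dcount (Suc N) E D = (\<Sum>j\<le>D. card ((\<lambda>m. m(N := j)) ` ?S j))"
    unfolding dcount_def eq
  proof (rule card_UN_disjoint)
    show "\<forall>j\<in>{..D}. finite ((\<lambda>m. m(N := j)) ` ?S j)"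
    proof
      fix j
      have "slice N E j \<subseteq> nvecs N" by (auto simp: slice_def)
      from finite_dcount[OF this] show "finite ((\<lambda>m. m(N := j)) ` ?S j)" by blast
    qed
    show "\<forall>i\<in>{..D}. \<forall>j\<in>{..D}. i \<noteq> j \<longrightarrow>
        (\<lambda>m. m(N := i)) ` ?S i \<inter> (\<lambda>m. m(N := j)) ` ?S j = {}"
      by (auto dest!: fun_cong[of _ _ N])
  qed simp
  then show ?thesis by (simp add: card_image[OF inj] dcount_def)
qed

text \<open>The slices decrease, hence are constant from some \<open>J\<close> on. The earlier ones
  contribute finitely many shifted counts, the others one cumulative sum.\<close>

lemma evpoly_dcount:
  assumes "downset N E"
  shows "evpoly (dcount N E)"
  using assms
proof (induction N arbitrary: E)
  case 0
  have "dcount 0 E = (\<lambda>_. card E)" by (auto simp: dcount_def)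
  then show ?case by (simp add: evpoly_const)
next
  case (Suc N)
  obtain J where J: "\<And>j. j \<ge> J \<Longrightarrow> slice N E j = slice N E J"
    using downset_chain_stable[of N "slice N E", OF downset_slice[OF Suc.prems]
      slice_antimono[OF Suc.prems]] by blast
  have ev: "evpoly (dcount N (slice N E j))" for j
    by (rule Suc.IH[OF downset_slice[OF Suc.prems]])
  show ?case
  proof (rule evpoly_cong)
    show "evpoly (\<lambda>D. (\<Sum>j<J. dcount N (slice N E j) (D - j)) + (\<Sum>i\<le>D - J. dcount N (slice N E J) i))"
      by (intro evpoly_add evpoly_sum evpoly_shift[of "\<lambda>D. \<Sum>i\<le>D. dcount N (slice N E J) i"]
          evpoly_cumulative evpoly_shift ev) auto
    fix D assume D: "D \<ge> J"
    have "dcount (Suc N) E D = (\<Sum>j\<le>D. dcount N (slice N E j) (D - j))"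
      by (rule dcount_slices) (use Suc.prems in \<open>auto simp: downset_def\<close>)
    also have "{..D} = {..<J} \<union> {J..D}" using D by auto
    also have "(\<Sum>j\<in>\<dots>. dcount N (slice N E j) (D - j)) =
      (\<Sum>j<J. dcount N (slice N E j) (D - j)) + (\<Sum>j\<in>{J..D}. dcount N (slice N E j) (D - j))"
      by (rule sum.union_disjoint) auto
    also have "(\<Sum>j\<in>{J..D}. dcount N (slice N E j) (D - j)) = (\<Sum>j\<in>{J..D}. dcount N (slice N E J) (D - j))"
      by (intro sum.cong refl arg_cong2[of _ _ _ _ "dcount N"] fun_cong[OF arg_cong[of _ _ "dcount N"]] J) simp
    also have "\<dots> = (\<Sum>i\<le>D - J. dcount N (slice N E J) i)"
      by (rule sum.reindex_bij_witness[of _ "\<lambda>i. D - i" "\<lambda>j. D - j"]) (use D in auto)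
    finally show "dcount (Suc N) E D = (\<Sum>j<J. dcount N (slice N E j) (D - j)) +
        (\<Sum>i\<le>D - J. dcount N (slice N E J) i)" .
  qed
qed

lemma dcount_all: "dcount N (nvecs N) D = (D + N choose N)"
proof (induction N arbitrary: D)
  case 0
  have "{m. (m::nat\<Rightarrow>nat) \<in> nvecs 0} = {\<lambda>_. 0}" by (auto simp: nvecs_def)
  then show ?case by (simp add: dcount_def)
next
  case (Suc N)
  have "slice N (nvecs (Suc N)) j = nvecs N" for j by (auto simp: slice_def nvecs_def)
  then have "dcount (Suc N) (nvecs (Suc N)) D = (\<Sum>j\<le>D. (D - j + N choose N))"
    by (subst dcount_slices) (auto simp: Suc.IH)
  also have "\<dots> = (\<Sum>j\<le>D. (j + N choose N))"
    by (rule sum.reindex_bij_witness[of _ "\<lambda>i. D - i" "\<lambda>j. D - j"]) auto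
  also have "\<dots> = (D + Suc N choose Suc N)"
    by (induction D) auto
  finally show ?case .
qed

subsection \<open>Graded lexicographic normal forms\<close>

text \<open>Comparing degrees first ensures that passing to a smaller equivalent monomial never
  leaves \<open>pts N D\<close>.\<close>

definition glex :: "nat \<Rightarrow> (nat \<Rightarrow> nat) \<Rightarrow> (nat \<Rightarrow> nat) \<Rightarrow> bool" where
  "glex N m m' \<longleftrightarrow> (\<Sum>i<N. m i) < (\<Sum>i<N. m' i) \<or>
     (\<Sum>i<N. m i) = (\<Sum>i<N. m' i) \<and> (\<exists>j<N. m j < m' j \<and> (\<forall>i<j. m i = m' i))"

definition ivec :: "(nat \<Rightarrow> nat) \<Rightarrow> vec" where
  "ivec m = (\<lambda>i. int (m i))"

lemma glex_trans: "glex N a b \<Longrightarrow> glex N b c \<Longrightarrow> glex N a c"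
proof -
  assume ab: "glex N a b" and bc: "glex N b c"
  show ?thesis
  proof (cases "(\<Sum>i<N. a i) < (\<Sum>i<N. c i)")
    case False
    then have s: "(\<Sum>i<N. a i) = (\<Sum>i<N. b i)" "(\<Sum>i<N. b i) = (\<Sum>i<N. c i)"
      using ab bc by (auto simp: glex_def)
    then obtain j k where j: "j < N" "a j < b j" "\<forall>i<j. a i = b i" and k: "k < N" "b k < c k" "\<forall>i<k. b i = c i"
      using ab bc by (auto simp: glex_def)
    then have "min j k < N \<and> a (min j k) < c (min j k) \<and> (\<forall>i<min j k. a i = c i)"
      by (cases j k rule: linorder_cases) (auto simp: min_def)
    then show ?thesis using s by (auto simp: glex_def)
  qed (auto simp: glex_def)
qed

lemma glex_irrefl: "\<not> glex N a a"
  by (auto simp: glex_def)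

lemma glex_total:
  assumes "a \<in> nvecs N" "b \<in> nvecs N" "a \<noteq> b"
  shows "glex N a b \<or> glex N b a"
proof -
  define l where "l = (LEAST i. a i \<noteq> b i)"
  obtain i where "a i \<noteq> b i" using assms by (auto simp: fun_eq_iff)
  then have l: "a l \<noteq> b l" unfolding l_def by (rule LeastI)
  have eq: "a i = b i" if "i < l" for i using not_less_Least[of i "\<lambda>i. a i \<noteq> b i"] that by (auto simp: l_def)
  have "l < N" using l assms by (force simp: nvecs_def not_less[symmetric])
  then have "(\<exists>j<N. a j < b j \<and> (\<forall>i<j. a i = b i)) \<or> (\<exists>j<N. b j < a j \<and> (\<forall>i<j. b i = a i))"
    using l eq by (cases "a l < b l") force+
  then show ?thesis
    by (cases "(\<Sum>i<N. a i)" "(\<Sum>i<N. b i)" rule: linorder_cases) (auto simp: glex_def)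
qed

lemma glex_add: "glex N a b \<Longrightarrow> glex N (\<lambda>i. a i + c i) (\<lambda>i. b i + c i)"
  by (auto simp: glex_def sum.distrib)

definition normal_forms :: "nat \<Rightarrow> vec set \<Rightarrow> (nat \<Rightarrow> nat) set" where
  "normal_forms N R = {m \<in> nvecs N. \<forall>m'\<in>nvecs N. ivec m' - ivec m \<in> R \<longrightarrow> \<not> glex N m' m}"

text \<open>These are the standard monomials of the lattice ideal. A smaller equivalent of a
  divisor, multiplied by the cofactor, would be a smaller equivalent of the monomial itself.\<close>

lemma downset_normal_forms: "downset N (normal_forms N R)"
  unfolding downset_def
proof (intro conjI ballI allI impI)
  fix m m' assume m: "m \<in> normal_forms N R" and le: "\<forall>i. m' i \<le> m i"
  have m': "m' \<in> nvecs N" using m nvecs_le[OF _ le] by (simp add: normal_forms_def)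
  have "\<not> glex N x m'" if x: "x \<in> nvecs N" "ivec x - ivec m' \<in> R" for x
  proof
    assume g: "glex N x m'"
    let ?c = "\<lambda>i. m i - m' i"
    have "(\<lambda>i. m' i + ?c i) = m" using le by auto
    then have "glex N (\<lambda>i. x i + ?c i) m" using glex_add[OF g, of ?c] by simp
    moreover have "(\<lambda>i. x i + ?c i) \<in> nvecs N" using x m by (auto simp: normal_forms_def nvecs_def)
    moreover have "ivec (\<lambda>i. x i + ?c i) - ivec m = ivec x - ivec m'"
      using le by (auto simp: ivec_def fun_eq_iff of_nat_diff trans_le_add2)
    ultimately show False using m x by (auto simp: normal_forms_def)
  qed
  then show "m' \<in> normal_forms N R" using m' by (auto simp: normal_forms_def)
qed (auto simp: normal_forms_def)

lemma pts_eq_ivec: "pts N D = ivec ` {m \<in> nvecs N. (\<Sum>i<N. m i) \<le> D}"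
proof (intro set_eqI iffI)
  fix v assume v: "v \<in> pts N D"
  let ?m = "\<lambda>i. nat (v i)"
  have 1: "v = ivec ?m" using v by (auto simp: pts_def ivec_def)
  have "int (\<Sum>i<N. ?m i) = (\<Sum>i<N. v i)" using v by (auto simp: pts_def)
  then have "(\<Sum>i<N. ?m i) \<le> D" using v unfolding pts_def mem_Collect_eq by linarith
  then have "?m \<in> {m \<in> nvecs N. (\<Sum>i<N. m i) \<le> D}" using v by (auto simp: nvecs_def pts_def vecs_def)
  then show "v \<in> ivec ` {m \<in> nvecs N. (\<Sum>i<N. m i) \<le> D}" using 1 by blast
next
  fix v assume "v \<in> ivec ` {m \<in> nvecs N. (\<Sum>i<N. m i) \<le> D}"
  then obtain m where "v = ivec m" "m \<in> nvecs N" "(\<Sum>i<N. m i) \<le> D" by blast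
  then show "v \<in> pts N D"
    by (auto simp: pts_def vecs_def nvecs_def ivec_def simp flip: of_nat_sum)
qed

lemma inj_ivec: "inj ivec"
  by (auto simp: inj_def ivec_def fun_eq_iff)

lemma card_pts: "card (pts N D) = (D + N choose N)"
  unfolding pts_eq_ivec dcount_all[symmetric] dcount_def
  by (rule card_image) (meson inj_ivec inj_on_subset subset_UNIV)

lemma normal_form_exists:
  assumes R: "subgrp R" and m: "m \<in> nvecs N"
  shows "\<exists>m'\<in>normal_forms N R. ivec m' - ivec m \<in> R \<and> (\<Sum>i<N. m' i) \<le> (\<Sum>i<N. m i)"
proof -
  let ?D = "\<Sum>i<N. m i"
  let ?S = "{m' \<in> nvecs N. (\<Sum>i<N. m' i) \<le> ?D} \<inter> {m'. ivec m' - ivec m \<in> R}"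
  have fin: "finite ?S" using finite_dcount[of "nvecs N" N ?D] by auto
  let ?r = "{(a, b). glex N a b} \<inter> ?S \<times> ?S"
  have "trans ?r" using glex_trans by (auto simp: trans_def)
  then have "wf ?r"
    by (intro finite_acyclic_wf finite_subset[of ?r "?S \<times> ?S"])
      (auto simp: fin acyclic_def glex_irrefl trancl_id)
  moreover have "m \<in> ?S" using m subgrpD(1)[OF R] by auto
  ultimately have "\<exists>x\<in>?S. \<forall>y. (y, x) \<in> ?r \<longrightarrow> y \<notin> ?S"
    unfolding wf_eq_minimal by blast
  then obtain x where x: "x \<in> ?S" "\<And>y. (y, x) \<in> ?r \<Longrightarrow> y \<notin> ?S" by blast
  have "x \<in> normal_forms N R"
    unfolding normal_forms_def
  proof (intro CollectI conjI ballI impI notI)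
    show "x \<in> nvecs N" using x by simp
    fix y assume y: "y \<in> nvecs N" "ivec y - ivec x \<in> R" "glex N y x"
    have "(ivec y - ivec x) + (ivec x - ivec m) \<in> R" using y x subgrpD(3)[OF R] by blast
    then have "ivec y - ivec m \<in> R" by simp
    moreover have "(\<Sum>i<N. y i) \<le> ?D" using y(3) x(1) by (auto simp: glex_def)
    ultimately show False using x y by auto
  qed
  then show ?thesis using x by auto
qed

text \<open>Khovanskii's theorem on the growth of sumsets, with the argument of Nathanson and Ruzsa.\<close>

lemma evpoly_ncls:
  assumes R: "subgrp R"
  shows "evpoly (ncls N R)"
proof -
  have "ncls N R D = dcount N (normal_forms N R) D" for D
  proof -
    let ?T = "{m \<in> normal_forms N R. (\<Sum>i<N. m i) \<le> D}"
    have T: "ivec m \<in> pts N D" if "m \<in> ?T" for m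
      using that by (auto simp: pts_eq_ivec normal_forms_def)
    have "cls N R D ` pts N D = (\<lambda>m. cls N R D (ivec m)) ` ?T"
    proof (intro set_eqI iffI)
      fix C assume "C \<in> cls N R D ` pts N D"
      then obtain m where m: "m \<in> nvecs N" "(\<Sum>i<N. m i) \<le> D" "C = cls N R D (ivec m)"
        by (auto simp: pts_eq_ivec)
      obtain m' where m': "m'\<in>normal_forms N R" "ivec m' - ivec m \<in> R" "(\<Sum>i<N. m' i) \<le> (\<Sum>i<N. m i)"
        using normal_form_exists[OF R m(1)] by blast
      have "m' \<in> ?T" using m m' by simp
      moreover have "ivec m \<in> pts N D" using m by (auto simp: pts_eq_ivec)
      ultimately have "cls N R D (ivec m') = C" using cls_eq_iff[OF R T] m'(2) m(3) by simp
      then show "C \<in> (\<lambda>m. cls N R D (ivec m)) ` ?T" 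
        using \<open>m' \<in> ?T\<close> by (auto intro: rev_image_eqI)
    qed (use T in auto)
    moreover have "inj_on (\<lambda>m. cls N R D (ivec m)) ?T"
    proof (rule inj_onI)
      fix m m' assume m: "m \<in> ?T" "m' \<in> ?T" "cls N R D (ivec m) = cls N R D (ivec m')"
      then have "ivec m - ivec m' \<in> R" "ivec m' - ivec m \<in> R"
        using cls_eq_iff[OF R T[OF m(1)] T[OF m(2)]] cls_eq_iff[OF R T[OF m(2)] T[OF m(1)]] by simp_all
      moreover have nf: "m \<in> normal_forms N R" "m' \<in> normal_forms N R" using m by simp_all
      ultimately have "\<not> glex N m' m" "\<not> glex N m m'" by (simp_all add: normal_forms_def)
      then show "m = m'" using nf glex_total[of m N m'] by (auto simp: normal_forms_def)
    qed
    ultimately show ?thesis by (simp add: ncls_def dcount_def card_image)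
  qed
  then have "ncls N R = dcount N (normal_forms N R)" by auto
  then show ?thesis using evpoly_dcount[OF downset_normal_forms] by simp
qed

section \<open>Scaling the simplex\<close>

lemma finite_vecs_bound:
  assumes "finite F" "F \<subseteq> vecs N"
  shows "\<exists>K::nat. \<forall>v\<in>F. \<forall>l. \<bar>v l\<bar> \<le> int K"
proof -
  let ?B = "insert 0 ((\<lambda>(v, l). \<bar>v l\<bar>) ` (F \<times> {..<N}))"
  have "\<bar>v l\<bar> \<le> int (nat (Max ?B))" if "v \<in> F" for v l
  proof -
    have "\<bar>v l\<bar> \<in> ?B" using that assms(2) by (cases "l < N") (auto simp: vecs_def)
    moreover have "finite ?B" using assms(1) by auto
    ultimately have "\<bar>v l\<bar> \<le> Max ?B" "0 \<le> Max ?B" by (auto intro: Max_ge)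
    then show ?thesis by simp
  qed
  then show ?thesis by blast
qed

definition ones :: "nat \<Rightarrow> vec" where
  "ones N = (\<lambda>i. if i < N then 1 else 0)"

lemma shift_in_pts:
  assumes "v \<in> vecs N" "\<And>l. \<bar>v l\<bar> \<le> int K"
  shows "v + zmul (int K) (ones N) \<in> pts N (2 * K * N)"
proof -
  let ?w = "v + zmul (int K) (ones N)"
  have le: "?w l \<le> 2 * int K" "0 \<le> ?w l" for l
    using assms(2)[of l] assms(1) by (auto simp: ones_def zmul_apply vecs_def)
  have "(\<Sum>l<N. ?w l) \<le> (\<Sum>l<N. 2 * int K)" by (intro sum_mono le)
  moreover have "?w \<in> vecs N" using assms(1) by (auto simp: vecs_def ones_def zmul_apply)
  ultimately show ?thesis using le by (auto simp: pts_def algebra_simps)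
qed

text \<open>Lattice lifts may have negative entries. Adding the same multiple of
  \<open>ones N\<close> to all of them makes them monomials, at the price of a shift
  \<open>b\<close> common to all of \<open>F\<close>, which cancels when positions are
  compared.\<close>

lemma effective_lift:
  assumes c: "coords N \<Phi>" and F: "finite F"
  shows "\<exists>C b. \<forall>y\<in>F. \<exists>d\<in>pts N C. \<forall>j<N. \<Phi> j d = y j + b j"
proof -
  obtain h where h: "\<And>y. h y \<in> vecs N" "\<And>y j. j < N \<Longrightarrow> \<Phi> j (h y) = y j"
    using coordsD(2)[OF c] by metis
  obtain K where K: "\<And>v l. v \<in> h ` F \<Longrightarrow> \<bar>v l\<bar> \<le> int K"
    using finite_vecs_bound[of "h ` F" N] F h(1) by blast
  have "\<exists>d\<in>pts N (2 * K * N). \<forall>j<N. \<Phi> j d = y j + \<Phi> j (zmul (int K) (ones N))" if "y \<in> F" for y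
    by (rule bexI[of _ "h y + zmul (int K) (ones N)"])
      (use K that h in \<open>auto simp: additiveD(1)[OF coordsD(1)[OF c]] intro!: shift_in_pts\<close>)
  then show ?thesis by (intro exI[of _ "2 * K * N"] exI[of _ "\<lambda>j. \<Phi> j (zmul (int K) (ones N))"]) blast
qed

text \<open>Division with remainder gives \<open>m = r a + x\<close>, entry by entry. The monomial
  \<open>(p - r) a\<close> has degree at most \<open>(p - r) * s\<close> and does most of the move;
  the rest depends on \<open>x\<close> alone, which ranges over a finite set, and is supplied by
  \<open>effective_lift\<close>.\<close>

lemma ncls_scaling_step:
  assumes c: "coords N \<Phi>" and i: "i \<le> N" and r: "0 < r" "r \<le> p"
    and \<beta>: "\<beta> \<in> PiE {i..<N} (\<lambda>_. {0..<int r})"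
  shows "\<exists>C b. \<forall>s. \<forall>m\<in>pts N (r * s). (\<forall>j\<in>{i..<N}. \<Phi> j m mod int r = \<beta> j) \<longrightarrow>
     (\<exists>g\<in>pts N ((p - r) * s + C). \<forall>j\<in>{i..<N}.
        \<Phi> j g = int (p - r) * ((\<Phi> j m - \<beta> j) div int r) + b j)"
proof -
  note add = coordsD(1)[OF c]
  let ?z = "\<lambda>x j. if i \<le> j then int (p - r) * ((\<Phi> j x - \<beta> j) div int r) else 0"
  let ?X = "{v \<in> vecs N. \<forall>l. \<bar>v l\<bar> \<le> int r}"
  obtain C b where Cb: "\<forall>y\<in>?z ` ?X. \<exists>d\<in>pts N C. \<forall>j<N. \<Phi> j d = y j + b j"
    using effective_lift[OF c finite_imageI[OF finite_bounded_vecs, of ?z N "int r"]]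
    by (elim exE) (rule that)
  have "\<exists>g\<in>pts N ((p - r) * s + C). \<forall>j\<in>{i..<N}.
        \<Phi> j g = int (p - r) * ((\<Phi> j m - \<beta> j) div int r) + b j"
    if m: "m \<in> pts N (r * s)" and res: "\<forall>j\<in>{i..<N}. \<Phi> j m mod int r = \<beta> j" for s m
  proof -
    define a where "a = (\<lambda>l. m l div int r)"
    define x where "x = (\<lambda>l. m l mod int r)"
    have mx: "m = zmul (int r) a + x" by (auto simp: a_def x_def fun_eq_iff zmul_apply)
    have "x \<in> ?X" using m r by (auto simp: x_def pts_def vecs_def less_imp_le)
    from bspec[OF Cb imageI[OF this]]
    obtain d where d: "d \<in> pts N C" "\<forall>j<N. \<Phi> j d = ?z x j + b j" by (elim bexE) (rule that)
    have a0: "a \<in> vecs N" "\<And>l. 0 \<le> a l" using m r by (auto simp: a_def pts_def vecs_def pos_imp_zdiv_nonneg_iff)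
    have "int r * (\<Sum>l<N. a l) \<le> (\<Sum>l<N. m l)"
      unfolding sum_distrib_left by (intro sum_mono) (use r in \<open>auto simp: a_def minus_mod_eq_mult_div[symmetric]\<close>)
    also have "\<dots> \<le> int r * int s" using m by (simp add: pts_def)
    finally have "(\<Sum>l<N. a l) \<le> int s" using r by simp
    then have "int (p - r) * (\<Sum>l<N. a l) \<le> int ((p - r) * s)" by (simp add: mult_left_mono)
    then have "zmul (int (p - r)) a \<in> pts N ((p - r) * s)"
      using a0 by (simp add: pts_def vecs_closed zmul_apply flip: sum_distrib_left)
    then have "zmul (int (p - r)) a + d \<in> pts N ((p - r) * s + C)" using d(1) by (rule pts_add)
    moreover have "\<Phi> j (zmul (int (p - r)) a + d) = int (p - r) * ((\<Phi> j m - \<beta> j) div int r) + b j"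
      if j: "j \<in> {i..<N}" for j
    proof -
      have "\<Phi> j m - \<beta> j = (\<Phi> j x - \<beta> j) + int r * \<Phi> j a"
        unfolding mx by (simp add: additiveD[OF add])
      then have "(\<Phi> j m - \<beta> j) div int r = (\<Phi> j x - \<beta> j) div int r + \<Phi> j a"
        using r by (simp only: div_mult_self2 of_nat_0_eq_iff neq0_conv[symmetric])
      then show ?thesis using j d(2) by (simp add: additiveD[OF add] algebra_simps)
    qed
    ultimately show ?thesis by blast
  qed
  then show ?thesis by blast
qed

text \<open>
  If \<open>y\<close> is the image of a class in the torsion free quotient \<open>\<int>\<^sup>N / W\<close>, written as
  \<open>y = r \<zeta> + \<beta>\<close>, the class is translated, by a monomial depending on \<open>y\<close> only, to every
  position \<open>p \<zeta> + \<epsilon>\<close> (up to a constant).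
\<close>

lemma ncls_scaling:
  assumes c: "coords N \<Phi>" and i: "i \<le> N" and r: "0 < r" "r \<le> p"
  shows "\<exists>C. \<forall>q s. 0 < q \<longrightarrow> p ^ (N - i) * ncls N (zmul (int q) ` flag N \<Phi> i) (r * s)
     \<le> r ^ (N - i) * ncls N (zmul (int q) ` flag N \<Phi> i) (p * (s + C))"
proof -
  note add = coordsD(1)[OF c]
  let ?I = "{i..<N}"
  let ?Res = "\<lambda>t. PiE ?I (\<lambda>_. {0..<int t})"
  have finR: "finite (?Res t)" for t by (simp add: finite_PiE)
  have cardR: "card (?Res t) = t ^ (N - i)" for t by (simp add: card_PiE)
  obtain C1 b1 where g: "\<And>\<beta> s m. \<beta> \<in> ?Res r \<Longrightarrow> m \<in> pts N (r * s) \<Longrightarrow> \<forall>j\<in>?I. \<Phi> j m mod int r = \<beta> j \<Longrightarrow>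
     (\<exists>g\<in>pts N ((p - r) * s + C1 \<beta>). \<forall>j\<in>?I.
        \<Phi> j g = int (p - r) * ((\<Phi> j m - \<beta> j) div int r) + b1 \<beta> j)"
    using ncls_scaling_step[OF c i r] by metis
  obtain C2 b2 where \<delta>: "\<And>y. y \<in> ?Res p \<Longrightarrow> \<exists>d\<in>pts N C2. \<forall>j<N. \<Phi> j d = y j + b2 j"
    using effective_lift[OF c finR] by metis
  \<comment> \<open>Only the finitely many residues enter, so the constant depends neither on
    \<open>q\<close> nor on \<open>s\<close>.\<close>
  define C where "C = Max (C1 ` ?Res r) + C2"
  have C1: "C1 \<beta> + C2 \<le> C" if "\<beta> \<in> ?Res r" for \<beta> using that finR by (simp add: C_def)
  have "p ^ (N - i) * ncls N (zmul (int q) ` flag N \<Phi> i) (r * s)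
     \<le> r ^ (N - i) * ncls N (zmul (int q) ` flag N \<Phi> i) (p * (s + C))" if q: "0 < q" for q s
  proof -
    let ?W = "zmul (int q) ` flag N \<Phi> i"
    have sg: "subgrp ?W" by (intro subgrp_zmul subgrp_flag c)
    let ?A = "\<lambda>\<beta>. {m \<in> pts N (r * s). \<forall>j\<in>?I. \<Phi> j m mod int r = \<beta> j}"
    let ?n = "ncls N ?W (p * (s + C))"
    have step: "p ^ (N - i) * card (cls N ?W (r * s) ` ?A \<beta>) \<le> ?n" if \<beta>: "\<beta> \<in> ?Res r" for \<beta>
    proof -
      \<comment> \<open>The translation must depend on the position \<open>base m\<close> only, so
        that two monomials over the same position keep their difference. Hence it is read off a
        chosen representative.\<close>
      define base where "base m = restrict (\<lambda>j. \<Phi> j m) ?I" for m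
      define rep where "rep m = (SOME x. x \<in> ?A \<beta> \<and> base x = base m)" for m
      have rep: "rep m \<in> ?A \<beta>" "base (rep m) = base m" if "m \<in> ?A \<beta>" for m
        using someI[of "\<lambda>x. x \<in> ?A \<beta> \<and> base x = base m" m] that unfolding rep_def by auto
      have rep_cong: "rep m = rep m'" if "base m = base m'" for m m' using that by (simp add: rep_def)
      have "\<forall>x\<in>?A \<beta>. \<exists>g. g\<in>pts N ((p - r) * s + C1 \<beta>) \<and> (\<forall>j\<in>?I.
          \<Phi> j g = int (p - r) * ((\<Phi> j x - \<beta> j) div int r) + b1 \<beta> j)"
        using g[OF \<beta>] by blast
      from bchoice[OF this] obtain G where G': "\<forall>x\<in>?A \<beta>. G x\<in>pts N ((p - r) * s + C1 \<beta>) \<and> (\<forall>j\<in>?I.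
          \<Phi> j (G x) = int (p - r) * ((\<Phi> j x - \<beta> j) div int r) + b1 \<beta> j)"
        by (elim exE) (rule that)
      have G: "\<And>x. x \<in> ?A \<beta> \<Longrightarrow> G x\<in>pts N ((p - r) * s + C1 \<beta>)"
        "\<And>x j. x \<in> ?A \<beta> \<Longrightarrow> j \<in> ?I \<Longrightarrow> \<Phi> j (G x) = int (p - r) * ((\<Phi> j x - \<beta> j) div int r) + b1 \<beta> j"
        using bspec[OF G'] by (blast, blast)
      obtain \<Delta> where \<Delta>: "\<And>y. y \<in> ?Res p \<Longrightarrow> \<Delta> y \<in> pts N C2" "\<And>y j. y \<in> ?Res p \<Longrightarrow> j < N \<Longrightarrow> \<Phi> j (\<Delta> y) = y j + b2 j"
        using \<delta> by metis
      define T where "T = (\<lambda>(m, y). m + G (rep m) + \<Delta> y)"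
      let ?P = "?A \<beta> \<times> ?Res p"
      have T: "T x \<in> pts N (p * (s + C))" if "x \<in> ?P" for x
      proof -
        obtain m y where x: "x = (m, y)" "m \<in> ?A \<beta>" "y \<in> ?Res p" using \<open>x \<in> ?P\<close> by auto
        have "T x \<in> pts N (r * s + ((p - r) * s + C1 \<beta>) + C2)"
          unfolding T_def x(1) prod.case by (intro pts_add G(1) rep(1) \<Delta>(1) x) (use x in auto)
        moreover have "r * s + ((p - r) * s + C1 \<beta>) + C2 \<le> p * (s + C)"
        proof -
          have "r * s + (p - r) * s = p * s" using r by (simp flip: distrib_right)
          moreover have "C \<le> p * C" using r by simp
          ultimately show ?thesis using C1[OF \<beta>] unfolding distrib_left by linarith
        qed
        ultimately show ?thesis using pts_mono by blast
      qed
      have \<Phi>T: "\<Phi> j (T (m, y)) = int p * ((\<Phi> j m - \<beta> j) div int r) + y j + (\<beta> j + b1 \<beta> j + b2 j)"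
        if "m \<in> ?A \<beta>" "y \<in> ?Res p" "j \<in> ?I" for m y j
      proof -
        have "\<Phi> j (rep m) = \<Phi> j m" using fun_cong[OF rep(2)[OF that(1)], of j] that(3) by (simp add: base_def)
        then have "\<Phi> j (G (rep m)) = int (p - r) * ((\<Phi> j m - \<beta> j) div int r) + b1 \<beta> j"
          using G(2)[OF rep(1)[OF that(1)] that(3)] by simp
        moreover have "\<Phi> j (\<Delta> y) = y j + b2 j" using \<Delta>(2)[OF that(2)] that(3) by simp
        moreover have "\<Phi> j m = int r * ((\<Phi> j m - \<beta> j) div int r) + \<beta> j"
        proof -
          have "int r dvd \<Phi> j m - \<beta> j" using that dvd_minus_mod[of "int r" "\<Phi> j m"] by simp
          then show ?thesis by simp
        qed
        moreover have "int p * z = int r * z + int (p - r) * z" for z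
          using r by (simp flip: distrib_right)
        note this[of "(\<Phi> j m - \<beta> j) div int r"]
        moreover have "\<Phi> j (T (m, y)) = \<Phi> j m + \<Phi> j (G (rep m)) + \<Phi> j (\<Delta> y)"
          unfolding T_def prod.case additiveD(1)[OF add] ..
        ultimately show ?thesis by linarith
      qed
      have "p ^ (N - i) * card (cls N ?W (r * s) ` ?A \<beta>) =
          card ((\<lambda>(m, y). (cls N ?W (r * s) m, y)) ` ?P)"
      proof -
        have "(\<lambda>(m, y). (f m, y)) ` (A \<times> B) = f ` A \<times> B" for f :: "vec \<Rightarrow> vec set" and A and B :: "(nat \<Rightarrow> int) set"
          by force
        from this[of "cls N ?W (r * s)" "?A \<beta>" "?Res p"] show ?thesis by (simp add: card_cartesian_product cardR)
      qed
      also have "\<dots> \<le> card ((\<lambda>x. cls N ?W (p * (s + C)) (T x)) ` ?P)"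
      proof (rule card_image_le_image)
        show "finite ?P" using finR by auto
        fix x x' assume x: "x \<in> ?P" "x' \<in> ?P"
          and eq: "cls N ?W (p * (s + C)) (T x) = cls N ?W (p * (s + C)) (T x')"
        obtain m y m' y' where xx: "x = (m, y)" "x' = (m', y')" by fastforce
        have my: "m \<in> ?A \<beta>" "y \<in> ?Res p" "m' \<in> ?A \<beta>" "y' \<in> ?Res p" using x xx by auto
        have d: "T x - T x' \<in> ?W" using cls_eq_iff[OF sg T[OF x(1)] T[OF x(2)]] eq by simp
        then have "T x - T x' \<in> flag N \<Phi> i" using subgrpD(5)[OF subgrp_flag[OF c]] by auto
        then have "\<Phi> j (T x) = \<Phi> j (T x')" if "j \<in> ?I" for j
          using that by (auto simp: flag_def additiveD[OF add])
        then have e: "int p * ((\<Phi> j m - \<beta> j) div int r) + y j = int p * ((\<Phi> j m' - \<beta> j) div int r) + y' j"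
          if "j \<in> ?I" for j using \<Phi>T[OF my(1,2) that] \<Phi>T[OF my(3,4) that] that xx by fastforce
        have yr: "0 \<le> y j \<and> y j < int p \<and> 0 \<le> y' j \<and> y' j < int p" if "j \<in> ?I" for j
          using my that by (auto simp: PiE_def Pi_def)
        \<comment> \<open>The constant shift has cancelled, and \<open>y\<close> has entries in [0,
          p): it is the residue modulo \<open>p\<close>, and the quotient is recovered next.\<close>
        have yy: "y j = y' j" if "j \<in> ?I" for j
          using arg_cong[OF e[OF that], of "\<lambda>t. t mod int p"] yr[OF that] by simp
        have zz: "(\<Phi> j m - \<beta> j) div int r = (\<Phi> j m' - \<beta> j) div int r" if "j \<in> ?I" for j
          using e[OF that] yy[OF that] r by simp
        have "y = y'" using yy my by (meson PiE_ext)
        have "\<Phi> j m = \<Phi> j m'" if "j \<in> ?I" for j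
        proof -
          have "int r dvd \<Phi> j m - \<beta> j" "int r dvd \<Phi> j m' - \<beta> j"
            using my that dvd_minus_mod[of "int r" "\<Phi> j m"] dvd_minus_mod[of "int r" "\<Phi> j m'"] by simp_all
          then show ?thesis using zz[OF that] by (metis diff_add_cancel dvd_mult_div_cancel)
        qed
        then have "base m = base m'" by (auto simp: base_def restrict_def)
        then have "rep m = rep m'" by (rule rep_cong)
        then have "T x - T x' = m - m'" unfolding T_def xx prod.case \<open>y = y'\<close> by simp
        then have "cls N ?W (r * s) m = cls N ?W (r * s) m'"
          using d cls_eq_iff[OF sg, of m N "r * s" m'] my by simp
        then show "(\<lambda>(m, y). (cls N ?W (r * s) m, y)) x = (\<lambda>(m, y). (cls N ?W (r * s) m, y)) x'"
          using xx \<open>y = y'\<close> by simp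
      qed
      also have "\<dots> \<le> ?n"
        unfolding ncls_def by (rule card_mono) (use T in auto)
      finally show ?thesis .
    qed
    have "pts N (r * s) = (\<Union>\<beta>\<in>?Res r. ?A \<beta>)"
    proof -
      have "restrict (\<lambda>j. \<Phi> j m mod int r) ?I \<in> ?Res r" for m using r by auto
      then have "m \<in> (\<Union>\<beta>\<in>?Res r. ?A \<beta>)" if "m \<in> pts N (r * s)" for m
        using that by (intro UN_I[of "restrict (\<lambda>j. \<Phi> j m mod int r) ?I"]) auto
      then show ?thesis by auto
    qed
    then have "cls N ?W (r * s) ` pts N (r * s) = (\<Union>\<beta>\<in>?Res r. cls N ?W (r * s) ` ?A \<beta>)"
      by (metis image_UN)
    then have "ncls N ?W (r * s) \<le> (\<Sum>\<beta>\<in>?Res r. card (cls N ?W (r * s) ` ?A \<beta>))"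
      unfolding ncls_def by (simp only: card_UN_le[OF finR])
    then have "p ^ (N - i) * ncls N ?W (r * s) \<le> (\<Sum>\<beta>\<in>?Res r. p ^ (N - i) * card (cls N ?W (r * s) ` ?A \<beta>))"
      unfolding sum_distrib_left[symmetric] by (rule mult_left_mono) simp
    also have "\<dots> \<le> (\<Sum>\<beta>\<in>?Res r. ?n)" by (rule sum_mono) (rule step)
    also have "\<dots> = r ^ (N - i) * ?n" by (simp add: cardR)
    finally show ?thesis .
  qed
  then show ?thesis by blast
qed

section \<open>Lower bound for the class count, after Minkowski's second theorem\<close>

lemma fact_times_binomial_Suc:
  "fact (Suc N) * (D + Suc N choose Suc N) = Suc (D + N) * (fact N * (D + N choose N))"
proof -
  have "fact (Suc N) * (D + Suc N choose Suc N) = fact N * (Suc N * (Suc (D + N) choose Suc N))"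
    by (simp add: algebra_simps)
  then show ?thesis by (simp only: Suc_times_binomial_eq mult_ac)
qed

text \<open>The right-hand side is (D + 1) ... (D + N). This is the source of the factor N! in the
  upper bound for the product of the minima.\<close>

lemma power_le_fact_binomial: "D ^ N \<le> fact N * (D + N choose N)"
proof (induction N)
  case (Suc N)
  have "D * D ^ N \<le> Suc (D + N) * (fact N * (D + N choose N))" by (intro mult_mono Suc.IH) auto
  then show ?case by (simp only: fact_times_binomial_Suc power_Suc)
qed simp

lemma minima_nrm_pos:
  assumes "minima N L \<Phi> u k" "L \<subseteq> vecs N" "i < k"
  shows "0 < nrm N (u i)"
proof -
  have "u i \<in> L" "\<Phi> i (u i) \<noteq> 0" "additive (\<Phi> i)" using assms by (auto simp: minima_def coords_def)
  then show ?thesis using assms(2) additiveD(2) by (intro nrm_pos) auto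
qed

text \<open>For the first minimum no two monomials of the given degree are identified by q L. Each
  later step compares q L with a flag, scales modulo the flag and compares back. The offset
  \<open>c0\<close> is arbitrary because every scaling uses up a constant, for which the induction
  hypothesis must leave room; \<open>c0 > 0\<close> keeps the degree strictly below q times the
  minimum.\<close>

lemma ncls_flag_lower:
  assumes m: "minima N L \<Phi> u k" and L: "L = flag N \<Phi> k" and "i < k" "0 < c0"
  shows "\<exists>c. \<forall>q>c. nrm N (u i) ^ (N - i) * (\<Prod>l<i. nrm N (u l)) * (q - c) ^ N
     \<le> fact N * ncls N (zmul (int q) ` L) (nrm N (u i) * (q - c0))"
  using assms(3,4)
proof (induction i arbitrary: c0)
  case 0
  have c: "coords N \<Phi>" using m by (auto simp: minima_def)
  have sg: "subgrp (zmul (int q) ` L)" for q unfolding L by (intro subgrp_zmul subgrp_flag c)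
  have "nrm N (u 0) ^ N * (q - c0) ^ N \<le> fact N * ncls N (zmul (int q) ` L) (nrm N (u 0) * (q - c0))"
    if q: "q > c0" for q
  proof -
    let ?D = "nrm N (u 0) * (q - c0)"
    have pos: "0 < nrm N (u 0)" by (rule minima_nrm_pos[OF m _ 0(1)]) (auto simp: L flag_def)
    have lt: "?D < q * nrm N (u 0)" using pos q 0 by (simp add: mult.commute)
    have "card (pts N ?D) = ncls N {0} ?D"
      by (subst ncls_eq_card_image[of _ _ _ id]) (auto simp: subgrp_def)
    also have "\<dots> \<le> ncls N (zmul (int q) ` L) ?D"
    proof (rule ncls_le[OF _ sg])
      fix v assume v: "v \<in> zmul (int q) ` L" "nrm N v \<le> ?D"
      then obtain w where w: "w \<in> L" "v = zmul (int q) w" by auto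
      then have "q * nrm N w < q * nrm N (u 0)" using v lt nrm_zmul by (metis le_less_trans)
      then have "w \<in> flag N \<Phi> 0" using m w 0 by (auto simp: minima_def)
      then show "v \<in> {0}" using flag_zero[OF c] w by auto
    qed (auto simp: subgrp_def)
    finally have "fact N * (?D + N choose N) \<le> fact N * ncls N (zmul (int q) ` L) ?D"
      unfolding card_pts by (rule mult_left_mono) simp
    with power_le_fact_binomial[of ?D N] show ?thesis
      unfolding power_mult_distrib by (rule order.trans)
  qed
  then show ?case by auto
next
  case (Suc i)
  have c: "coords N \<Phi>" and kN: "k \<le> N" using m by (auto simp: minima_def)
  have sg: "subgrp (zmul (int q) ` flag N \<Phi> j)" for q j by (intro subgrp_zmul subgrp_flag c)
  let ?r = "nrm N (u i)" and ?p = "nrm N (u (Suc i))" and ?d = "N - Suc i"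
  have r: "0 < ?r" by (rule minima_nrm_pos[OF m]) (use Suc.prems in \<open>auto simp: L flag_def\<close>)
  have rp: "?r \<le> ?p" by (rule minima_mono[OF m]) (use Suc.prems in auto)
  obtain C where C: "\<And>q s. 0 < q \<Longrightarrow> ?p ^ ?d * ncls N (zmul (int q) ` flag N \<Phi> (Suc i)) (?r * s)
     \<le> ?r ^ ?d * ncls N (zmul (int q) ` flag N \<Phi> (Suc i)) (?p * (s + C))"
    using ncls_scaling[OF c _ r rp, of "Suc i"] Suc.prems kN by auto
  \<comment> \<open>The extra offset \<open>C\<close> pays for the scaling: from
    \<open>q - (c0 + C)\<close> it leads to \<open>q - c0\<close>.\<close>
  obtain c1 where c1: "\<And>q. q > c1 \<Longrightarrow> ?r ^ (N - i) * (\<Prod>l<i. nrm N (u l)) * (q - c1) ^ N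
     \<le> fact N * ncls N (zmul (int q) ` L) (?r * (q - (c0 + C)))"
    using Suc.IH[of "c0 + C"] Suc.prems by auto
  let ?c = "max c1 (c0 + C)"
  have "?p ^ (N - Suc i) * (\<Prod>l<Suc i. nrm N (u l)) * (q - ?c) ^ N
     \<le> fact N * ncls N (zmul (int q) ` L) (?p * (q - c0))" if q: "q > ?c" for q
  proof -
    let ?s = "q - (c0 + C)" and ?P = "\<Prod>l<i. nrm N (u l)"
    have s: "?s + C = q - c0" using q by auto
    have "?p * (q - c0) < q * ?p" using r rp q Suc.prems by (simp add: mult.commute)
    \<comment> \<open>The degree is below q times the next minimum, so the vectors of q L that
      matter already lie in q times the flag.\<close>
    then have 1: "ncls N (zmul (int q) ` flag N \<Phi> (Suc i)) (?p * (?s + C)) \<le> ncls N (zmul (int q) ` L) (?p * (q - c0))"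
      unfolding s
    proof (intro ncls_le sg)
      show "subgrp (zmul (int q) ` L)" using sg L by simp
      fix v assume lt: "?p * (q - c0) < q * ?p" and v: "v \<in> zmul (int q) ` L" "nrm N v \<le> ?p * (q - c0)"
      then obtain w where w: "w \<in> L" "v = zmul (int q) w" by auto
      then have "q * nrm N w < q * ?p" using v lt nrm_zmul by (metis le_less_trans)
      then have "w \<in> flag N \<Phi> (Suc i)" using m w Suc.prems by (auto simp: minima_def)
      then show "v \<in> zmul (int q) ` flag N \<Phi> (Suc i)" using w by blast
    qed
    have 2: "ncls N (zmul (int q) ` L) (?r * ?s) \<le> ncls N (zmul (int q) ` flag N \<Phi> (Suc i)) (?r * ?s)"
    proof (rule ncls_le)
      show "subgrp (zmul (int q) ` L)" using sg L by simp
      show "v \<in> zmul (int q) ` L" if "v \<in> zmul (int q) ` flag N \<Phi> (Suc i)" for v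
        using that flag_mono[of "Suc i" k] Suc.prems unfolding L by auto
    qed (rule sg)
    have Ni: "N - i = Suc ?d" using Suc.prems kN by auto
    have "?r ^ ?d * (?p ^ ?d * (?r * ?P * (q - ?c) ^ N)) = ?p ^ ?d * (?r ^ (N - i) * ?P * (q - ?c) ^ N)"
      unfolding Ni by simp
    also have "\<dots> \<le> ?p ^ ?d * (?r ^ (N - i) * ?P * (q - c1) ^ N)"
      by (intro mult_left_mono power_mono) auto
    also have "\<dots> \<le> ?p ^ ?d * (fact N * ncls N (zmul (int q) ` L) (?r * ?s))"
      using c1[of q] q by (intro mult_left_mono) auto
    also have "\<dots> \<le> ?p ^ ?d * (fact N * ncls N (zmul (int q) ` flag N \<Phi> (Suc i)) (?r * ?s))"
      using 2 by (intro mult_left_mono) auto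
    also have "\<dots> = fact N * (?p ^ ?d * ncls N (zmul (int q) ` flag N \<Phi> (Suc i)) (?r * ?s))" by simp
    also have "\<dots> \<le> fact N * (?r ^ ?d * ncls N (zmul (int q) ` flag N \<Phi> (Suc i)) (?p * (?s + C)))"
      using C[of q ?s] q by (intro mult_left_mono) auto
    also have "\<dots> \<le> fact N * (?r ^ ?d * ncls N (zmul (int q) ` L) (?p * (q - c0)))"
      using 1 by (intro mult_left_mono) auto
    finally have "?r ^ ?d * (?p ^ ?d * (?r * ?P * (q - ?c) ^ N)) \<le>
        ?r ^ ?d * (fact N * ncls N (zmul (int q) ` L) (?p * (q - c0)))" by (simp add: mult_ac)
    then show ?thesis using r by (simp add: mult_ac)
  qed
  then show ?case by blast
qed

section \<open>The leading coefficient of the class counting polynomial\<close>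

lemma coeff_le_if_eventually_le:
  fixes p q :: "real poly"
  assumes "degree p \<le> n" "degree q \<le> n"
    and le: "\<forall>\<^sub>F D in sequentially. poly p (real D) \<le> poly q (real D)"
  shows "coeff p n \<le> coeff q n"
proof (rule ccontr)
  assume "\<not> ?thesis"
  then have neg: "coeff (p - q) n > 0" by simp
  have "degree (p - q) \<le> n" using assms by (intro degree_diff_le)
  moreover have "n \<le> degree (p - q)" using neg by (intro le_degree) auto
  ultimately have "degree (p - q) = n" by simp
  then have "lead_coeff (p - q) > 0" using neg by simp
  from poly_pinfty_gt_lc[OF this] obtain x0 where x0: "\<And>x. x \<ge> x0 \<Longrightarrow> poly (p - q) x > 0"
    using \<open>lead_coeff (p - q) > 0\<close> by (metis less_le_trans)
  obtain n0 where "\<And>D. D \<ge> n0 \<Longrightarrow> poly p (real D) \<le> poly q (real D)"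
    using le by (auto simp: eventually_sequentially)
  then have "poly p (real (max n0 (nat \<lceil>x0\<rceil>))) \<le> poly q (real (max n0 (nat \<lceil>x0\<rceil>)))" by simp
  moreover have "real (max n0 (nat \<lceil>x0\<rceil>)) \<ge> x0" by linarith
  ultimately show False using x0[of "real (max n0 (nat \<lceil>x0\<rceil>))"] by simp
qed

lemma degree_le_if_eventually_le:
  fixes p q :: "real poly"
  assumes "degree q \<le> n"
    and "\<forall>\<^sub>F D in sequentially. 0 \<le> poly p (real D)"
    and "\<forall>\<^sub>F D in sequentially. poly p (real D) \<le> poly q (real D)"
  shows "degree p \<le> n"
proof (rule ccontr)
  assume n: "\<not> ?thesis"
  have "coeff p (degree p) \<le> coeff q (degree p)" "coeff 0 (degree p) \<le> coeff p (degree p)"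
    by (rule coeff_le_if_eventually_le; use assms n in simp)+
  moreover have "coeff q (degree p) = 0" using n assms(1) by (intro coeff_eq_0) auto
  ultimately have "p = 0" by simp
  then show False using n by simp
qed

section \<open>Upper bound for the class count, after Bezout\<close>

definition zspan :: "(nat \<Rightarrow> vec) \<Rightarrow> nat \<Rightarrow> vec set" where
  "zspan u i = range (\<lambda>c :: nat \<Rightarrow> int. \<Sum>l<i. zmul (c l) (u l))"

lemma subgrp_zspan: "subgrp (zspan u i)"
proof -
  have "0 \<in> zspan u i" by (auto simp: zspan_def intro!: image_eqI[of _ _ "\<lambda>_. 0"])
  moreover have "(\<Sum>l<i. zmul (c l) (u l)) - (\<Sum>l<i. zmul (d l) (u l)) \<in> zspan u i" for c d
    unfolding zspan_def by (rule image_eqI[of _ _ "\<lambda>l. c l - d l"]) (simp_all add: zmul_distrib sum_subtractf)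
  ultimately show ?thesis by (auto simp: subgrp_def zspan_def)
qed

lemma zspan_in: "l < i \<Longrightarrow> u l \<in> zspan u i"
  unfolding zspan_def
  by (rule image_eqI[of _ _ "\<lambda>j. if j = l then 1 else 0"])
    (simp_all add: if_distrib[of "\<lambda>c. zmul c _"] sum.delta cong: if_cong)

lemma zspan_mono: "zspan u i \<subseteq> zspan u (Suc i)"
proof
  fix v assume "v \<in> zspan u i"
  then obtain c where "v = (\<Sum>l<i. zmul (c l) (u l))" by (auto simp: zspan_def)
  then have "v = (\<Sum>l<Suc i. zmul ((c(i := 0)) l) (u l))" by simp
  then show "v \<in> zspan u (Suc i)" unfolding zspan_def by blast
qed

lemma zspan_least: "subgrp R \<Longrightarrow> (\<And>l. l < i \<Longrightarrow> u l \<in> R) \<Longrightarrow> zspan u i \<subseteq> R"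
proof
  fix v assume R: "subgrp R" "\<And>l. l < i \<Longrightarrow> u l \<in> R" and "v \<in> zspan u i"
  then obtain c where v: "v = (\<Sum>l<i. zmul (c l) (u l))" by (auto simp: zspan_def)
  have "(\<Sum>l<j. zmul (c l) (u l)) \<in> R" if "j \<le> i" for j
    using that by (induction j) (use R subgrpD in auto)
  then show "v \<in> R" using v by simp
qed

lemma poly_full_count:
  "\<exists>p::real poly. (\<forall>D. real (D + N choose N) = poly p (real D)) \<and> degree p = N \<and> fact N * coeff p N = 1"
proof -
  let ?q = "\<Prod>i<N. [:real (Suc i), 1:]"
  have "degree ?q = N" by (simp add: degree_prod_sum_eq)
  moreover have "lead_coeff ?q = 1" unfolding lead_coeff_prod by simp
  moreover have "fact N * real (D + N choose N) = poly ?q (real D)" for D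
  proof (induction N)
    case (Suc N)
    have "real (fact (Suc N) * (D + Suc N choose Suc N)) = real (Suc (D + N)) * (fact N * real (D + N choose N))"
      unfolding fact_times_binomial_Suc by (simp add: algebra_simps)
    then show ?case by (simp add: Suc algebra_simps del: fact_Suc binomial_Suc_Suc)
  qed simp
  then have "real (D + N choose N) = poly (smult (1 / fact N) ?q) (real D)" for D
    by (simp add: field_simps)
  ultimately show ?thesis by (intro exI[of _ "smult (1 / fact N) ?q"]) simp
qed

lemma ncls_zero: "ncls N {0} D = (D + N choose N)"
proof -
  have "ncls N {0} D = card (id ` pts N D)"
    by (rule ncls_eq_card_image) (auto simp: subgrp_def)
  then show ?thesis by (simp add: card_pts)
qed

text \<open>The start is the count of all monomials, with normalised top coefficient 1; each
  \<open>u i\<close> lowers the degree bound by one and multiplies the bound for that coefficient by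
  \<open>nrm N (u i)\<close>. The span is used, not the flag, because only the norms of the
  \<open>u l\<close> are known.\<close>

lemma ncls_zspan_poly:
  assumes m: "minima N L \<Phi> u k" and L: "L \<subseteq> vecs N" and "i \<le> k"
  shows "\<exists>p::real poly. (\<forall>\<^sub>F D in sequentially. real (ncls N (zspan u i) D) = poly p (real D)) \<and>
    degree p \<le> N - i \<and> fact (N - i) * coeff p (N - i) \<le> real (\<Prod>l<i. nrm N (u l))"
  using \<open>i \<le> k\<close>
proof (induction i)
  case 0
  have "zspan u 0 = {0}" by (auto simp: zspan_def)
  moreover obtain p :: "real poly" where "\<forall>D. real (D + N choose N) = poly p (real D)"
    "degree p = N" "fact N * coeff p N = 1" using poly_full_count[of N] by blast
  ultimately show ?case by (intro exI[of _ p]) (simp add: ncls_zero)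
next
  case (Suc i)
  have iN: "N - i = Suc (N - Suc i)" and u: "u i \<in> vecs N" and c: "coords N \<Phi>"
    using Suc.prems m L by (auto simp: minima_def)
  note add = coordsD(1)[OF c]
  obtain p :: "real poly" where p: "\<forall>\<^sub>F D in sequentially. real (ncls N (zspan u i) D) = poly p (real D)"
    "degree p \<le> Suc (N - Suc i)" "fact (Suc (N - Suc i)) * coeff p (Suc (N - Suc i)) \<le> real (\<Prod>l<i. nrm N (u l))"
    using Suc iN by auto
  obtain p' :: "real poly" where p': "\<forall>\<^sub>F D in sequentially. real (ncls N (zspan u (Suc i)) D) = poly p' (real D)"
    using evpoly_ncls[OF subgrp_zspan] unfolding evpoly_def by blast
  let ?a = "nrm N (u i)"
  let ?q = "p - pcompose p [:- real ?a, 1:]"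
  \<comment> \<open>Triangularity: \<open>\<Phi> i\<close> vanishes on the earlier vectors but not
    on \<open>u i\<close>, so no nonzero multiple of \<open>u i\<close> lies in their span.\<close>
  have "zspan u i \<subseteq> {v. \<Phi> i v = 0}"
  proof (rule zspan_least)
    show "subgrp {v. \<Phi> i v = 0}" by (auto simp: subgrp_def additiveD[OF add])
    show "u l \<in> {v. \<Phi> i v = 0}" if "l < i" for l
      using m that Suc.prems by (auto simp: minima_def)
  qed
  then have inf: "zmul c (u i) \<notin> zspan u i" if "c \<noteq> 0" for c
    using that m Suc.prems additiveD(5)[OF add] by (auto simp: minima_def subset_iff)
  have ineq: "\<forall>\<^sub>F D in sequentially. poly p' (real D) \<le> poly ?q (real D)"
  proof -
    obtain n0 where n0: "\<And>D. D \<ge> n0 \<Longrightarrow> real (ncls N (zspan u i) D) = poly p (real D)"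
      using p(1) by (auto simp: eventually_sequentially)
    show ?thesis
      using p' eventually_ge_at_top[of "n0 + ?a"]
    proof eventually_elim
      case (elim D)
      have "ncls N (zspan u (Suc i)) D + ncls N (zspan u i) (D - ?a) \<le> ncls N (zspan u i) D"
        by (rule ncls_chain[OF subgrp_zspan subgrp_zspan zspan_mono zspan_in u inf]) (use elim in auto)
      then have "real (ncls N (zspan u (Suc i)) D) + real (ncls N (zspan u i) (D - ?a)) \<le> real (ncls N (zspan u i) D)"
        by linarith
      moreover have "real (ncls N (zspan u i) D) = poly p (real D)" by (rule n0) (use elim in auto)
      moreover have "real (ncls N (zspan u i) (D - ?a)) = poly p (real D - real ?a)"
        using n0[of "D - ?a"] elim by (simp add: of_nat_diff)
      moreover have "poly ?q (real D) = poly p (real D) - poly p (real D - real ?a)"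
        by (simp add: poly_pcompose)
      ultimately show ?case using elim(1) by linarith
    qed
  qed
  have dq: "degree ?q \<le> N - Suc i" "coeff ?q (N - Suc i) = real (Suc (N - Suc i)) * real ?a * coeff p (Suc (N - Suc i))"
    by (rule backward_difference[OF p(2)])+
  have "degree p' \<le> N - Suc i"
    by (rule degree_le_if_eventually_le[OF dq(1) _ ineq]) (use p' in \<open>auto elim!: eventually_mono simp flip: of_nat_0_le_iff\<close>)
  moreover have "fact (N - Suc i) * coeff p' (N - Suc i) \<le> real (\<Prod>l<Suc i. nrm N (u l))"
  proof -
    have "fact (N - Suc i) * coeff p' (N - Suc i) \<le> fact (N - Suc i) * coeff ?q (N - Suc i)"
      by (intro mult_left_mono coeff_le_if_eventually_le ineq dq(1) \<open>degree p' \<le> N - Suc i\<close>) auto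
    also have "\<dots> = (fact (Suc (N - Suc i)) * coeff p (Suc (N - Suc i))) * real ?a"
      unfolding dq(2) by (simp add: algebra_simps)
    also have "\<dots> \<le> real (\<Prod>l<i. nrm N (u l)) * real ?a"
      by (intro mult_right_mono p(3)) auto
    finally show ?thesis by simp
  qed
  ultimately show ?case using p' by blast
qed

text \<open>The span of the \<open>u l\<close> lies in \<open>L\<close>, which gives the degree
  bound and the first estimate. The second compares coefficients of \<open>q ^ N\<close> as
  \<open>q\<close> varies, after the index \<open>q ^ k\<close> has been split off.\<close>

theorem ncls_flag_poly:
  assumes m: "minima N L \<Phi> u k" and L: "L = flag N \<Phi> k"
  shows "\<exists>p::real poly. (\<forall>\<^sub>F D in sequentially. real (ncls N L D) = poly p (real D)) \<and>
    degree p = N - k \<and> fact (N - k) * coeff p (N - k) \<le> real (\<Prod>l<k. nrm N (u l)) \<and>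
    real (\<Prod>l<k. nrm N (u l)) \<le> fact N * coeff p (N - k)"
proof -
  have c: "coords N \<Phi>" and kN: "k \<le> N" using m by (auto simp: minima_def)
  have Lv: "L \<subseteq> vecs N" by (auto simp: L flag_def)
  have sg: "subgrp L" unfolding L by (rule subgrp_flag[OF c])
  obtain p :: "real poly" where p: "\<forall>\<^sub>F D in sequentially. real (ncls N L D) = poly p (real D)"
    using evpoly_ncls[OF sg] unfolding evpoly_def by blast
  obtain p' :: "real poly" where p': "\<forall>\<^sub>F D in sequentially. real (ncls N (zspan u k) D) = poly p' (real D)"
    "degree p' \<le> N - k" "fact (N - k) * coeff p' (N - k) \<le> real (\<Prod>l<k. nrm N (u l))"
    using ncls_zspan_poly[OF m Lv order.refl] by blast
  have sub: "zspan u k \<subseteq> L" by (rule zspan_least[OF sg]) (use m in \<open>auto simp: minima_def\<close>)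
  have ncls_sub: "real (ncls N L D) \<le> real (ncls N (zspan u k) D)" for D
    unfolding of_nat_le_iff by (rule ncls_le[OF sg subgrp_zspan]) (use sub in auto)
  have le: "\<forall>\<^sub>F D in sequentially. poly p (real D) \<le> poly p' (real D)"
    using p p'(1)
  proof eventually_elim
    case (elim D)
    then show ?case using ncls_sub[of D] by simp
  qed
  have deg: "degree p \<le> N - k"
    by (rule degree_le_if_eventually_le[OF p'(2) _ le]) (use p in \<open>auto elim!: eventually_mono simp flip: of_nat_0_le_iff\<close>)
  have upper: "fact (N - k) * coeff p (N - k) \<le> real (\<Prod>l<k. nrm N (u l))"
    by (rule order.trans[OF mult_left_mono[OF coeff_le_if_eventually_le[OF deg p'(2) le]] p'(3)]) simp
  have lower: "real (\<Prod>l<k. nrm N (u l)) \<le> fact N * coeff p (N - k)"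
  proof (cases k)
    \<comment> \<open>With no minimum there is no degree to scale by; here all monomials are
      inequivalent.\<close>
    case 0
    have "coeff (monom 1 N) N \<le> coeff (smult (fact N) p) N"
    proof (rule coeff_le_if_eventually_le)
      have "L = {0}" using flag_zero[OF c] L 0 by simp
      show "\<forall>\<^sub>F D in sequentially. poly (monom 1 N) (real D) \<le> poly (smult (fact N) p) (real D)"
        using p
      proof eventually_elim
        case (elim D)
        have "D ^ N \<le> fact N * ncls N L D"
          unfolding \<open>L = {0}\<close> ncls_zero by (rule power_le_fact_binomial)
        then have "real (D ^ N) \<le> real (fact N * ncls N L D)" by linarith
        then show ?case using elim by (simp add: poly_monom)
      qed
    qed (use deg 0 in \<open>auto intro: degree_monom_le order.trans[OF degree_smult_le]\<close>)
    then show ?thesis using 0 by simp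
  next
    case (Suc i)
    let ?l = "nrm N (u i)"
    have lpos: "0 < ?l" by (rule minima_nrm_pos[OF m Lv]) (simp add: Suc)
    obtain c1 where c1: "\<And>q. q > c1 \<Longrightarrow> ?l ^ (N - i) * (\<Prod>l<i. nrm N (u l)) * (q - c1) ^ N
        \<le> fact N * ncls N (zmul (int q) ` L) (?l * (q - 1))"
      using ncls_flag_lower[OF m L, of i 1] Suc by auto
    obtain n0 where n0: "\<And>D. D \<ge> n0 \<Longrightarrow> real (ncls N L D) = poly p (real D)"
      using p by (auto simp: eventually_sequentially)
    let ?A = "real (?l ^ (N - i) * (\<Prod>l<i. nrm N (u l)))"
    \<comment> \<open>Both sides as polynomials in \<open>q\<close>. The factor
      \<open>monom 1 k\<close> is the index \<open>q ^ k\<close>, and the composition evaluates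
      \<open>p\<close> at the degree \<open>?l * (q - 1)\<close>.\<close>
    let ?P = "smult ?A ([:- real c1, 1:] ^ N)" and ?Q = "smult (fact N) (monom 1 k * pcompose p [:- real ?l, real ?l:])"
    have "coeff ([:- real c1, 1:] ^ N) N = 1" by (simp add: coeff_linear_poly_power)
    then have cP: "coeff ?P N = ?A" by (simp only: coeff_smult mult_1_right)
    have "coeff ?P N \<le> coeff ?Q N"
    proof (rule coeff_le_if_eventually_le)
      show "degree ?P \<le> N" by (rule order.trans[OF degree_smult_le]) (simp add: degree_linear_power)
      show "degree ?Q \<le> N"
        by (rule order.trans[OF degree_smult_le order.trans[OF degree_mult_le]])
          (use pcompose_linear_coeff(1)[OF deg, of "- real ?l" "real ?l"] kN in \<open>simp add: degree_monom_eq\<close>)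
      show "\<forall>\<^sub>F q in sequentially. poly ?P (real q) \<le> poly ?Q (real q)"
        unfolding eventually_sequentially
      proof (intro exI allI impI)
        fix q assume q: "q \<ge> Suc (c1 + n0)"
        have "n0 \<le> 1 * (q - 1)" using q by simp
        also have "\<dots> \<le> ?l * (q - 1)" using lpos by (intro mult_right_mono) auto
        finally have "n0 \<le> ?l * (q - 1)" .
        then have e: "real (ncls N L (?l * (q - 1))) = poly p (real ?l * (real q - 1))"
          using n0[of "?l * (q - 1)"] q by (simp add: of_nat_diff)
        have "?l ^ (N - i) * (\<Prod>l<i. nrm N (u l)) * (q - c1) ^ N
            \<le> fact N * (q ^ k * ncls N L (?l * (q - 1)))"
        proof (rule order.trans)
          show "?l ^ (N - i) * (\<Prod>l<i. nrm N (u l)) * (q - c1) ^ N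
            \<le> fact N * ncls N (zmul (int q) ` L) (?l * (q - 1))" by (rule c1) (use q in simp)
          show "fact N * ncls N (zmul (int q) ` L) (?l * (q - 1)) \<le> fact N * (q ^ k * ncls N L (?l * (q - 1)))"
            unfolding L by (intro mult_left_mono ncls_zmul_flag_le[OF c _ kN]) (use q in auto)
        qed
        then have "real (?l ^ (N - i) * (\<Prod>l<i. nrm N (u l)) * (q - c1) ^ N)
            \<le> real (fact N * (q ^ k * ncls N L (?l * (q - 1))))" by linarith
        then have "?A * (real q - real c1) ^ N \<le> fact N * (real q ^ k * poly p (real ?l * (real q - 1)))"
          using q e by (simp add: of_nat_diff)
        then show "poly ?P (real q) \<le> poly ?Q (real q)"
          by (simp add: poly_monom poly_pcompose algebra_simps)
      qed
    qed
    then have "?A \<le> coeff ?Q N" unfolding cP .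
    moreover have "coeff ?Q N = fact N * (real ?l ^ (N - k) * coeff p (N - k))"
      using kN by (simp add: coeff_monom_mult pcompose_linear_coeff(2)[OF deg])
    moreover have "N - i = Suc (N - k)" using Suc kN by simp
    ultimately have "real ?l ^ (N - k) * real (\<Prod>l<k. nrm N (u l)) \<le> real ?l ^ (N - k) * (fact N * coeff p (N - k))"
      by (simp add: Suc algebra_simps)
    then show ?thesis using lpos by simp
  qed
  \<comment> \<open>Positivity of the minima turns the lower estimate into the exact degree.\<close>
  have "real (\<Prod>l<k. nrm N (u l)) > 0"
    unfolding of_nat_0_less_iff using minima_nrm_pos[OF m Lv] by (intro prod_pos) auto
  then have "coeff p (N - k) \<noteq> 0" using lower by auto
  then have "degree p = N - k" using deg le_degree by (metis le_antisym)
  then show ?thesis using p upper lower by blast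
qed

section \<open>Forms and torus points\<close>

definition mons :: "nat \<Rightarrow> nat \<Rightarrow> (nat \<Rightarrow>\<^sub>0 nat) set" where
  "mons N D = {m. Poly_Mapping.keys m \<subseteq> {..N} \<and> monom_degree m = D}"

definition expv :: "nat \<Rightarrow> (nat \<Rightarrow>\<^sub>0 nat) \<Rightarrow> vec" where
  "expv N m = (\<lambda>i. if i < N then int (Poly_Mapping.lookup m (Suc i)) else 0)"

definition chr :: "nat \<Rightarrow> (nat \<Rightarrow> 'k::field) \<Rightarrow> vec \<Rightarrow> 'k" where
  "chr N z v = (\<Prod>i<N. z i powi v i)"

text \<open>Coordinates on the torus with \<alpha> as unit element and the zeroth coordinate fixed
  to \<open>\<alpha> 0\<close>. A monomial then becomes a character times its constant value at
  \<alpha>.\<close>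

definition vrep :: "nat \<Rightarrow> (nat \<Rightarrow> 'k::field) \<Rightarrow> (nat \<Rightarrow> 'k) \<Rightarrow> nat \<Rightarrow> 'k" where
  "vrep N \<alpha> z = (\<lambda>i. if i \<le> N then \<alpha> i * (case i of 0 \<Rightarrow> 1 | Suc j \<Rightarrow> z j) else 0)"

definition tpt :: "nat \<Rightarrow> (nat \<Rightarrow> 'k::field) \<Rightarrow> (nat \<Rightarrow> 'k) \<Rightarrow> 'k pt" where
  "tpt N \<alpha> z = proj_rel N `` {vrep N \<alpha> z}"

lemma forms_iff: "f \<in> forms N D \<longleftrightarrow> Poly_Mapping.keys f \<subseteq> mons N D"
  by (auto simp: forms_def mpolys_def mons_def)

lemma mons_degree: "m \<in> mons N D \<Longrightarrow> Poly_Mapping.lookup m 0 + (\<Sum>i<N. Poly_Mapping.lookup m (Suc i)) = D"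
  by (auto simp: mons_def monom_degree_superset[of "{..N}"] sum.atMost_Suc_shift simp flip: sum.lessThan_Suc_shift lessThan_Suc_atMost)

lemma expv_in_pts: "m \<in> mons N D \<Longrightarrow> expv N m \<in> pts N D"
  using mons_degree[of m N D] by (auto simp: pts_def vecs_def expv_def simp flip: of_nat_sum)

lemma inj_expv: "inj_on (expv N) (mons N D)"
proof (rule inj_onI)
  fix m m' assume m: "m \<in> mons N D" "m' \<in> mons N D" "expv N m = expv N m'"
  have s: "Poly_Mapping.lookup m (Suc i) = Poly_Mapping.lookup m' (Suc i)" if "i < N" for i
    using fun_cong[OF m(3), of i] that by (simp add: expv_def)
  then have "Poly_Mapping.lookup m 0 = Poly_Mapping.lookup m' 0"
    using mons_degree[OF m(1)] mons_degree[OF m(2)] by simp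
  moreover have "Poly_Mapping.lookup m i = 0 \<and> Poly_Mapping.lookup m' i = 0" if "i > N" for i
    using m that by (auto simp: mons_def in_keys_iff[symmetric] subset_iff simp flip: not_in_keys_iff_lookup_eq_zero)
  ultimately show "m = m'"
    using s by (intro poly_mapping_eqI) (metis Suc_le_eq not_le old.nat.exhaust)
qed

lemma expv_surj:
  assumes "v \<in> pts N D"
  shows "\<exists>m\<in>mons N D. expv N m = v"
proof -
  let ?f = "\<lambda>i. if i = 0 then D - nat (\<Sum>i<N. v i) else if i \<le> N then nat (v (i - 1)) else 0"
  have fin: "finite {i. ?f i \<noteq> 0}" by (rule finite_subset[of _ "{..N}"]) auto
  define m where "m = Abs_poly_mapping ?f"
  have l: "Poly_Mapping.lookup m = ?f" unfolding m_def by (rule lookup_Abs_poly_mapping[OF fin])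
  have keys: "Poly_Mapping.keys m \<subseteq> {..N}" by (auto simp: in_keys_iff l split: if_splits)
  have "monom_degree m = (\<Sum>i\<in>{..N}. ?f i)"
    using monom_degree_superset[OF _ keys] by (simp add: l)
  also have "\<dots> = ?f 0 + (\<Sum>i<N. nat (v i))"
    by (subst lessThan_Suc_atMost[symmetric], subst sum.lessThan_Suc_shift) simp
  also have "\<dots> = D"
  proof -
    have "int (\<Sum>i<N. nat (v i)) = (\<Sum>i<N. v i)" using assms by (auto simp: pts_def)
    then have "nat (\<Sum>i<N. v i) = (\<Sum>i<N. nat (v i))" by (metis nat_int)
    moreover have "nat (\<Sum>i<N. v i) \<le> D" using assms by (auto simp: pts_def)
    ultimately show ?thesis by simp
  qed
  finally have "m \<in> mons N D" using keys by (simp add: mons_def)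
  moreover have "expv N m = v" using assms by (auto simp: expv_def l pts_def vecs_def)
  ultimately show ?thesis by blast
qed

lemma expv_image: "expv N ` mons N D = pts N D"
  using expv_in_pts expv_surj by blast

lemma finite_mons [simp]: "finite (mons N D)"
  using inj_expv expv_image finite_pts by (metis finite_imageD)

lemma card_mons: "card (mons N D) = card (pts N D)"
  using card_image[OF inj_expv] by (simp add: expv_image)

lemma mpoly_eval_forms:
  "f \<in> forms N D \<Longrightarrow> mpoly_eval v f = (\<Sum>m\<in>mons N D. Poly_Mapping.lookup f m * monom_eval v m)"
  by (rule mpoly_eval_superset) (auto simp: forms_iff)

lemma monom_eval_vrep:
  assumes "m \<in> mons N D"
  shows "monom_eval (vrep N \<alpha> z) m = monom_eval \<alpha> m * chr N z (expv N m)"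
proof -
  have k: "finite {..N}" "Poly_Mapping.keys m \<subseteq> {..N}" using assms by (auto simp: mons_def)
  have "monom_eval (vrep N \<alpha> z) m =
      (\<Prod>i\<le>N. \<alpha> i ^ Poly_Mapping.lookup m i) * (\<Prod>i\<le>N. (case i of 0 \<Rightarrow> 1 | Suc j \<Rightarrow> z j) ^ Poly_Mapping.lookup m i)"
    by (simp add: monom_eval_superset[OF k] vrep_def power_mult_distrib prod.distrib)
  also have "(\<Prod>i\<le>N. (case i of 0 \<Rightarrow> 1 | Suc j \<Rightarrow> z j) ^ Poly_Mapping.lookup m i) =
      (\<Prod>i<N. z i ^ Poly_Mapping.lookup m (Suc i))"
    by (subst lessThan_Suc_atMost[symmetric], subst prod.lessThan_Suc_shift) simp
  finally show ?thesis by (simp add: monom_eval_superset[OF k, of \<alpha>] chr_def expv_def)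
qed

lemma monom_eval_nz: "m \<in> mons N D \<Longrightarrow> (\<And>i. i \<le> N \<Longrightarrow> \<alpha> i \<noteq> 0) \<Longrightarrow> monom_eval \<alpha> m \<noteq> 0"
  by (auto simp: monom_eval_def mons_def subset_iff)

lemma chr_diff: "(\<And>i. i < N \<Longrightarrow> z i \<noteq> 0) \<Longrightarrow> chr N z (u - v) = chr N z u / chr N z v"
  by (auto simp: chr_def power_int_diff simp flip: prod_dividef intro!: prod.cong)

lemma chr_nz: "(\<And>i. i < N \<Longrightarrow> z i \<noteq> 0) \<Longrightarrow> chr N z u \<noteq> 0"
  by (auto simp: chr_def)

lemma subgrp_chr_kernel: "(\<And>i. i < N \<Longrightarrow> z i \<noteq> 0) \<Longrightarrow> subgrp {v. chr N z v = 1}"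
  unfolding subgrp_def by (auto simp: chr_diff) (simp add: chr_def)

section \<open>Graded parts of the twisted lattice ideal\<close>

abbreviation mcoeff :: "'k::zero mpoly \<Rightarrow> (nat \<Rightarrow>\<^sub>0 nat) \<Rightarrow> 'k" where
  "mcoeff \<equiv> Poly_Mapping.lookup"

abbreviation mcls :: "nat \<Rightarrow> vec set \<Rightarrow> nat \<Rightarrow> (nat \<Rightarrow>\<^sub>0 nat) \<Rightarrow> (nat \<Rightarrow>\<^sub>0 nat) set" where
  "mcls N R D m0 \<equiv> {m. m \<in> mons N D \<and> expv N m - expv N m0 \<in> R}"

text \<open>The degree \<open>D\<close> part of the lattice ideal of \<open>R\<close>, twisted by \<open>\<alpha>\<close>.\<close>

definition toric_forms :: "nat \<Rightarrow> vec set \<Rightarrow> (nat \<Rightarrow> 'k::field) \<Rightarrow> nat \<Rightarrow> 'k mpoly set" where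
  "toric_forms N R \<alpha> D = {f \<in> forms N D. \<forall>m0\<in>mons N D.
     (\<Sum>m\<in>mcls N R D m0. mcoeff f m * monom_eval \<alpha> m) = 0}"

lemma sum_over_classes:
  fixes g h :: "(nat \<Rightarrow>\<^sub>0 nat) \<Rightarrow> 'k::field"
  assumes R: "subgrp R"
    and g: "\<And>m0. m0 \<in> mons N D \<Longrightarrow> (\<Sum>m\<in>mcls N R D m0. g m) = 0"
    and h: "\<And>m m'. m \<in> mons N D \<Longrightarrow> m' \<in> mons N D \<Longrightarrow> expv N m - expv N m' \<in> R \<Longrightarrow> h m = h m'"
  shows "(\<Sum>m\<in>mons N D. g m * h m) = 0"
proof -
  let ?c = "\<lambda>m. cls N R D (expv N m)"
  have "(\<Sum>m\<in>mons N D. g m * h m) = (\<Sum>C\<in>?c ` mons N D. \<Sum>m | m \<in> mons N D \<and> ?c m = C. g m * h m)"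
    by (rule sum.image_gen) simp
  also have "\<dots> = 0"
  proof (rule sum.neutral, rule ballI)
    fix C assume "C \<in> ?c ` mons N D"
    then obtain m0 where m0: "m0 \<in> mons N D" "C = ?c m0" by blast
    have eq: "{m. m \<in> mons N D \<and> ?c m = C} = mcls N R D m0"
      unfolding m0(2) using cls_eq_iff[OF R expv_in_pts expv_in_pts] m0(1) by blast
    have "(\<Sum>m | m \<in> mons N D \<and> ?c m = C. g m * h m) =
        (\<Sum>m\<in>mcls N R D m0. g m * h m0)"
      unfolding eq by (rule sum.cong) (use h m0 in auto)
    also have "\<dots> = 0" using g[OF m0(1)] by (simp flip: sum_distrib_right)
    finally show "(\<Sum>m | m \<in> mons N D \<and> ?c m = C. g m * h m) = 0" .
  qed
  finally show ?thesis .
qed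

text \<open>In degree \<open>D\<close> only exponent differences of norm at most \<open>D\<close>
  occur, so the character has to be trivial on those alone. This slack puts a larger subtorus into
  the zero set in low degree.\<close>

lemma toric_forms_vanish:
  assumes R: "subgrp R" and f: "f \<in> toric_forms N R \<alpha> D"
    and z: "\<And>i. i < N \<Longrightarrow> z i \<noteq> 0"
    and chr: "\<And>v. v \<in> R \<Longrightarrow> v \<in> vecs N \<Longrightarrow> nrm N v \<le> D \<Longrightarrow> chr N z v = 1"
  shows "mpoly_eval (vrep N \<alpha> z) f = 0"
proof -
  have f': "f \<in> forms N D" using f by (simp add: toric_forms_def)
  have "mpoly_eval (vrep N \<alpha> z) f =
      (\<Sum>m\<in>mons N D. (mcoeff f m * monom_eval \<alpha> m) * chr N z (expv N m))"
    unfolding mpoly_eval_forms[OF f'] by (rule sum.cong) (simp_all add: monom_eval_vrep mult.assoc)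
  also have "\<dots> = 0"
  proof (rule sum_over_classes[OF R])
    fix m m' assume m: "m \<in> mons N D" "m' \<in> mons N D" "expv N m - expv N m' \<in> R"
    then have "chr N z (expv N m - expv N m') = 1"
      using chr nrm_diff_le pts_diff_vecs expv_in_pts by blast
    then show "chr N z (expv N m) = chr N z (expv N m')"
      using chr_nz[OF z] by (simp add: chr_diff[OF z])
  qed (use f in \<open>auto simp: toric_forms_def\<close>)
  finally show ?thesis .
qed

text \<open>The form is the binomial of \<open>ppart u\<close> and \<open>ppart (- u)\<close>,
  filled up to degree \<open>D\<close> with the zeroth variable; its coefficients invert the values
  at \<alpha> to undo the twist.\<close>

lemma toric_binomial:
  fixes \<alpha> :: "nat \<Rightarrow> 'k::field"
  assumes R: "subgrp R" and \<alpha>: "\<And>i. i \<le> N \<Longrightarrow> \<alpha> i \<noteq> 0"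
    and u: "u \<in> R" "u \<in> vecs N" "nrm N u \<le> D"
  shows "\<exists>f\<in>toric_forms N R \<alpha> D. \<forall>z. (\<forall>i<N. z i \<noteq> 0) \<longrightarrow>
      (mpoly_eval (vrep N \<alpha> z) f = 0 \<longleftrightarrow> chr N z u = 1)"
proof -
  obtain m1 where m1: "m1 \<in> mons N D" "expv N m1 = ppart u"
    using expv_surj[of "ppart u" N D] nrm_parts(1)[OF u(2)] pts_mono[OF u(3)] by blast
  obtain m2 where m2: "m2 \<in> mons N D" "expv N m2 = ppart (- u)"
    using expv_surj[of "ppart (- u)" N D] nrm_parts(2)[OF u(2)] pts_mono[OF u(3)] by blast
  have nz: "monom_eval \<alpha> m1 \<noteq> 0" "monom_eval \<alpha> m2 \<noteq> 0" using monom_eval_nz m1 m2 \<alpha> by blast+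
  let ?f = "Poly_Mapping.single m1 (1 / monom_eval \<alpha> m1) - Poly_Mapping.single m2 (1 / monom_eval \<alpha> m2)"
  have forms: "?f \<in> forms N D"
  proof -
    have "Poly_Mapping.keys ?f \<subseteq> {m1, m2}"
      by (rule order.trans[OF keys_diff]) auto
    then show ?thesis using m1 m2 by (auto simp: forms_iff)
  qed
  have lk: "mcoeff ?f m * monom_eval \<alpha> m = (if m = m1 then 1 else 0) - (if m = m2 then 1 else 0)" for m
    using nz by (auto simp: lookup_minus lookup_single when_def)
  have "?f \<in> toric_forms N R \<alpha> D"
    unfolding toric_forms_def
  proof (intro CollectI conjI ballI forms)
    fix m0 assume "m0 \<in> mons N D"
    have "expv N m1 - expv N m2 \<in> R" using u by (simp add: m1 m2 ppart_diff)
    from subgrpD(2)[OF R _ this, of "expv N m1 - expv N m0"] subgrpD(3)[OF R this, of "expv N m2 - expv N m0"]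
    have "expv N m1 - expv N m0 \<in> R \<longleftrightarrow> expv N m2 - expv N m0 \<in> R" by auto
    then show "(\<Sum>m\<in>mcls N R D m0. mcoeff ?f m * monom_eval \<alpha> m) = 0"
      using m1 m2 by (simp add: lk sum_subtractf sum.delta)
  qed
  moreover have "mpoly_eval (vrep N \<alpha> z) ?f = 0 \<longleftrightarrow> chr N z u = 1" if z: "\<forall>i<N. z i \<noteq> 0" for z
  proof -
    have z': "\<And>i. i < N \<Longrightarrow> z i \<noteq> 0" using z by blast
    have "mpoly_eval (vrep N \<alpha> z) ?f = mpoly_eval (vrep N \<alpha> z) (Poly_Mapping.single m1 (1 / monom_eval \<alpha> m1)) +
       mpoly_eval (vrep N \<alpha> z) (Poly_Mapping.single m2 (- (1 / monom_eval \<alpha> m2)))"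
      by (simp add: single_uminus flip: mpoly_eval_add)
    also have "\<dots> = chr N z (ppart u) - chr N z (ppart (- u))"
      using nz by (simp add: mpoly_eval_single monom_eval_vrep[OF m1(1)] monom_eval_vrep[OF m2(1)] m1 m2)
    finally have 1: "mpoly_eval (vrep N \<alpha> z) ?f = chr N z (ppart u) - chr N z (ppart (- u))" .
    have "chr N z u = chr N z (ppart u) / chr N z (ppart (- u))"
      using chr_diff[OF z', where ?u = "ppart u" and ?v = "ppart (- u)"] by (simp add: ppart_diff)
    then show ?thesis using 1 chr_nz[OF z'] by simp
  qed
  ultimately show ?thesis by blast
qed

section \<open>Independence of characters\<close>

lemma infinite_alg_closed: "infinite (UNIV :: 'k::alg_closed_field set)"
proof
  assume fin: "finite (UNIV :: 'k set)"
  \<comment> \<open>Over a finite field this polynomial would take the value 1 everywhere.\<close>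
  let ?p = "(\<Prod>a\<in>UNIV. [:- a, 1:]) + 1 :: 'k poly"
  have d: "degree (\<Prod>a\<in>UNIV. [:- a, 1:] :: 'k poly) = card (UNIV :: 'k set)"
    by (simp add: degree_prod_sum_eq)
  have "card (UNIV :: 'k set) > 0" using fin by (simp add: card_gt_0_iff)
  then have "degree ?p = card (UNIV :: 'k set)"
    using d by (subst degree_add_eq_left) auto
  then have "degree ?p > 0" using \<open>card UNIV > 0\<close> by simp
  then obtain x where "poly ?p x = 0" using alg_closed_imp_poly_has_root by blast
  moreover have "(\<Prod>a\<in>UNIV. x - a) = 0" using fin by (intro prod_zero) auto
  ultimately show False by (simp add: poly_prod)
qed

lemma exists_nonroot:
  fixes p :: "'k::alg_closed_field poly"
  assumes "p \<noteq> 0"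
  shows "\<exists>x. poly p x \<noteq> 0"
  using poly_roots_finite[OF assms] infinite_alg_closed by (metis (mono_tags, lifting) UNIV_eq_I mem_Collect_eq)

lemma exists_powi_neq:
  assumes "a \<noteq> b"
  shows "\<exists>x::'k::alg_closed_field. x \<noteq> 0 \<and> x powi a \<noteq> x powi b"
proof -
  have "\<exists>x::'k. x \<noteq> 0 \<and> x powi a \<noteq> x powi b" if "a < b" for a b
  proof -
    \<comment> \<open>The factor \<open>[:0, 1:]\<close> forces a point where the polynomial is
      nonzero to be nonzero itself.\<close>
    let ?p = "[:0, 1:] * (monom 1 (nat (b - a)) - 1) :: 'k poly"
    have "coeff (monom 1 (nat (b - a)) - 1 :: 'k poly) (nat (b - a)) = 1"
      using that by (simp add: coeff_1)
    then have "monom 1 (nat (b - a)) - 1 \<noteq> (0 :: 'k poly)" by (metis coeff_0 zero_neq_one)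
    then have "?p \<noteq> 0" by (simp del: mult_pCons_left)
    then obtain x where "poly ?p x \<noteq> 0" using exists_nonroot by blast
    then have x: "x \<noteq> 0" "x ^ nat (b - a) \<noteq> 1" by (auto simp: poly_monom)
    then have "x powi (b - a) \<noteq> 1" using that by (simp add: power_int_def)
    then have "x powi b \<noteq> x powi a" using x by (auto simp: power_int_diff)
    then show ?thesis using x by metis
  qed
  then show ?thesis using assms by (metis linorder_neqE_linordered_idom)
qed

text \<open>Artin's argument: translating a relation by \<open>t\<close> and subtracting a multiple
  of the original removes the character \<open>b0\<close>. Extensionality makes distinct exponents
  differ at some index in \<open>J\<close>.\<close>

lemma characters_independent:
  fixes a :: "(nat \<Rightarrow> int) \<Rightarrow> 'k::alg_closed_field"
  assumes "finite X" "finite J" "X \<subseteq> extensional J"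
    and "\<And>s. (\<And>l. s l \<noteq> 0) \<Longrightarrow> (\<Sum>b\<in>X. a b * (\<Prod>l\<in>J. s l powi b l)) = 0"
    and "b \<in> X"
  shows "a b = 0"
  using assms
proof (induction X arbitrary: a b rule: finite_induct)
  case (insert b0 X)
  note rel = insert.prems(3)
  let ?\<chi> = "\<lambda>b s. \<Prod>l\<in>J. (s l :: 'k) powi b l"
  have X0: "a b = 0" if b: "b \<in> X" for b
  proof -
    have "b \<noteq> b0" using b insert.hyps by auto
    then obtain l where l: "l \<in> J" "b l \<noteq> b0 l" using b insert.prems(2) by (meson extensionalityI insert_subset subsetD)
    obtain x :: 'k where x: "x \<noteq> 0" "x powi b l \<noteq> x powi b0 l" using exists_powi_neq[OF l(2)] by blast
    define t where "t = (\<lambda>i. if i = l then x else 1)"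
    have \<chi>t: "?\<chi> c t = x powi c l" for c
    proof -
      have "?\<chi> c t = (\<Prod>i\<in>J. if i = l then x powi c l else 1)" by (rule prod.cong) (auto simp: t_def)
      then show ?thesis using l assms(2) by (simp add: prod.delta)
    qed
    have "a b * (?\<chi> b t - ?\<chi> b0 t) = 0"
    proof (rule insert.IH[of "\<lambda>c. a c * (?\<chi> c t - ?\<chi> b0 t)"])
      fix s :: "nat \<Rightarrow> 'k" assume s: "\<And>l. s l \<noteq> 0"
      have \<chi>m: "?\<chi> c (\<lambda>l. s l * t l) = ?\<chi> c s * ?\<chi> c t" for c
        by (simp add: power_int_mult_distrib prod.distrib)
      have "(\<Sum>c\<in>insert b0 X. a c * ?\<chi> c (\<lambda>l. s l * t l)) - ?\<chi> b0 t * (\<Sum>c\<in>insert b0 X. a c * ?\<chi> c s) = 0"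
        using rel[of s] rel[of "\<lambda>l. s l * t l"] s x by (simp add: t_def)
      then show "(\<Sum>c\<in>X. a c * (?\<chi> c t - ?\<chi> b0 t) * ?\<chi> c s) = 0"
        unfolding \<chi>m using insert.hyps by (simp add: algebra_simps sum_subtractf sum_distrib_left)
    qed (use insert.prems b in auto)
    then show ?thesis using x by (simp add: \<chi>t)
  qed
  moreover have "a b0 = 0"
  proof -
    have "(\<Sum>b\<in>X. a b * ?\<chi> b (\<lambda>_. 1)) = 0" using X0 by simp
    then show ?thesis using rel[of "\<lambda>_. 1"] insert.hyps by simp
  qed
  ultimately show ?case using insert.prems(4) by auto
qed simp

text \<open>The functionals \<open>B l\<close> act as cocharacters: on this torus the character
  \<open>v\<close> takes the value \<open>\<Prod>l\<in>J. s l powi B l v\<close>. The monomial map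
  and the subtori belonging to flags are both of this form.\<close>

definition zpt :: "(nat \<Rightarrow> vec \<Rightarrow> int) \<Rightarrow> nat set \<Rightarrow> (nat \<Rightarrow> 'k::field) \<Rightarrow> nat \<Rightarrow> 'k" where
  "zpt B J s i = (\<Prod>l\<in>J. s l powi B l (unit_vec i))"

lemma power_int_sum: "(x::'k::field) \<noteq> 0 \<Longrightarrow> x powi (\<Sum>i\<in>I. f i) = (\<Prod>i\<in>I. x powi f i)"
  by (induction I rule: infinite_finite_induct) (auto simp: power_int_add)

lemma power_int_prod: "(\<Prod>i\<in>I. f i :: 'k::field) powi n = (\<Prod>i\<in>I. f i powi n)"
  by (induction I rule: infinite_finite_induct) (auto simp: power_int_mult_distrib)

lemma zpt_nz: "finite J \<Longrightarrow> (\<And>l. l \<in> J \<Longrightarrow> s l \<noteq> 0) \<Longrightarrow> zpt B J s i \<noteq> 0"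
  by (auto simp: zpt_def)

lemma chr_zpt:
  assumes "finite J" "\<And>l. additive (B l)" "\<And>l. l \<in> J \<Longrightarrow> s l \<noteq> 0" "v \<in> vecs N"
  shows "chr N (zpt B J s) v = (\<Prod>l\<in>J. s l powi B l v)"
proof -
  have "chr N (zpt B J s) v = (\<Prod>i<N. \<Prod>l\<in>J. s l powi (B l (unit_vec i) * v i))"
    by (simp add: chr_def zpt_def power_int_prod power_int_mult)
  also have "\<dots> = (\<Prod>l\<in>J. \<Prod>i<N. s l powi (B l (unit_vec i) * v i))" by (rule prod.swap)
  also have "\<dots> = (\<Prod>l\<in>J. s l powi B l v)"
    by (rule prod.cong) (auto simp: additive_expand[OF assms(2,4)] power_int_sum assms(3) mult.commute)
  finally show ?thesis .
qed

text \<open>Restricted to the subtorus, monomials become the same character exactly when all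
  \<open>B l\<close> agree on them, that is, when they are equivalent modulo the common kernel.
  Independence of characters then makes every class sum vanish.\<close>

lemma toric_forms_if_vanish:
  fixes \<alpha> :: "nat \<Rightarrow> 'k::alg_closed_field"
  assumes J: "finite J" and B: "\<And>l. additive (B l)" and f: "f \<in> forms N D"
    and van: "\<And>s. (\<And>l. s l \<noteq> 0) \<Longrightarrow> mpoly_eval (vrep N \<alpha> (zpt B J s)) f = 0"
  shows "f \<in> toric_forms N {v \<in> vecs N. \<forall>l\<in>J. B l v = 0} \<alpha> D"
proof -
  let ?b = "\<lambda>m. restrict (\<lambda>l. B l (expv N m)) J"
  let ?g = "\<lambda>m. mcoeff f m * monom_eval \<alpha> m"
  let ?a = "\<lambda>b. \<Sum>m | m \<in> mons N D \<and> ?b m = b. ?g m"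
  have 0: "?a b = 0" if "b \<in> ?b ` mons N D" for b
  proof (rule characters_independent[OF _ J _ _ that])
    fix s :: "nat \<Rightarrow> 'k" assume s: "\<And>l. s l \<noteq> 0"
    have "0 = mpoly_eval (vrep N \<alpha> (zpt B J s)) f" using van[OF s] by simp
    also have "\<dots> = (\<Sum>m\<in>mons N D. ?g m * chr N (zpt B J s) (expv N m))"
      unfolding mpoly_eval_forms[OF f]
      by (rule sum.cong) (simp_all add: monom_eval_vrep mult.assoc)
    also have "\<dots> = (\<Sum>m\<in>mons N D. ?g m * (\<Prod>l\<in>J. s l powi (?b m) l))"
      by (rule sum.cong) (auto simp: chr_zpt[OF J B s pts_vecs[OF expv_in_pts]])
    also have "\<dots> = (\<Sum>b\<in>?b ` mons N D. \<Sum>m | m \<in> mons N D \<and> ?b m = b. ?g m * (\<Prod>l\<in>J. s l powi (?b m) l))"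
      by (rule sum.image_gen) simp
    also have "\<dots> = (\<Sum>b\<in>?b ` mons N D. ?a b * (\<Prod>l\<in>J. s l powi b l))"
      by (simp add: sum_distrib_right)
    finally show "(\<Sum>b\<in>?b ` mons N D. ?a b * (\<Prod>l\<in>J. s l powi b l)) = 0" by simp
  qed auto
  have "(\<Sum>m\<in>mcls N ({v \<in> vecs N. \<forall>l\<in>J. B l v = 0}) D m0. ?g m) = 0"
    if m0: "m0 \<in> mons N D" for m0
  proof -
    have "?b m = ?b m0 \<longleftrightarrow> expv N m - expv N m0 \<in> {v \<in> vecs N. \<forall>l\<in>J. B l v = 0}" if "m \<in> mons N D" for m
    proof -
      have "?b m = ?b m0 \<longleftrightarrow> (\<forall>l\<in>J. B l (expv N m) = B l (expv N m0))"
        by (auto simp: restrict_def fun_eq_iff)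
      then show ?thesis
        using pts_diff_vecs[OF expv_in_pts[OF that] expv_in_pts[OF m0]] by (auto simp: additiveD[OF B])
    qed
    then have "mcls N ({v \<in> vecs N. \<forall>l\<in>J. B l v = 0}) D m0 =
       {m. m \<in> mons N D \<and> ?b m = ?b m0}" by blast
    then show ?thesis using 0[of "?b m0"] m0 by simp
  qed
  then show ?thesis using f by (auto simp: toric_forms_def)
qed

section \<open>The Hilbert function\<close>

lemma lookup_scale: "mcoeff (mpoly_scale c f) m = c * mcoeff f m"
proof -
  have "mpoly_scale c f = (\<Sum>n\<in>Poly_Mapping.keys f. Poly_Mapping.single n (c * mcoeff f n))"
    unfolding mpoly_scale_def
    by (subst mpoly_sum_monomials[of f]) (simp add: sum_distrib_left mult_single)
  then have "mcoeff (mpoly_scale c f) m =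
      (\<Sum>n\<in>Poly_Mapping.keys f. if n = m then c * mcoeff f n else 0)"
    by (simp add: lookup_sum lookup_single when_def)
  then show ?thesis by (simp add: sum.delta in_keys_iff)
qed

lemma triangular_basis:
  fixes g :: "(nat \<Rightarrow>\<^sub>0 nat) \<Rightarrow> 'k::field mpoly"
  assumes "finite M" "\<And>m m'. m \<in> M \<Longrightarrow> m' \<in> M \<Longrightarrow> mcoeff (g m) m' = (if m = m' then 1 else 0)"
    and "g ` M \<subseteq> V" and "\<And>f. f \<in> V \<Longrightarrow> f = (\<Sum>m\<in>M. mpoly_scale (mcoeff f m) (g m))"
  shows "mpoly_dim V = card M"
proof (rule mpoly.dim_unique[of "g ` M"])
  have inj: "inj_on g M" by (rule inj_onI) (metis assms(2) zero_neq_one)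
  then show "card (g ` M) = card M" by (rule card_image)
  show "V \<subseteq> mpoly.span (g ` M)"
  proof
    fix f assume "f \<in> V"
    have "(\<Sum>m\<in>M. mpoly_scale (mcoeff f m) (g m)) \<in> mpoly.span (g ` M)"
      by (intro mpoly.span_sum mpoly.span_scale mpoly.span_base) auto
    then show "f \<in> mpoly.span (g ` M)" using assms(4)[OF \<open>f \<in> V\<close>] by simp
  qed
  show "mpoly.independent (g ` M)"
  proof (rule mpoly.independent_if_scalars_zero)
    fix c x assume 0: "(\<Sum>x\<in>g ` M. mpoly_scale (c x) x) = 0" and "x \<in> g ` M"
    then obtain m where m: "m \<in> M" "x = g m" by blast
    have "0 = mcoeff (\<Sum>x\<in>g ` M. mpoly_scale (c x) x) m" by (simp add: 0)
    also have "\<dots> = (\<Sum>n\<in>M. c (g n) * (if n = m then 1 else 0))"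
      by (simp add: sum.reindex[OF inj] lookup_sum lookup_scale assms(2) m(1))
    also have "\<dots> = c x" using m assms(1) by (simp add: if_distrib sum.delta cong: if_cong)
    finally show "c x = 0" by simp
  qed (use assms(1) in simp)
qed (use assms in auto)

lemma dim_forms: "mpoly_dim (forms N D :: 'k::field mpoly set) = card (mons N D)"
proof (rule triangular_basis[of _ "\<lambda>m. Poly_Mapping.single m 1"])
  fix f :: "'k mpoly" assume f: "f \<in> forms N D"
  show "f = (\<Sum>m\<in>mons N D. mpoly_scale (mcoeff f m) (Poly_Mapping.single m 1))"
  proof (rule poly_mapping_eqI)
    fix n
    have "mcoeff f n = 0" if "n \<notin> mons N D"
      using f that by (auto simp: forms_iff in_keys_iff)
    then show "mcoeff f n =
        mcoeff (\<Sum>m\<in>mons N D. mpoly_scale (mcoeff f m) (Poly_Mapping.single m 1)) n"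
      by (auto simp: lookup_sum lookup_scale lookup_single when_def if_distrib sum.delta cong: if_cong)
  qed
qed (auto simp: forms_iff lookup_single when_def)

text \<open>Fix a representative \<open>\<rho> m\<close> in each class. The binomials joining
  \<open>m\<close> to \<open>\<rho> m\<close>, for the \<open>m\<close> that are not
  representatives, form a basis; the remaining monomials correspond to the classes.\<close>

lemma dim_toric_forms:
  fixes \<alpha> :: "nat \<Rightarrow> 'k::field"
  assumes R: "subgrp R" and \<alpha>: "\<And>i. i \<le> N \<Longrightarrow> \<alpha> i \<noteq> 0"
  shows "mpoly_dim (toric_forms N R \<alpha> D) = card (mons N D) - ncls N R D"
proof -
  let ?c = "\<lambda>m. cls N R D (expv N m)"
  define \<rho> where "\<rho> m = (SOME m'. m' \<in> mons N D \<and> ?c m' = ?c m)" for m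
  have \<rho>: "\<rho> m \<in> mons N D" "?c (\<rho> m) = ?c m" if "m \<in> mons N D" for m
    using someI[of "\<lambda>m'. m' \<in> mons N D \<and> ?c m' = ?c m" m] that unfolding \<rho>_def by auto
  have \<rho>_cong: "?c m = ?c m' \<Longrightarrow> \<rho> m = \<rho> m'" for m m' by (simp add: \<rho>_def)
  have \<rho>\<rho>: "\<rho> (\<rho> m) = \<rho> m" if "m \<in> mons N D" for m by (rule \<rho>_cong) (rule \<rho>(2)[OF that])
  have c_iff: "?c m = ?c m' \<longleftrightarrow> expv N m - expv N m' \<in> R" if "m \<in> mons N D" "m' \<in> mons N D" for m m'
    by (rule cls_eq_iff[OF R expv_in_pts[OF that(1)] expv_in_pts[OF that(2)]])
  have nz: "monom_eval \<alpha> m \<noteq> 0" if "m \<in> mons N D" for m by (rule monom_eval_nz[OF that \<alpha>])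
  let ?M = "{m \<in> mons N D. \<rho> m \<noteq> m}"
  \<comment> \<open>Chosen so that the two coefficients, weighted by their values at \<alpha>,
    cancel.\<close>
  let ?q = "\<lambda>m. monom_eval \<alpha> m / monom_eval \<alpha> (\<rho> m)"
  let ?g = "\<lambda>m. Poly_Mapping.single m 1 - Poly_Mapping.single (\<rho> m) (?q m)"
  have lg: "mcoeff (?g m) n = (if m = n then 1 else 0) - (if \<rho> m = n then ?q m else 0)" for m n
    by (simp add: lookup_minus lookup_single when_def)
  have "mpoly_dim (toric_forms N R \<alpha> D) = card ?M"
  proof (rule triangular_basis[of _ ?g])
    show "mcoeff (?g m) m' = (if m = m' then 1 else 0)" if "m \<in> ?M" "m' \<in> ?M" for m m'
      using that \<rho>\<rho>[of m] by (auto simp: lg)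
    show "?g ` ?M \<subseteq> toric_forms N R \<alpha> D"
    proof (clarsimp, goal_cases)
      case (1 m)
      have "Poly_Mapping.keys (?g m) \<subseteq> {m, \<rho> m}" by (rule order.trans[OF keys_diff]) auto
      then have forms: "?g m \<in> forms N D" using 1 \<rho>(1)[of m] by (auto simp: forms_iff)
      have "(\<Sum>x\<in>mcls N R D m0. mcoeff (?g m) x * monom_eval \<alpha> x) = 0"
        if m0: "m0 \<in> mons N D" for m0
      proof -
        have eq: "mcls N R D m0 = {x \<in> mons N D. ?c x = ?c m0}"
          using c_iff[OF _ m0] by blast
        have "mcoeff (?g m) x * monom_eval \<alpha> x =
            (if x = m then monom_eval \<alpha> m else 0) - (if x = \<rho> m then monom_eval \<alpha> m else 0)" for x
          using nz[OF \<rho>(1)[OF 1(1)]] by (auto simp: lg)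
        then show ?thesis unfolding eq using 1 \<rho>[of m] by (simp add: sum_subtractf sum.delta)
      qed
      then show ?case using forms by (simp add: toric_forms_def)
    qed
    fix f assume f: "f \<in> toric_forms N R \<alpha> D"
    show "f = (\<Sum>m\<in>?M. mpoly_scale (mcoeff f m) (?g m))"
    proof (rule poly_mapping_eqI)
      fix n
      have "mcoeff (\<Sum>m\<in>?M. mpoly_scale (mcoeff f m) (?g m)) n =
          (\<Sum>m\<in>?M. mcoeff f m * ((if m = n then 1 else 0) - (if \<rho> m = n then ?q m else 0)))"
        by (simp add: lookup_sum lookup_scale lg)
      also have "\<dots> = (\<Sum>m\<in>?M. if m = n then mcoeff f m else 0) -
          (\<Sum>m\<in>?M. if \<rho> m = n then mcoeff f m * ?q m else 0)"
        unfolding sum_subtractf[symmetric] by (rule sum.cong) auto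
      also have "(\<Sum>m\<in>?M. if m = n then mcoeff f m else 0) =
          (if n \<in> ?M then mcoeff f n else 0)" by (simp add: sum.delta)
      finally have rhs: "mcoeff (\<Sum>m\<in>?M. mpoly_scale (mcoeff f m) (?g m)) n =
          (if n \<in> ?M then mcoeff f n else 0) -
          (\<Sum>m\<in>?M. if \<rho> m = n then mcoeff f m * ?q m else 0)" .
      consider "n \<in> ?M" | "n \<notin> mons N D" | "n \<in> mons N D" "\<rho> n = n" by blast
      then show "mcoeff f n = mcoeff (\<Sum>m\<in>?M. mpoly_scale (mcoeff f m) (?g m)) n"
      proof cases
        case 1
        have "(\<Sum>m\<in>?M. if \<rho> m = n then mcoeff f m * ?q m else 0) = 0"
          by (rule sum.neutral) (use 1 \<rho>\<rho> in auto)
        then show ?thesis using 1 unfolding rhs by simp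
      next
        case 2
        have "mcoeff f n = 0" using 2 f by (auto simp: toric_forms_def forms_iff in_keys_iff)
        moreover have "(\<Sum>m\<in>?M. if \<rho> m = n then mcoeff f m * ?q m else 0) = 0"
          by (rule sum.neutral) (use 2 \<rho>(1) in auto)
        ultimately show ?thesis unfolding rhs using 2 by simp
      next
        \<comment> \<open>The coefficient at a representative is determined by the others of its
          class, since the weighted class sum is zero.\<close>
        case 3
        have "(\<Sum>m\<in>?M. if \<rho> m = n then mcoeff f m * ?q m else 0) =
            (\<Sum>m | m \<in> ?M \<and> \<rho> m = n. mcoeff f m * ?q m)"
          by (rule sum.inter_filter[symmetric]) simp
        also have "\<dots> = (\<Sum>m | m \<in> ?M \<and> \<rho> m = n. mcoeff f m * monom_eval \<alpha> m) / monom_eval \<alpha> n"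
          unfolding sum_divide_distrib by (rule sum.cong) auto
        finally have 4: "(\<Sum>m\<in>?M. if \<rho> m = n then mcoeff f m * ?q m else 0) =
           (\<Sum>m | m \<in> ?M \<and> \<rho> m = n. mcoeff f m * monom_eval \<alpha> m) / monom_eval \<alpha> n" .
        have "mcls N R D n = insert n {m. m \<in> ?M \<and> \<rho> m = n}"
        proof (intro set_eqI iffI)
          fix m assume "m \<in> mcls N R D n"
          then have "m \<in> mons N D" "\<rho> m = \<rho> n" using c_iff[OF _ 3(1)] \<rho>_cong by blast+
          then show "m \<in> insert n {m. m \<in> ?M \<and> \<rho> m = n}" using 3 by auto
        next
          fix m assume "m \<in> insert n {m. m \<in> ?M \<and> \<rho> m = n}"
          then have "m \<in> mons N D" "?c m = ?c n" using 3 \<rho>(2)[of m] by auto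
          then show "m \<in> mcls N R D n" using c_iff[OF _ 3(1)] by blast
        qed
        moreover have "(\<Sum>m\<in>mcls N R D n. mcoeff f m * monom_eval \<alpha> m) = 0"
          using f 3(1) by (simp add: toric_forms_def)
        ultimately have "(\<Sum>m\<in>insert n {m. m \<in> ?M \<and> \<rho> m = n}. mcoeff f m * monom_eval \<alpha> m) = 0"
          by simp
        then have "(\<Sum>m | m \<in> ?M \<and> \<rho> m = n. mcoeff f m * monom_eval \<alpha> m) =
            - mcoeff f n * monom_eval \<alpha> n"
          using 3 by (subst (asm) sum.insert) (auto simp: add_eq_0_iff)
        then show ?thesis unfolding rhs 4 using 3 nz[OF 3(1)] by simp
      qed
    qed
  qed simp
  also have "card ?M = card (mons N D) - card {m \<in> mons N D. \<rho> m = m}"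
    by (subst card_Diff_subset[symmetric]) (auto intro!: arg_cong[of _ _ card])
  also have "card {m \<in> mons N D. \<rho> m = m} = ncls N R D"
  proof -
    have "?c ` {m \<in> mons N D. \<rho> m = m} = ?c ` mons N D"
    proof (intro equalityI subsetI)
      fix C assume "C \<in> ?c ` mons N D"
      then obtain m where m: "m \<in> mons N D" "C = ?c m" by blast
      have "\<rho> m \<in> {m \<in> mons N D. \<rho> m = m}" using \<rho>(1)[OF m(1)] \<rho>\<rho>[OF m(1)] by simp
      moreover have "C = ?c (\<rho> m)" unfolding m(2) by (rule \<rho>(2)[OF m(1), symmetric])
      ultimately show "C \<in> ?c ` {m \<in> mons N D. \<rho> m = m}" by (intro image_eqI)
    qed auto
    also have "\<dots> = cls N R D ` pts N D" by (simp add: image_image expv_image[symmetric])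
    finally have "?c ` {m \<in> mons N D. \<rho> m = m} = cls N R D ` pts N D" .
    have "inj_on ?c {m \<in> mons N D. \<rho> m = m}"
    proof (rule inj_onI)
      fix m m' assume m: "m \<in> {m \<in> mons N D. \<rho> m = m}" "m' \<in> {m \<in> mons N D. \<rho> m = m}" "?c m = ?c m'"
      have "\<rho> m = \<rho> m'" by (rule \<rho>_cong[OF m(3)])
      then show "m = m'" using m(1,2) by simp
    qed
    from card_image[OF this] show ?thesis unfolding ncls_def \<open>?c ` {m \<in> mons N D. \<rho> m = m} = cls N R D ` pts N D\<close> by simp
  qed
  finally show ?thesis .
qed

lemma ncls_le_card_mons: "ncls N R D \<le> card (mons N D)"
  unfolding ncls_def card_mons by (rule card_image_le) simp

section \<open>Zero sets and torus points\<close>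

lemma mpoly_eval_one: "mpoly_eval v 1 = 1"
  by (simp add: mpoly_eval_def monom_eval_def)

lemma mpoly_eval_power: "mpoly_eval v (f ^ n) = mpoly_eval v f ^ n"
  by (induction n) (auto simp: mpoly_eval_one mpoly_eval_mult)

lemma mpoly_eval_prod: "mpoly_eval v (\<Prod>i\<in>I. f i) = (\<Prod>i\<in>I. mpoly_eval v (f i))"
  by (induction I rule: infinite_finite_induct) (auto simp: mpoly_eval_one mpoly_eval_mult)

lemma mpoly_eval_mpoly_scale: "mpoly_eval v (mpoly_scale c f) = c * mpoly_eval v f"
  by (simp add: mpoly_scale_def mpoly_eval_mult mpoly_eval_single) (simp add: monom_eval_def)

lemma mpoly_eval_mvar: "mpoly_eval v (mvar i) = v i"
  by (simp add: mvar_def mpoly_eval_single monom_eval_def)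

lemma forms_one: "1 \<in> forms N 0"
  by (auto simp: forms_def mpolys_def monom_degree_def)

lemma forms_power: "f \<in> forms N D \<Longrightarrow> f ^ n \<in> forms N (n * D)"
  by (induction n) (auto simp: forms_one intro: forms_mult)

lemma forms_prod: "(\<And>i. i \<in> I \<Longrightarrow> f i \<in> forms N (d i)) \<Longrightarrow> (\<Prod>i\<in>I. f i) \<in> forms N (\<Sum>i\<in>I. d i)"
  by (induction I rule: infinite_finite_induct) (auto simp: forms_one intro!: forms_mult)

lemma forms_scale: "f \<in> forms N D \<Longrightarrow> mpoly_scale c f \<in> forms N D"
  by (auto simp: forms_iff in_keys_iff lookup_scale subset_iff)

lemma forms_add: "f \<in> forms N D \<Longrightarrow> g \<in> forms N D \<Longrightarrow> f + g \<in> forms N D"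
  using keys_add[of f g] by (auto simp: forms_iff)

lemma forms_sum: "(\<And>i. i \<in> I \<Longrightarrow> f i \<in> forms N D) \<Longrightarrow> (\<Sum>i\<in>I. f i) \<in> forms N D"
proof (induction I rule: infinite_finite_induct)
  case (insert x F)
  then show ?case by (simp add: forms_add)
qed (auto simp: forms_iff)

lemma forms_mvar: "i \<le> N \<Longrightarrow> mvar i \<in> forms N 1"
  by (auto simp: forms_def mpolys_def mvar_def monom_degree_def)

definition vanish :: "'k::field pt set \<Rightarrow> 'k mpoly \<Rightarrow> bool" where
  "vanish S f \<longleftrightarrow> (\<forall>p\<in>S. \<forall>v\<in>p. mpoly_eval v f = 0)"

lemma vanish_iff_zero_set: "S \<subseteq> proj_space N \<Longrightarrow> vanish S f \<longleftrightarrow> S \<subseteq> zero_set N {f}"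
  by (auto simp: vanish_def zero_set_def)

lemma vanish_closure:
  assumes S: "S \<subseteq> proj_space N" and f: "f \<in> forms N D"
  shows "vanish (zariski N closure_of S) f \<longleftrightarrow> vanish S f"
proof
  have sub: "S \<subseteq> zariski N closure_of S" by (rule closure_of_subset) (use S in \<open>simp add: topspace_zariski\<close>)
  show "vanish (zariski N closure_of S) f \<Longrightarrow> vanish S f" using sub by (auto simp: vanish_def)
  assume "vanish S f"
  then have "S \<subseteq> zero_set N {f}" using vanish_iff_zero_set[OF S] by blast
  moreover have "closedin (zariski N) (zero_set N {f})" 
    unfolding closedin_zariski by (intro exI[of _ "{f}"]) (use f in auto)
  ultimately have "zariski N closure_of S \<subseteq> zero_set N {f}" by (rule closure_of_minimal)
  then show "vanish (zariski N closure_of S) f" by (auto simp: vanish_def zero_set_def)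
qed

lemma closure_subset_proj_space: "zariski N closure_of S \<subseteq> proj_space N"
  by (metis closure_of_subset_topspace topspace_zariski)

lemma vrep_nonzero_vecs: "\<alpha> 0 \<noteq> 0 \<Longrightarrow> vrep N \<alpha> z \<in> nonzero_vecs N"
  by (auto simp: nonzero_vecs_def vrep_def intro!: exI[of _ 0])

lemma tpt_proj_space: "\<alpha> 0 \<noteq> 0 \<Longrightarrow> tpt N \<alpha> z \<in> proj_space N"
  unfolding tpt_def proj_space_def by (intro quotientI vrep_nonzero_vecs)

lemma vrep_in_tpt: "\<alpha> 0 \<noteq> 0 \<Longrightarrow> vrep N \<alpha> z \<in> tpt N \<alpha> z"
  unfolding tpt_def using equiv_class_self[OF equiv_proj_rel vrep_nonzero_vecs] by blast

lemma vanish_tpt: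
  assumes "\<alpha> 0 \<noteq> 0" "f \<in> forms N D"
  shows "vanish {tpt N \<alpha> z} f \<longleftrightarrow> mpoly_eval (vrep N \<alpha> z) f = 0"
  using zero_set_homogeneous[OF assms(2) tpt_proj_space[of \<alpha> N z, OF assms(1)] vrep_in_tpt[of \<alpha> N z, OF assms(1)]]
    vrep_in_tpt[of \<alpha> N z, OF assms(1)]
  by (auto simp: vanish_def)

lemma proj_rel_class_scale:
  assumes "v \<in> nonzero_vecs N" "c \<noteq> 0"
  shows "proj_rel N `` {\<lambda>i. c * v i} = proj_rel N `` {v}"
proof (rule equiv_class_eq[OF equiv_proj_rel, symmetric])
  have "(\<lambda>i. c * v i) \<in> nonzero_vecs N" using assms by (auto simp: nonzero_vecs_def)
  then show "(v, \<lambda>i. c * v i) \<in> proj_rel N" using assms by (auto simp: proj_rel_def)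
qed

lemma mem_torus_part_iff:
  "p \<in> torus_part N \<longleftrightarrow> p \<in> proj_space N \<and> (\<exists>v\<in>p. \<forall>i\<le>N. v i \<noteq> 0)"
proof -
  have "mpoly_eval v (\<Prod>i\<le>N. mvar i) = 0 \<longleftrightarrow> (\<exists>i\<le>N. v i = 0)" for v :: "nat \<Rightarrow> 'a"
    by (simp add: mpoly_eval_prod mpoly_eval_mvar) auto
  then show ?thesis by (auto simp: torus_part_def zero_set_def)
qed

lemma tpt_torus_part:
  assumes "\<And>i. i \<le> N \<Longrightarrow> \<alpha> i \<noteq> 0" "\<And>i. i < N \<Longrightarrow> z i \<noteq> 0"
  shows "tpt N \<alpha> z \<in> torus_part N"
  unfolding mem_torus_part_iff
  using tpt_proj_space[of \<alpha> N z] vrep_in_tpt[of \<alpha> N z] assms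
  by (intro conjI bexI[of _ "vrep N \<alpha> z"]) (auto simp: vrep_def split: nat.split)

lemma torus_part_ex_tpt:
  assumes p: "p \<in> torus_part N" and \<alpha>: "\<And>i. i \<le> N \<Longrightarrow> \<alpha> i \<noteq> 0"
  shows "\<exists>z. (\<forall>i<N. z i \<noteq> 0) \<and> p = tpt N \<alpha> z"
proof -
  obtain v where v: "v \<in> p" "\<And>i. i \<le> N \<Longrightarrow> v i \<noteq> 0" and P: "p \<in> proj_space N"
    using p unfolding mem_torus_part_iff by blast
  obtain w where w: "w \<in> nonzero_vecs N" "p = proj_rel N `` {w}"
    using P unfolding proj_space_def by (rule quotientE)
  then have vn: "v \<in> nonzero_vecs N" and pv: "p = proj_rel N `` {v}"
    using v(1) equiv_class_eq[OF equiv_proj_rel, of w v N] by (auto simp: proj_rel_def)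
  \<comment> \<open>Coordinates relative to \<alpha>, rescaled so that the zeroth one becomes
    \<open>\<alpha> 0\<close>.\<close>
  let ?z = "\<lambda>i. (v (Suc i) / \<alpha> (Suc i)) / (v 0 / \<alpha> 0)"
  have "vrep N \<alpha> ?z = (\<lambda>i. (\<alpha> 0 / v 0) * v i)"
  proof
    fix i show "vrep N \<alpha> ?z i = (\<alpha> 0 / v 0) * v i"
      using v(2)[of 0] \<alpha>[of i] vn by (auto simp: vrep_def nonzero_vecs_def split: nat.split)
  qed
  then have "p = tpt N \<alpha> ?z"
    unfolding tpt_def pv using proj_rel_class_scale[OF vn, of "\<alpha> 0 / v 0"] v(2)[of 0] \<alpha>[of 0] by simp
  moreover have "\<forall>i<N. ?z i \<noteq> 0" using v(2) \<alpha> by auto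
  ultimately show ?thesis by (intro exI[of _ ?z] conjI)
qed

section \<open>The monomial map in torus coordinates\<close>

definition exponent_diffs :: "nat \<Rightarrow> (nat \<Rightarrow> nat \<Rightarrow> int) \<Rightarrow> nat \<Rightarrow> vec \<Rightarrow> int" where
  "exponent_diffs N A j v = (\<Sum>i<N. v i * (A (Suc i) j - A 0 j))"

lemma additive_exponent_diffs: "additive (exponent_diffs N A j)"
  by (auto simp: additive_def exponent_diffs_def algebra_simps sum.distrib sum_subtractf)

lemma exponent_diffs_unit: "i < N \<Longrightarrow> exponent_diffs N A j (unit_vec i) = A (Suc i) j - A 0 j"
  by (simp add: exponent_diffs_def unit_vec_def if_distrib[of "\<lambda>c. c * _"] sum.delta cong: if_cong)

lemma monomial_map_eq_tpt:
  assumes "\<alpha> 0 \<noteq> 0" "\<And>j. j < r \<Longrightarrow> s j \<noteq> 0"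
  shows "monomial_map N r A \<alpha> s = tpt N \<alpha> (zpt (exponent_diffs N A) {..<r} s)"
proof -
  \<comment> \<open>Dividing by the character of the zeroth exponent leaves differences of
    exponents; \<open>?c\<close> is that common factor.\<close>
  let ?v = "vrep N \<alpha> (zpt (exponent_diffs N A) {..<r} s)" and ?c = "\<Prod>j<r. s j powi A 0 j"
  have c: "?c \<noteq> 0" using assms(2) by auto
  have "(if i \<le> N then \<alpha> i * (\<Prod>j<r. s j powi A i j) else 0) = ?c * ?v i" for i
  proof (cases i)
    case (Suc l)
    have "(\<Prod>j<r. s j powi A i j) = ?c * zpt (exponent_diffs N A) {..<r} s l" if "l < N"
      unfolding zpt_def prod.distrib[symmetric] Suc
      by (rule prod.cong) (use that assms(2) in \<open>auto simp: exponent_diffs_unit simp flip: power_int_add\<close>)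
    then show ?thesis by (auto simp: vrep_def Suc)
  qed (simp add: vrep_def)
  then show ?thesis
    unfolding monomial_map_def hom_coords_def tpt_def
    using proj_rel_class_scale[OF vrep_nonzero_vecs[of \<alpha>, OF assms(1)] c] by simp
qed

section \<open>Dimension from above\<close>

lemma exists_linear_relation:
  fixes M :: "'c \<Rightarrow> 'q \<Rightarrow> 'k::field"
  assumes "finite Q" "finite C" "card Q < card C"
  shows "\<exists>a. (\<exists>c\<in>C. a c \<noteq> 0) \<and> (\<forall>x\<in>Q. (\<Sum>c\<in>C. a c * M c x) = 0)"
  using assms
proof (induction Q arbitrary: C M rule: finite_induct)
  case empty
  then show ?case by (intro exI[of _ "\<lambda>_. 1"]) (auto simp: card_gt_0_iff)
next
  case (insert x Q)
  show ?case
  proof (cases "\<forall>c\<in>C. M c x = 0")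
    case True
    have "card Q < card C" using insert by simp
    then obtain a where "\<exists>c\<in>C. a c \<noteq> 0" "\<forall>y\<in>Q. (\<Sum>c\<in>C. a c * M c y) = 0"
      using insert.IH[OF insert.prems(1), of M] by blast
    then show ?thesis using True by (intro exI[of _ a]) auto
  next
    case False
    then obtain c0 where c0: "c0 \<in> C" "M c0 x \<noteq> 0" by blast
    \<comment> \<open>Elimination with the pivot \<open>M c0 x\<close>.\<close>
    let ?C = "C - {c0}" and ?M = "\<lambda>c y. M c y - M c x / M c0 x * M c0 y"
    have "card Q < card ?C" using insert c0 by simp
    then obtain a where a: "\<exists>c\<in>?C. a c \<noteq> 0" "\<forall>y\<in>Q. (\<Sum>c\<in>?C. a c * ?M c y) = 0"
      using insert.IH[of ?C ?M] insert.prems by auto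
    let ?b = "a(c0 := - (\<Sum>c\<in>?C. a c * M c x) / M c0 x)"
    have "(\<Sum>c\<in>C. ?b c * M c y) = (\<Sum>c\<in>?C. a c * ?M c y)" for y
    proof -
      have "(\<Sum>c\<in>C. ?b c * M c y) = ?b c0 * M c0 y + (\<Sum>c\<in>?C. ?b c * M c y)"
        using c0 insert.prems by (simp add: sum.remove)
      also have "(\<Sum>c\<in>?C. ?b c * M c y) = (\<Sum>c\<in>?C. a c * M c y)" by (rule sum.cong) auto
      also have "?b c0 * M c0 y = - (\<Sum>c\<in>?C. a c * (M c x / M c0 x * M c0 y))"
        by (simp add: sum_distrib_right sum_divide_distrib mult.assoc)
      finally show ?thesis by (simp add: right_diff_distrib sum_subtractf)
    qed
    moreover have "?M c x = 0" for c using c0 by simp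
    ultimately have "\<forall>y\<in>insert x Q. (\<Sum>c\<in>C. ?b c * M c y) = 0" using a by simp
    moreover have "\<exists>c\<in>C. ?b c \<noteq> 0" using a(1) by auto
    ultimately show ?thesis by blast
  qed
qed

lemma vanish_power: "\<not> vanish S f \<Longrightarrow> \<not> vanish S (f ^ n)"
  by (auto simp: vanish_def mpoly_eval_power)

text \<open>
  A relation between the monomials in \<open>f 0, \<dots>, f (m - 1)\<close> on \<open>Z m\<close> can be divided by a power
  of \<open>f (m - 1)\<close> and restricted to \<open>Z (m - 1)\<close>, where \<open>f (m - 1)\<close> vanishes.
\<close>

lemma chain_monomials_independent:
  fixes f :: "nat \<Rightarrow> 'k::field mpoly" and c :: "'i \<Rightarrow> nat \<Rightarrow> nat"
  assumes prime: "\<And>j D E g h. j \<le> m \<Longrightarrow> g \<in> forms N D \<Longrightarrow> h \<in> forms N E \<Longrightarrow> vanish (Z j) (g * h) \<Longrightarrow>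
      vanish (Z j) g \<or> vanish (Z j) h"
    and mono: "\<And>j. j < m \<Longrightarrow> Z j \<subseteq> Z (Suc j)"
    and f: "\<And>j. j < m \<Longrightarrow> f j \<in> forms N (e j)" "\<And>j. j < m \<Longrightarrow> vanish (Z j) (f j)"
      "\<And>j. j < m \<Longrightarrow> \<not> vanish (Z (Suc j)) (f j)"
    and l: "l \<in> forms N 1" "\<not> vanish (Z 0) l"
    and I: "finite I" "\<And>i i'. i \<in> I \<Longrightarrow> i' \<in> I \<Longrightarrow> (\<And>j. j < m \<Longrightarrow> c i j = c i' j) \<Longrightarrow> i = i'"
    and deg: "\<And>i. i \<in> I \<Longrightarrow> h i + (\<Sum>j<m. c i j * e j) = E"
    and van: "vanish (Z m) (\<Sum>i\<in>I. mpoly_scale (a i) (l ^ h i * (\<Prod>j<m. f j ^ c i j)))"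
    and "i \<in> I"
  shows "a i = 0"
  using assms
proof (induction m arbitrary: I a c h E i)
  case 0
  have "i' = i" if "i' \<in> I" for i' by (rule 0(9)[OF that 0(12)]) simp
  then have "I = {i}" using 0(12) by blast
  then have "vanish (Z 0) (mpoly_scale (a i) (l ^ h i))" using 0(11) by simp
  moreover obtain p v where pv: "p \<in> Z 0" "v \<in> p" "mpoly_eval v l \<noteq> 0" using 0(7) by (auto simp: vanish_def)
  ultimately have "a i * mpoly_eval v l ^ h i = 0"
    by (auto simp: vanish_def mpoly_eval_mpoly_scale mpoly_eval_power)
  then show ?case using pv by simp
next
  case (Suc m)
  note prime = Suc.prems(1) and mono = Suc.prems(2) and f = Suc.prems(3-5) and l = Suc.prems(6,7)
    and finI = Suc.prems(8) and inj = Suc.prems(9) and deg = Suc.prems(10) and van = Suc.prems(11)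
  let ?I = "{i \<in> I. a i \<noteq> 0}"
  let ?t = "\<lambda>i. l ^ h i * (\<Prod>j<m. f j ^ c i j)"
  show ?case
  proof (rule ccontr)
    assume "a i \<noteq> 0"
    then have ne: "?I \<noteq> {}" using Suc.prems(12) by blast
    \<comment> \<open>The largest power of \<open>f m\<close> dividing all terms that really occur.
      It does not vanish identically on \<open>Z (Suc m)\<close>, so it can be cancelled
      there.\<close>
    define t where "t = Min ((\<lambda>i. c i m) ` ?I)"
    have tle: "t \<le> c i m" if "i \<in> ?I" for i unfolding t_def using finI that by (intro Min_le) auto
    have "t \<in> (\<lambda>i. c i m) ` ?I" unfolding t_def using finI ne by (intro Min_in) auto
    then obtain i1 where i1: "i1 \<in> ?I" "c i1 m = t" by blast
    let ?G = "\<Sum>i\<in>?I. mpoly_scale (a i) (?t i * f m ^ (c i m - t))"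
    have "(\<Sum>i\<in>I. mpoly_scale (a i) (l ^ h i * (\<Prod>j<Suc m. f j ^ c i j))) =
        (\<Sum>i\<in>?I. mpoly_scale (a i) (l ^ h i * (\<Prod>j<Suc m. f j ^ c i j)))"
      by (rule sum.mono_neutral_right) (use finI in \<open>auto simp: mpoly_scale_def\<close>)
    also have "\<dots> = (\<Sum>i\<in>?I. f m ^ t * mpoly_scale (a i) (?t i * f m ^ (c i m - t)))"
    proof (rule sum.cong)
      fix i assume "i \<in> ?I"
      then have "f m ^ c i m = f m ^ t * f m ^ (c i m - t)" using tle by (simp flip: power_add)
      then show "mpoly_scale (a i) (l ^ h i * (\<Prod>j<Suc m. f j ^ c i j)) =
          f m ^ t * mpoly_scale (a i) (?t i * f m ^ (c i m - t))"
        by (simp add: mpoly_scale_def mult_ac)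
    qed simp
    finally have eq: "(\<Sum>i\<in>I. mpoly_scale (a i) (l ^ h i * (\<Prod>j<Suc m. f j ^ c i j))) = f m ^ t * ?G"
      by (simp add: sum_distrib_left)
    have G: "?G \<in> forms N (E - t * e m)"
    proof (intro forms_sum forms_scale)
      fix i assume i: "i \<in> ?I"
      have "?t i * f m ^ (c i m - t) \<in> forms N (h i * 1 + (\<Sum>j<m. c i j * e j) + (c i m - t) * e m)"
        by (intro forms_mult forms_power forms_prod l f) auto
      moreover have "h i * 1 + (\<Sum>j<m. c i j * e j) + (c i m - t) * e m = E - t * e m"
      proof -
        have "c i m * e m = (c i m - t) * e m + t * e m" using tle[OF i] by (simp flip: distrib_right)
        moreover have "h i + (\<Sum>j<m. c i j * e j) + c i m * e m = E" using deg[of i] i by simp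
        ultimately show ?thesis by simp
      qed
      ultimately show "?t i * f m ^ (c i m - t) \<in> forms N (E - t * e m)" by simp
    qed
    have "f m ^ t \<in> forms N (t * e m)" by (intro forms_power f) simp
    moreover have "\<not> vanish (Z (Suc m)) (f m ^ t)" by (intro vanish_power f) simp
    ultimately have "vanish (Z (Suc m)) ?G" using prime[OF _ _ G] van unfolding eq by blast
    then have GZ: "vanish (Z m) ?G" using mono[of m] by (auto simp: vanish_def)
    let ?J = "{i \<in> ?I. c i m = t}"
    have "vanish (Z m) (\<Sum>i\<in>?J. mpoly_scale (a i) (?t i))"
      unfolding vanish_def
    proof (intro ballI)
      fix p v assume pv: "p \<in> Z m" "v \<in> p"
      have fm: "mpoly_eval v (f m) = 0" using f(2)[of m] pv by (auto simp: vanish_def)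
      have "0 = mpoly_eval v ?G" using GZ pv by (auto simp: vanish_def)
      \<comment> \<open>On \<open>Z m\<close> the form \<open>f m\<close> is zero, and only the
        terms with minimal exponent survive because \<open>0 ^ 0 = 1\<close>.\<close>
      also have "\<dots> = (\<Sum>i\<in>?I. a i * (mpoly_eval v (?t i) * 0 ^ (c i m - t)))"
        unfolding mpoly_eval_sum mpoly_eval_mpoly_scale mpoly_eval_mult mpoly_eval_power fm ..
      also have "\<dots> = (\<Sum>i\<in>?J. a i * mpoly_eval v (?t i))"
      proof (rule sum.mono_neutral_cong_right)
        show "\<forall>i\<in>?I - ?J. a i * (mpoly_eval v (?t i) * 0 ^ (c i m - t)) = 0"
        proof
          fix i assume "i \<in> ?I - ?J"
          then have "0 < c i m - t" using tle[of i] by auto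
          then show "a i * (mpoly_eval v (?t i) * 0 ^ (c i m - t)) = 0" by simp
        qed
      qed (use finI in auto)
      also have "\<dots> = mpoly_eval v (\<Sum>i\<in>?J. mpoly_scale (a i) (?t i))"
        unfolding mpoly_eval_sum mpoly_eval_mpoly_scale ..
      finally show "mpoly_eval v (\<Sum>i\<in>?J. mpoly_scale (a i) (?t i)) = 0" by simp
    qed
    then have "a i1 = 0"
    proof (rule Suc.IH[where I = ?J and E = "E - t * e m" and c = c and h = h, rotated -2])
      show "i1 \<in> ?J" using i1 by simp
      show "i = i'" if "i \<in> ?J" "i' \<in> ?J" "\<And>j. j < m \<Longrightarrow> c i j = c i' j" for i i'
        by (rule inj) (use that in \<open>auto simp: less_Suc_eq\<close>)
      show "h i + (\<Sum>j<m. c i j * e j) = E - t * e m" if "i \<in> ?J" for i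
        using deg[of i] that by auto
    qed (use prime mono f l finI in auto)
    then show False using i1 by simp
  qed
qed

lemma irreducible_prime:
  assumes irr: "irreducible_closedin (subtopology (zariski N) S) Z" and S: "S \<subseteq> proj_space N"
    and fg: "f \<in> forms N D" "g \<in> forms N E" and van: "vanish Z (f * g)"
  shows "vanish Z f \<or> vanish Z g"
proof -
  let ?T = "subtopology (zariski N) S"
  have ZS: "Z \<subseteq> S" using irr closedin_subset by (fastforce simp: irreducible_closedin_def)
  have cl: "closedin ?T (Z \<inter> zero_set N {h})" if "h \<in> forms N d" for h d
  proof -
    have "closedin (zariski N) (zero_set N {h})"
      unfolding closedin_zariski by (intro exI[of _ "{h}"]) (use that in auto)
    then have "closedin ?T (S \<inter> zero_set N {h})" by (rule closedin_subtopology_Int_closed)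
    moreover have "Z \<inter> zero_set N {h} = Z \<inter> (S \<inter> zero_set N {h})" using ZS by blast
    ultimately show ?thesis using irr by (metis closedin_Int irreducible_closedin_def)
  qed
  have "zero_set N {f} \<union> zero_set N {g} = zero_set N {f * g}"
    by (subst zero_set_Un) (use fg in auto)
  moreover have "Z \<subseteq> zero_set N {f * g}" using van vanish_iff_zero_set[of Z N] ZS S by blast
  ultimately have "Z = (Z \<inter> zero_set N {f}) \<union> (Z \<inter> zero_set N {g})" by blast
  then have "Z \<inter> zero_set N {f} = Z \<or> Z \<inter> zero_set N {g} = Z"
    using irr cl[OF fg(1)] cl[OF fg(2)] by (simp only: irreducible_closedin_def)
  then show ?thesis using vanish_iff_zero_set[of Z N] ZS S by blast
qed

lemma closed_separate:
  assumes "closedin (subtopology (zariski N) S) Z" "S \<subseteq> proj_space N" "Z' \<subseteq> S" "\<not> Z' \<subseteq> Z"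
  shows "\<exists>D. \<exists>f\<in>forms N D. vanish Z f \<and> \<not> vanish Z' f"
proof -
  obtain F where F: "F \<subseteq> (\<Union>D. forms N D)" "Z = S \<inter> zero_set N F"
    using assms(1) unfolding closedin_subtopology closedin_zariski by blast
  obtain p where p: "p \<in> Z'" "p \<notin> Z" using assms(4) by blast
  then have "p \<in> proj_space N" "p \<notin> zero_set N F" using F assms by auto
  then obtain f v where f: "f \<in> F" "v \<in> p" "mpoly_eval v f \<noteq> 0" by (auto simp: zero_set_def)
  have "\<not> vanish Z' f" using f p by (auto simp: vanish_def)
  moreover have "vanish Z f" using F(2) f(1) by (auto simp: vanish_def zero_set_def)
  moreover obtain D where "f \<in> forms N D" using F f by blast
  ultimately show ?thesis by blast
qed

text \<open>Modulo \<open>toric_forms\<close> a form is determined by its weighted class sums, one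
  for each class, so more forms than classes are linearly dependent.\<close>

lemma dependent_forms:
  fixes \<alpha> :: "nat \<Rightarrow> 'k::field" and g :: "'i \<Rightarrow> 'k mpoly"
  assumes R: "subgrp R" and van: "\<And>f. f \<in> toric_forms N R \<alpha> D \<Longrightarrow> vanish S f"
    and I: "finite I" "ncls N R D < card I" and g: "\<And>i. i \<in> I \<Longrightarrow> g i \<in> forms N D"
  shows "\<exists>a. (\<exists>i\<in>I. a i \<noteq> 0) \<and> vanish S (\<Sum>i\<in>I. mpoly_scale (a i) (g i))"
proof -
  let ?Q = "cls N R D ` pts N D"
  let ?M = "\<lambda>i C. \<Sum>m | m \<in> mons N D \<and> cls N R D (expv N m) = C. mcoeff (g i) m * monom_eval \<alpha> m"
  obtain a where a: "\<exists>i\<in>I. a i \<noteq> 0" "\<And>C. C \<in> ?Q \<Longrightarrow> (\<Sum>i\<in>I. a i * ?M i C) = 0"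
    using exists_linear_relation[of ?Q I ?M] I by (auto simp: ncls_def)
  let ?f = "\<Sum>i\<in>I. mpoly_scale (a i) (g i)"
  have "?f \<in> toric_forms N R \<alpha> D"
    unfolding toric_forms_def
  proof (intro CollectI conjI ballI)
    show "?f \<in> forms N D" by (intro forms_sum forms_scale g)
    fix m0 assume m0: "m0 \<in> mons N D"
    have eq: "mcls N R D m0 =
        {m. m \<in> mons N D \<and> cls N R D (expv N m) = cls N R D (expv N m0)}"
      using cls_eq_iff[OF R expv_in_pts expv_in_pts[OF m0]] by blast
    have "(\<Sum>m\<in>mcls N R D m0. mcoeff ?f m * monom_eval \<alpha> m) =
        (\<Sum>i\<in>I. a i * ?M i (cls N R D (expv N m0)))"
      unfolding eq by (simp add: lookup_sum lookup_scale sum_distrib_left sum_distrib_right mult.assoc sum.swap[of _ I])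
    also have "\<dots> = 0" by (rule a(2)) (use expv_in_pts[OF m0] in blast)
    finally show "(\<Sum>m\<in>mcls N R D m0. mcoeff ?f m * monom_eval \<alpha> m) = 0" .
  qed
  then show ?thesis using a van by blast
qed

text \<open>A chain of length \<open>m\<close> yields \<open>m\<close> forms whose monomials are
  independent on its top member. Exponents up to \<open>B\<close> give \<open>(B + 1) ^ m\<close>
  forms of one degree linear in \<open>B\<close>, hence at least as many classes, and comparing
  growth gives \<open>m \<le> d\<close>.\<close>

lemma proj_dim_le:
  fixes \<alpha> :: "nat \<Rightarrow> 'k::field" and p :: "real poly"
  assumes R: "subgrp R" and S: "S \<subseteq> proj_space N"
    and van: "\<And>D f. f \<in> toric_forms N R \<alpha> D \<Longrightarrow> vanish S f"
    and p: "\<forall>\<^sub>F D in sequentially. real (ncls N R D) = poly p (real D)" "degree p \<le> d"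
  shows "proj_dim N S \<le> ereal (real d)"
  unfolding proj_dim_def krull_dim_def
proof (rule Sup_least)
  fix x assume "x \<in> {ereal (real k) | k. \<exists>Z :: nat \<Rightarrow> 'k pt set.
      (\<forall>i\<le>k. irreducible_closedin (subtopology (zariski N) S) (Z i)) \<and> (\<forall>i<k. Z i \<subset> Z (Suc i))}"
  then obtain m Z where x: "x = ereal (real m)" and
    irr: "\<And>i. i \<le> m \<Longrightarrow> irreducible_closedin (subtopology (zariski N) S) (Z i)" and
    strict: "\<And>i. i < m \<Longrightarrow> Z i \<subset> Z (Suc i)" by blast
  have ZS: "Z i \<subseteq> S" if "i \<le> m" for i
    using irr[OF that] closedin_subset by (fastforce simp: irreducible_closedin_def)
  have "\<forall>j. \<exists>e f. j < m \<longrightarrow> f \<in> forms N e \<and> vanish (Z j) f \<and> \<not> vanish (Z (Suc j)) f"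
    using closed_separate[OF _ S] irr ZS strict
    by (metis Suc_leI irreducible_closedin_def less_imp_le_nat psubset_eq subset_antisym)
  then obtain e f where f: "\<And>j. j < m \<Longrightarrow> f j \<in> forms N (e j)" "\<And>j. j < m \<Longrightarrow> vanish (Z j) (f j)"
      "\<And>j. j < m \<Longrightarrow> \<not> vanish (Z (Suc j)) (f j)" by metis
  obtain q where q: "q \<in> Z 0" using irr[of 0] by (auto simp: irreducible_closedin_def)
  then have "q \<in> proj_space N" using ZS[of 0] S by blast
  then obtain w where w: "w \<in> nonzero_vecs N" "q = proj_rel N `` {w}" unfolding proj_space_def by (rule quotientE)
  \<comment> \<open>A coordinate not vanishing at a point of the smallest member serves to equalise
    the degrees of the monomials.\<close>
  then obtain i0 where i0: "w i0 \<noteq> 0" "i0 \<le> N" "w \<in> q"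
    using equiv_class_self[OF equiv_proj_rel w(1)] by (auto simp: nonzero_vecs_def) (meson not_le)
  have l: "mvar i0 \<in> forms N 1" "\<not> vanish (Z 0) (mvar i0 :: 'k mpoly)"
    using forms_mvar i0 q by (auto simp: vanish_def mpoly_eval_mvar)
  \<comment> \<open>Degree \<open>B * ?e\<close> accommodates all exponents up to \<open>B\<close>;
    the summand 1 keeps it at least \<open>B\<close>, so the polynomial formula applies for large
    \<open>B\<close>.\<close>
  let ?e = "(\<Sum>j<m. e j) + 1"
  have count: "(B + 1) ^ m \<le> ncls N R (B * ?e)" for B
  proof (rule ccontr)
    assume less: "\<not> ?thesis"
    let ?I = "PiE {..<m} (\<lambda>_. {..B})"
    have cardI: "card ?I = (B + 1) ^ m" by (simp add: card_PiE)
    let ?h = "\<lambda>c. B * ?e - (\<Sum>j<m. c j * e j)"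
    have deg: "?h c + (\<Sum>j<m. c j * e j) = B * ?e" if "c \<in> ?I" for c
    proof -
      have "(\<Sum>j<m. c j * e j) \<le> (\<Sum>j<m. B * e j)"
        by (intro sum_mono mult_right_mono) (use that in \<open>auto simp: PiE_def Pi_def\<close>)
      then show ?thesis by (simp add: sum_distrib_left)
    qed
    let ?g = "\<lambda>c. mvar i0 ^ ?h c * (\<Prod>j<m. f j ^ c j)"
    have g: "?g c \<in> forms N (B * ?e)" if "c \<in> ?I" for c
    proof -
      have "?g c \<in> forms N (?h c * 1 + (\<Sum>j<m. c j * e j))"
        by (intro forms_mult forms_power forms_prod l f) auto
      then show ?thesis using deg[OF that] by simp
    qed
    have fin: "finite ?I" by (intro finite_PiE) auto
    have "\<exists>a. (\<exists>c\<in>?I. a c \<noteq> 0) \<and> vanish S (\<Sum>c\<in>?I. mpoly_scale (a c) (?g c))"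
    proof (rule dependent_forms[where \<alpha> = \<alpha>, OF R])
      show "vanish S f" if "f \<in> toric_forms N R \<alpha> (B * ?e)" for f by (rule van[OF that])
      show "ncls N R (B * ?e) < card ?I" using less cardI by simp
    qed (rule fin, rule g)
    then obtain a where a: "\<exists>c\<in>?I. a c \<noteq> 0" "vanish S (\<Sum>c\<in>?I. mpoly_scale (a c) (?g c))"
      by (elim exE conjE) (rule that)
    have "vanish (Z m) (\<Sum>c\<in>?I. mpoly_scale (a c) (?g c))"
      using a(2) ZS[of m] by (auto simp: vanish_def)
    then have "a c = 0" if "c \<in> ?I" for c
    proof (rule chain_monomials_independent[where c = "\<lambda>c. c" and Z = Z and e = e and N = N, rotated -2])
      show "c \<in> ?I" by (rule that)
      show "vanish (Z j) g \<or> vanish (Z j) h" if "j \<le> m" "g \<in> forms N D" "h \<in> forms N E" "vanish (Z j) (g * h)"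
        for j D E g h using irreducible_prime[OF irr[OF that(1)] S that(2-4)] .
      show "c = c'" if "c \<in> ?I" "c' \<in> ?I" "\<And>j. j < m \<Longrightarrow> c j = c' j" for c c'
        using that by (intro PiE_ext) auto
    qed (use strict f l fin deg in auto)
    then show False using a(1) by blast
  qed
  let ?P = "[:1, 1:] ^ m :: real poly" and ?Q = "pcompose p [:0, real ?e:]"
  obtain n0 where n0: "\<And>D. D \<ge> n0 \<Longrightarrow> real (ncls N R D) = poly p (real D)"
    using p(1) by (auto simp: eventually_sequentially)
  have "degree ?P \<le> d"
  proof (rule degree_le_if_eventually_le)
    show "degree ?Q \<le> d" by (rule pcompose_linear_coeff(1)[OF p(2)])
    show "\<forall>\<^sub>F D in sequentially. 0 \<le> poly ?P (real D)" by simp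
    show "\<forall>\<^sub>F D in sequentially. poly ?P (real D) \<le> poly ?Q (real D)"
      unfolding eventually_sequentially
    proof (intro exI allI impI)
      fix B assume "n0 \<le> B"
      then have "n0 \<le> B * ?e" by (simp add: trans_le_add2)
      then have "real (ncls N R (B * ?e)) = poly p (real (B * ?e))" by (rule n0)
      moreover have "real ((B + 1) ^ m) \<le> real (ncls N R (B * ?e))"
        unfolding of_nat_le_iff by (rule count)
      moreover have "poly ?P (real B) = real ((B + 1) ^ m)" by (simp add: add.commute)
      moreover have "poly ?Q (real B) = poly p (real (B * ?e))" by (simp add: poly_pcompose algebra_simps)
      ultimately show "poly ?P (real B) \<le> poly ?Q (real B)" by linarith
    qed
  qed
  then show "x \<le> ereal (real d)" using x by (simp add: degree_linear_power)
qed

section \<open>Dimension from below\<close>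

text \<open>A common power of the coordinates clears the negative exponents, so a Laurent polynomial
  restricted to a line becomes a polynomial in one variable.\<close>

lemma laurent_on_line:
  fixes s s' :: "nat \<Rightarrow> 'k::field" and b :: "'m \<Rightarrow> nat \<Rightarrow> int"
  assumes "finite M" "finite J"
  shows "\<exists>P K. \<forall>t. (\<forall>l\<in>J. s l + t * (s' l - s l) \<noteq> 0) \<longrightarrow>
     poly P t = (\<Prod>l\<in>J. s l + t * (s' l - s l)) ^ K *
       (\<Sum>m\<in>M. c m * (\<Prod>l\<in>J. (s l + t * (s' l - s l)) powi b m l))"
proof -
  define K where "K = Max (insert 0 ((\<lambda>(m, l). nat (- b m l)) ` (M \<times> J)))"
  have K: "0 \<le> b m l + int K" if "m \<in> M" "l \<in> J" for m l
  proof -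
    have "nat (- b m l) \<le> K" unfolding K_def using assms that by (intro Max_ge) auto
    then show ?thesis by linarith
  qed
  let ?P = "\<Sum>m\<in>M. smult (c m) (\<Prod>l\<in>J. [:s l, s' l - s l:] ^ nat (b m l + int K))"
  have "poly ?P t = (\<Prod>l\<in>J. s l + t * (s' l - s l)) ^ K *
       (\<Sum>m\<in>M. c m * (\<Prod>l\<in>J. (s l + t * (s' l - s l)) powi b m l))"
    if nz: "\<forall>l\<in>J. s l + t * (s' l - s l) \<noteq> 0" for t
  proof -
    let ?x = "\<lambda>l. s l + t * (s' l - s l)"
    have "?x l ^ nat (b m l + int K) = ?x l ^ K * ?x l powi b m l" if "m \<in> M" "l \<in> J" for m l
    proof -
      have "?x l ^ nat (b m l + int K) = ?x l powi (b m l + int K)"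
        using K[OF that] by (simp add: power_int_def)
      also have "\<dots> = ?x l powi b m l * ?x l ^ K" using nz that by (simp add: power_int_add)
      finally show ?thesis by (simp add: mult.commute)
    qed
    then have "poly ?P t = (\<Sum>m\<in>M. c m * (\<Prod>l\<in>J. ?x l ^ K * ?x l powi b m l))"
      by (simp add: poly_sum poly_prod)
    then show ?thesis by (simp add: prod.distrib prod_power_distrib sum_distrib_left mult_ac)
  qed
  then show ?thesis by blast
qed

text \<open>On the line joining \<open>s\<close> to \<open>s'\<close>, \<open>f\<close> is nonzero
  at 0, \<open>g\<close> at 1, and each coordinate in \<open>J\<close> at both. The product of the
  corresponding polynomials is nonzero and has a nonroot, the field being infinite.\<close>

lemma torus_domain:
  fixes \<alpha> :: "nat \<Rightarrow> 'k::alg_closed_field"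
  assumes J: "finite J" and B: "\<And>l. additive (B l)"
    and fg: "f \<in> forms N D" "g \<in> forms N E"
    and s: "\<And>l. s l \<noteq> 0" "mpoly_eval (vrep N \<alpha> (zpt B J s)) f \<noteq> 0"
    and s': "\<And>l. s' l \<noteq> 0" "mpoly_eval (vrep N \<alpha> (zpt B J s')) g \<noteq> 0"
  shows "\<exists>t. (\<forall>l. t l \<noteq> 0) \<and> mpoly_eval (vrep N \<alpha> (zpt B J t)) f \<noteq> 0 \<and> mpoly_eval (vrep N \<alpha> (zpt B J t)) g \<noteq> 0"
proof -
  let ?x = "\<lambda>t l. s l + t * (s' l - s l)"
  \<comment> \<open>Outside \<open>J\<close> the line may pass through zero; those parameters do not
    affect the point and are set to 1.\<close>
  let ?y = "\<lambda>t l. if l \<in> J then ?x t l else 1"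
  have ev: "mpoly_eval (vrep N \<alpha> (zpt B J r)) h =
      (\<Sum>m\<in>mons N d. (mcoeff h m * monom_eval \<alpha> m) * (\<Prod>l\<in>J. r l powi B l (expv N m)))"
    if "h \<in> forms N d" "\<And>l. l \<in> J \<Longrightarrow> r l \<noteq> 0" for h d r
    unfolding mpoly_eval_forms[OF that(1)]
    by (rule sum.cong) (auto simp: monom_eval_vrep chr_zpt[OF J B that(2) pts_vecs[OF expv_in_pts]])
  have line: "\<exists>P K. \<forall>t. (\<forall>l\<in>J. ?x t l \<noteq> 0) \<longrightarrow> poly P t = (\<Prod>l\<in>J. ?x t l) ^ K * mpoly_eval (vrep N \<alpha> (zpt B J (?x t))) h"
    if h: "h \<in> forms N d" for h d
  proof -
    obtain P K where "\<forall>t. (\<forall>l\<in>J. ?x t l \<noteq> 0) \<longrightarrow> poly P t = (\<Prod>l\<in>J. ?x t l) ^ K *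
       (\<Sum>m\<in>mons N d. (mcoeff h m * monom_eval \<alpha> m) * (\<Prod>l\<in>J. ?x t l powi B l (expv N m)))"
      using laurent_on_line[where M = "mons N d" and J = J and s = s and s' = s' and
          c = "\<lambda>m. mcoeff h m * monom_eval \<alpha> m" and b = "\<lambda>m l. B l (expv N m)", OF finite_mons J]
      by (elim exE) (rule that)
    then show ?thesis using ev[OF h] by (intro exI[of _ P] exI[of _ K]) auto
  qed
  obtain P K where P: "\<And>t. (\<forall>l\<in>J. ?x t l \<noteq> 0) \<Longrightarrow> poly P t = (\<Prod>l\<in>J. ?x t l) ^ K * mpoly_eval (vrep N \<alpha> (zpt B J (?x t))) f"
    using line[OF fg(1)] by blast
  obtain Q L where Q: "\<And>t. (\<forall>l\<in>J. ?x t l \<noteq> 0) \<Longrightarrow> poly Q t = (\<Prod>l\<in>J. ?x t l) ^ L * mpoly_eval (vrep N \<alpha> (zpt B J (?x t))) g"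
    using line[OF fg(2)] by blast
  let ?V = "\<Prod>l\<in>J. [:s l, s' l - s l:]"
  have "?x 0 = s" "?x 1 = s'" by auto
  then have "poly P 0 \<noteq> 0" "poly Q 1 \<noteq> 0" "poly ?V 0 \<noteq> 0"
    using P[of 0] Q[of 1] s s' J by (auto simp: poly_prod)
  then have "P \<noteq> 0" "Q \<noteq> 0" "?V \<noteq> 0" by auto
  then have "P * Q * ?V \<noteq> 0" by simp
  then obtain t where t: "poly (P * Q * ?V) t \<noteq> 0" using exists_nonroot by blast
  then have xt: "\<forall>l\<in>J. ?x t l \<noteq> 0" using J by (auto simp: poly_prod)
  have "zpt B J (?y t) = zpt B J (?x t)" by (auto simp: zpt_def)
  moreover have "\<forall>l. ?y t l \<noteq> 0" using xt by auto
  moreover have "mpoly_eval (vrep N \<alpha> (zpt B J (?x t))) f \<noteq> 0" "mpoly_eval (vrep N \<alpha> (zpt B J (?x t))) g \<noteq> 0"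
    using t P[OF xt] Q[OF xt] by auto
  ultimately show ?thesis by (intro exI[of _ "?y t"]) simp
qed

section \<open>Closures of subtorus orbits\<close>

definition orbit :: "nat \<Rightarrow> (nat \<Rightarrow> 'k::field) \<Rightarrow> (nat \<Rightarrow> vec \<Rightarrow> int) \<Rightarrow> nat set \<Rightarrow> 'k pt set" where
  "orbit N \<alpha> B J = {tpt N \<alpha> (zpt B J s) | s. \<forall>l. s l \<noteq> 0}"

lemma vanish_orbit:
  assumes "\<alpha> 0 \<noteq> 0" "f \<in> forms N D"
  shows "vanish (orbit N \<alpha> B J) f \<longleftrightarrow> (\<forall>s. (\<forall>l. s l \<noteq> 0) \<longrightarrow> mpoly_eval (vrep N \<alpha> (zpt B J s)) f = 0)"
proof -
  have "vanish (orbit N \<alpha> B J) f \<longleftrightarrow> (\<forall>s. (\<forall>l. s l \<noteq> 0) \<longrightarrow> vanish {tpt N \<alpha> (zpt B J s)} f)"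
    by (auto simp: vanish_def orbit_def)
  then show ?thesis unfolding vanish_tpt[of \<alpha>, OF assms] .
qed

text \<open>Two proper closed pieces would yield forms vanishing on them but not on the orbit;
  \<open>torus_domain\<close> finds a point of the orbit where neither form vanishes.\<close>

lemma irreducible_closure_orbit:
  fixes \<alpha> :: "nat \<Rightarrow> 'k::alg_closed_field"
  assumes J: "finite J" and B: "\<And>l. additive (B l)" and \<alpha>: "\<alpha> 0 \<noteq> 0"
    and S: "S \<subseteq> proj_space N" and Y: "orbit N \<alpha> B J \<subseteq> S"
  shows "irreducible_closedin (subtopology (zariski N) S) (S \<inter> zariski N closure_of orbit N \<alpha> B J)"
    (is "irreducible_closedin ?T ?Z")
proof -
  let ?Y = "orbit N \<alpha> B J"
  have YP: "?Y \<subseteq> proj_space N" using Y S by blast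
  have YZ: "?Y \<subseteq> ?Z" using Y closure_of_subset[of ?Y "zariski N"] YP by (auto simp: topspace_zariski)
  have ne: "?Y \<noteq> {}" by (auto simp: orbit_def intro!: exI[of _ "\<lambda>_. 1"])
  have sep: "\<exists>D. \<exists>f\<in>forms N D. vanish A f \<and> \<not> vanish ?Y f" if A: "closedin ?T A" "A \<subseteq> ?Z" "A \<noteq> ?Z" for A
  proof -
    obtain D f where f: "f \<in> forms N D" "vanish A f" "\<not> vanish ?Z f"
      using closed_separate[OF A(1) S, of ?Z] A by blast
    have "\<not> vanish ?Y f" using vanish_closure[OF YP f(1)] f(3) by (auto simp: vanish_def)
    then show ?thesis using f by blast
  qed
  show ?thesis
    unfolding irreducible_closedin_def
  proof (intro conjI allI impI)
    show "closedin ?T ?Z" by (rule closedin_subtopology_Int_closed) simp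
    show "?Z \<noteq> {}" using YZ ne by blast
    fix A C assume AC: "closedin ?T A" "closedin ?T C" "?Z = A \<union> C"
    show "A = ?Z \<or> C = ?Z"
    proof (rule ccontr)
      assume *: "\<not> ?thesis"
      obtain D f where f: "f \<in> forms N D" "vanish A f" "\<not> vanish ?Y f" using sep[of A] AC * by blast
      obtain E g where g: "g \<in> forms N E" "vanish C g" "\<not> vanish ?Y g" using sep[of C] AC * by blast
      obtain s s' where s: "\<And>l. s l \<noteq> 0" "mpoly_eval (vrep N \<alpha> (zpt B J s)) f \<noteq> 0"
        and s': "\<And>l. s' l \<noteq> 0" "mpoly_eval (vrep N \<alpha> (zpt B J s')) g \<noteq> 0"
        using f(3) g(3) unfolding vanish_orbit[of \<alpha>, OF \<alpha> f(1)] vanish_orbit[of \<alpha>, OF \<alpha> g(1)] by blast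
      obtain t where t: "\<forall>l. t l \<noteq> 0" "mpoly_eval (vrep N \<alpha> (zpt B J t)) f \<noteq> 0"
        "mpoly_eval (vrep N \<alpha> (zpt B J t)) g \<noteq> 0"
        using torus_domain[OF J B f(1) g(1) s s'] by blast
      let ?p = "tpt N \<alpha> (zpt B J t)"
      have "?p \<in> ?Y" using t by (auto simp: orbit_def)
      then have "?p \<in> A \<or> ?p \<in> C" using YZ AC by blast
      then show False
        using f(2) g(2) t(2,3) vrep_in_tpt[of \<alpha>, OF \<alpha>] by (auto simp: vanish_def)
    qed
  qed
qed

text \<open>Adjoining the cocharacters \<open>\<Phi> (N - 1)\<close>, ..., \<open>\<Phi> j\<close>
  one at a time to the trivial torus gives a chain of \<open>N - j + 1\<close> irreducible closed
  sets.\<close>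

lemma proj_dim_ge:
  fixes \<alpha> :: "nat \<Rightarrow> 'k::alg_closed_field"
  assumes c: "coords N \<Phi>" and j: "j \<le> N" and \<alpha>: "\<And>i. i \<le> N \<Longrightarrow> \<alpha> i \<noteq> 0"
    and S: "S \<subseteq> proj_space N" and Y: "orbit N \<alpha> \<Phi> {j..<N} \<subseteq> S"
  shows "ereal (real (N - j)) \<le> proj_dim N S"
proof -
  note add = coordsD(1)[OF c]
  let ?J = "\<lambda>i. {N - i..<N}"
  let ?Y = "\<lambda>i. orbit N \<alpha> \<Phi> (?J i)"
  let ?Z = "\<lambda>i. S \<inter> zariski N closure_of ?Y i"
  have mono: "?Y i \<subseteq> ?Y i'" if "i \<le> i'" for i i'
  proof
    fix p assume "p \<in> ?Y i"
    then obtain s where s: "p = tpt N \<alpha> (zpt \<Phi> (?J i) s)" "\<forall>l. s l \<noteq> 0" by (auto simp: orbit_def)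
    let ?s = "\<lambda>l. if l \<in> ?J i then s l else 1"
    have "zpt \<Phi> (?J i) s = zpt \<Phi> (?J i') ?s"
    proof
      fix x
      have "zpt \<Phi> (?J i) s x = (\<Prod>l\<in>?J i. ?s l powi \<Phi> l (unit_vec x))"
        unfolding zpt_def by (rule prod.cong) auto
      also have "\<dots> = zpt \<Phi> (?J i') ?s x"
        unfolding zpt_def by (rule prod.mono_neutral_left) (use that in auto)
      finally show "zpt \<Phi> (?J i) s x = zpt \<Phi> (?J i') ?s x" .
    qed
    then show "p \<in> ?Y i'" using s unfolding orbit_def by (intro CollectI exI[of _ ?s]) auto
  qed
  have YS: "?Y i \<subseteq> S" if "i \<le> N - j" for i
    using mono[OF that] Y j by simp
  have YZ: "?Y i \<subseteq> ?Z i" if "i \<le> N - j" for i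
    using YS[OF that] S closure_of_subset[of "?Y i" "zariski N"] by (auto simp: topspace_zariski)
  have "?Z i \<subset> ?Z (Suc i)" if i: "i < N - j" for i
  proof -
    let ?l = "N - Suc i"
    have l: "?l < N" "?J (Suc i) = insert ?l (?J i)" "?l \<notin> ?J i" using i by auto
    \<comment> \<open>The dual basis vector: its character is trivial on the smaller torus and
      equals the new parameter on the larger one, so its binomial separates them.\<close>
    obtain u where u: "u \<in> vecs N" "\<forall>l'<N. \<Phi> l' u = (if l' = ?l then 1 else 0)"
      using coordsD(2)[OF c, of "\<lambda>l'. if l' = ?l then 1 else 0"] by blast
    have "u \<in> flag N \<Phi> (N - i)" using u i by (auto simp: flag_def)
    then obtain f where f: "f \<in> toric_forms N (flag N \<Phi> (N - i)) \<alpha> (nrm N u)"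
      "\<And>z. \<forall>i<N. z i \<noteq> 0 \<Longrightarrow> mpoly_eval (vrep N \<alpha> z) f = 0 \<longleftrightarrow> chr N z u = 1"
      using toric_binomial[OF subgrp_flag[OF c], of N \<alpha> u "N - i" "nrm N u"] \<alpha> u(1) by blast
    have ff: "f \<in> forms N (nrm N u)" using f(1) by (simp add: toric_forms_def)
    have "chr N (zpt \<Phi> (?J i) s) u = 1" if "\<forall>l. s l \<noteq> 0" for s :: "nat \<Rightarrow> 'k"
    proof -
      have "chr N (zpt \<Phi> (?J i) s) u = (\<Prod>l\<in>?J i. s l powi \<Phi> l u)"
        by (rule chr_zpt) (use that add u in auto)
      also have "\<dots> = 1" by (rule prod.neutral) (use u l in auto)
      finally show ?thesis .
    qed
    then have "vanish (?Y i) f"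
      unfolding vanish_orbit[of \<alpha>, OF \<alpha>[of 0, simplified] ff] using f(2) zpt_nz by (metis finite_atLeastLessThan)
    then have vi: "vanish (?Z i) f"
      using vanish_closure[OF _ ff, of "?Y i"] YS[of i] i S by (auto simp: vanish_def)
    obtain x :: 'k where x: "x \<noteq> 0" "x \<noteq> 1" using exists_powi_neq[of 1 0] by auto
    let ?s = "\<lambda>l. if l = ?l then x else 1"
    have "chr N (zpt \<Phi> (?J (Suc i)) ?s) u = (\<Prod>l\<in>?J (Suc i). ?s l powi \<Phi> l u)"
      by (rule chr_zpt) (use x add u in auto)
    also have "\<dots> = x"
    proof -
      have "(\<Prod>l\<in>?J i. ?s l powi \<Phi> l u) = 1" by (rule prod.neutral) (use l in auto)
      then show ?thesis unfolding l(2) using l u by simp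
    qed
    finally have "mpoly_eval (vrep N \<alpha> (zpt \<Phi> (?J (Suc i)) ?s)) f \<noteq> 0"
      using f(2)[of "zpt \<Phi> (?J (Suc i)) ?s"] x zpt_nz[of "?J (Suc i)" ?s \<Phi>] by auto
    then have "\<not> vanish (?Y (Suc i)) f"
      unfolding vanish_orbit[of \<alpha>, OF \<alpha>[of 0, simplified] ff] 
      using x by (auto intro!: exI[of _ ?s] split: if_splits)
    then have "\<not> vanish (?Z (Suc i)) f" using YZ[of "Suc i"] i by (auto simp: vanish_def)
    moreover have "?Z i \<subseteq> ?Z (Suc i)" using closure_of_mono[OF mono[of i "Suc i"], of "zariski N"] by auto
    ultimately show ?thesis using vi by auto
  qed
  moreover have "irreducible_closedin (subtopology (zariski N) S) (?Z i)" if "i \<le> N - j" for i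
    by (rule irreducible_closure_orbit) (use that add \<alpha> S YS in auto)
  ultimately show ?thesis
    unfolding proj_dim_def krull_dim_def by (intro Sup_upper) (auto intro!: exI[of _ ?Z])
qed

section \<open>Toric varieties\<close>

lemma orbit_eq_image:
  assumes "\<alpha> 0 \<noteq> 0"
  shows "monomial_map N r A \<alpha> ` {s. \<forall>j<r. s j \<noteq> 0} = orbit N \<alpha> (exponent_diffs N A) {..<r}"
proof (intro equalityI subsetI)
  fix p assume "p \<in> monomial_map N r A \<alpha> ` {s. \<forall>j<r. s j \<noteq> 0}"
  then obtain s where s: "\<And>j. j < r \<Longrightarrow> s j \<noteq> 0" "p = monomial_map N r A \<alpha> s" by blast
  let ?s = "\<lambda>l. if l < r then s l else 1"
  have "zpt (exponent_diffs N A) {..<r} s = zpt (exponent_diffs N A) {..<r} ?s"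
    by (auto simp: zpt_def fun_eq_iff)
  then have "p = tpt N \<alpha> (zpt (exponent_diffs N A) {..<r} ?s)"
    using s monomial_map_eq_tpt[of \<alpha> r s N A] assms by simp
  then show "p \<in> orbit N \<alpha> (exponent_diffs N A) {..<r}"
    unfolding orbit_def using s by (intro CollectI exI[of _ ?s]) auto
next
  fix p assume "p \<in> orbit N \<alpha> (exponent_diffs N A) {..<r}"
  then obtain s where s: "\<forall>l. s l \<noteq> 0" "p = tpt N \<alpha> (zpt (exponent_diffs N A) {..<r} s)"
    by (auto simp: orbit_def)
  then have "p = monomial_map N r A \<alpha> s" using monomial_map_eq_tpt[of \<alpha> r s N A] assms by simp
  then show "p \<in> monomial_map N r A \<alpha> ` {s. \<forall>j<r. s j \<noteq> 0}" using s by blast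
qed

lemma eventually_poly_unique:
  fixes p q :: "real poly"
  assumes "\<forall>\<^sub>F D in sequentially. real (h D) = poly p (real D)"
    and "\<forall>\<^sub>F D in sequentially. real (h D) = poly q (real D)"
  shows "p = q"
proof (rule ccontr)
  assume "p \<noteq> q"
  then have fin: "finite {x. poly (p - q) x = 0}" by (intro poly_roots_finite) simp
  have "\<forall>\<^sub>F D in sequentially. poly (p - q) (real D) = 0"
    using assms by eventually_elim simp
  then obtain n0 where "\<And>D. D \<ge> n0 \<Longrightarrow> poly (p - q) (real D) = 0"
    by (auto simp: eventually_sequentially)
  then have "real ` {n0..} \<subseteq> {x. poly (p - q) x = 0}" by auto
  then have "finite (real ` {n0..})" using fin by (rule finite_subset)
  then have "finite {n0..}" by (rule finite_imageD) (simp add: inj_on_def)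
  then show False by (simp add: infinite_Ici)
qed

text \<open>The quotient of the factorials is a product of \<open>k\<close> factors, each at most
  \<open>N\<close>.\<close>

lemma fact_le_power_mult_fact: "k \<le> N \<Longrightarrow> fact N \<le> (N + 1) ^ k * (fact (N - k) :: nat)"
proof (induction k)
  case (Suc k)
  have "fact (N - k) = (N - k) * fact (N - Suc k)"
    using Suc.prems by (simp add: fact_reduce)
  also have "\<dots> \<le> (N + 1) * fact (N - Suc k)" by (intro mult_right_mono) auto
  finally have "(N + 1) ^ k * fact (N - k) \<le> (N + 1) ^ k * ((N + 1) * fact (N - Suc k))"
    by (rule mult_left_mono) simp
  also have "\<dots> = (N + 1) ^ Suc k * fact (N - Suc k)" by (simp only: power_Suc mult_ac)
  finally show ?case using Suc by (meson Suc_leD le_trans)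
qed simp

lemma toric_forms_iff_vanish_orbit:
  fixes \<alpha> :: "nat \<Rightarrow> 'k::alg_closed_field"
  assumes J: "finite J" and B: "\<And>l. additive (B l)" and \<alpha>: "\<alpha> 0 \<noteq> 0" and f: "f \<in> forms N D"
  shows "f \<in> toric_forms N {v \<in> vecs N. \<forall>l\<in>J. B l v = 0} \<alpha> D \<longleftrightarrow> vanish (orbit N \<alpha> B J) f"
    (is "f \<in> toric_forms N ?L \<alpha> D \<longleftrightarrow> _")
proof
  assume "vanish (orbit N \<alpha> B J) f"
  then show "f \<in> toric_forms N ?L \<alpha> D"
    unfolding vanish_orbit[of \<alpha>, OF \<alpha> f] by (intro toric_forms_if_vanish J B f) blast
next
  assume t: "f \<in> toric_forms N ?L \<alpha> D"
  have sg: "subgrp ?L" by (auto simp: subgrp_def vecs_closed additiveD[OF B])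
  have "mpoly_eval (vrep N \<alpha> (zpt B J s)) f = 0" if s: "\<forall>l. s l \<noteq> 0" for s
  proof (rule toric_forms_vanish[OF sg t])
    show "zpt B J s i \<noteq> 0" for i using zpt_nz[OF J] s by blast
    fix v assume v: "v \<in> ?L"
    have "chr N (zpt B J s) v = (\<Prod>l\<in>J. s l powi B l v)" by (rule chr_zpt) (use J B s v in auto)
    also have "\<dots> = 1" by (rule prod.neutral) (use v in auto)
    finally show "chr N (zpt B J s) v = 1" .
  qed
  then show "vanish (orbit N \<alpha> B J) f" unfolding vanish_orbit[of \<alpha>, OF \<alpha> f] by blast
qed

lemma orbit_subset_proj_space: "\<alpha> 0 \<noteq> 0 \<Longrightarrow> orbit N \<alpha> B J \<subseteq> proj_space N"
  using tpt_proj_space[of \<alpha>] by (auto simp: orbit_def)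

text \<open>In degree \<open>nrm N (u i)\<close> the binomials of \<open>u 0, ..., u i\<close> are
  available, which forces codimension \<open>Suc i\<close> in the torus. In smaller degree all
  relevant vectors of \<open>L\<close> lie in the flag at \<open>i\<close>, so a whole subtorus
  orbit of dimension \<open>N - i\<close> remains in the zero set.\<close>

lemma obstruction_index_toric:
  fixes X :: "'k::alg_closed_field pt set"
  assumes \<alpha>: "\<And>i. i \<le> N \<Longrightarrow> \<alpha> i \<noteq> 0"
    and ideal: "\<And>D. hom_ideal_part N X D = toric_forms N L \<alpha> D"
    and m: "minima N L \<Phi> u k" and L: "L = flag N \<Phi> k" and i: "i < k"
  shows "obstruction_index N X (torus_part N) (Suc i) = nrm N (u i)"
proof -
  have c: "coords N \<Phi>" and kN: "k \<le> N" using m by (auto simp: minima_def)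
  have sg: "subgrp L" unfolding L by (rule subgrp_flag[OF c])
  have Lv: "L \<subseteq> vecs N" by (auto simp: L flag_def)
  let ?V = "\<lambda>D. zero_set N (toric_forms N L \<alpha> D) \<inter> torus_part N"
  have VP: "?V D \<subseteq> proj_space N" for D by (auto simp: zero_set_def)
  have upper: "proj_dim N (?V (nrm N (u i))) \<le> ereal (real N - real (Suc i))"
  proof -
    obtain p :: "real poly" where p: "\<forall>\<^sub>F D in sequentially. real (ncls N (zspan u (Suc i)) D) = poly p (real D)"
      "degree p \<le> N - Suc i"
      using ncls_zspan_poly[OF m Lv, of "Suc i"] i by auto
    have "proj_dim N (?V (nrm N (u i))) \<le> ereal (real (N - Suc i))"
    proof (rule proj_dim_le[OF subgrp_zspan VP _ p])
      fix D f assume f: "f \<in> toric_forms N (zspan u (Suc i)) \<alpha> D"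
      have "vanish {x} f" if x: "x \<in> ?V (nrm N (u i))" for x
      proof -
        obtain z where z: "\<And>i. i < N \<Longrightarrow> z i \<noteq> 0" "x = tpt N \<alpha> z"
          using torus_part_ex_tpt[of x N \<alpha>] x \<alpha> by blast
        \<comment> \<open>Only triviality on the span follows; on the flag the character may take
          nontrivial roots of unity as values.\<close>
        have "zspan u (Suc i) \<subseteq> {v. chr N z v = 1}"
        proof (rule zspan_least[OF subgrp_chr_kernel[OF z(1)]])
          fix l assume l: "l < Suc i"
          have ul: "u l \<in> L" using m l i by (auto simp: minima_def)
          have "nrm N (u l) \<le> nrm N (u i)" by (rule minima_mono[OF m]) (use l i in auto)
          then obtain g where g: "g \<in> toric_forms N L \<alpha> (nrm N (u i))"
            "\<And>z. \<forall>i<N. z i \<noteq> 0 \<Longrightarrow> mpoly_eval (vrep N \<alpha> z) g = 0 \<longleftrightarrow> chr N z (u l) = 1"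
            using toric_binomial[OF sg, of N \<alpha> "u l" "nrm N (u i)"] \<alpha> ul Lv by blast
          have "mpoly_eval (vrep N \<alpha> z) g = 0"
            using x g(1) vrep_in_tpt[of \<alpha> N z] \<alpha> z(2) by (auto simp: zero_set_def)
          then show "u l \<in> {v. chr N z v = 1}" using g(2)[of z] z(1) by simp
        qed
        then have "mpoly_eval (vrep N \<alpha> z) f = 0"
          by (intro toric_forms_vanish[OF subgrp_zspan f z(1)]) auto
        then show ?thesis
          unfolding z(2) using vanish_tpt[of \<alpha> f N D z] \<alpha> f by (simp add: toric_forms_def)
      qed
      then show "vanish (?V (nrm N (u i))) f" by (auto simp: vanish_def)
    qed
    then show ?thesis using i kN by (simp add: of_nat_diff)
  qed
  have lower: "nrm N (u i) \<le> D" if D: "proj_dim N (?V D) \<le> ereal (real N - real (Suc i))" for D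
  proof (rule ccontr)
    assume less: "\<not> nrm N (u i) \<le> D"
    have "orbit N \<alpha> \<Phi> {i..<N} \<subseteq> ?V D"
    proof
      fix x assume "x \<in> orbit N \<alpha> \<Phi> {i..<N}"
      then obtain s where s: "\<And>l. s l \<noteq> 0" "x = tpt N \<alpha> (zpt \<Phi> {i..<N} s)" by (auto simp: orbit_def)
      let ?z = "zpt \<Phi> {i..<N} s"
      have nz: "?z l \<noteq> 0" for l by (rule zpt_nz) (use s in auto)
      have xt: "x \<in> torus_part N" unfolding s(2) by (rule tpt_torus_part) (use \<alpha> nz in auto)
      have "vanish {x} f" if f: "f \<in> toric_forms N L \<alpha> D" for f
      proof -
        have "mpoly_eval (vrep N \<alpha> ?z) f = 0"
        proof (rule toric_forms_vanish[OF sg f nz])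
          fix v assume v: "v \<in> L" "v \<in> vecs N" "nrm N v \<le> D"
          then have "v \<in> flag N \<Phi> i" using m i less by (auto simp: minima_def)
          have "chr N ?z v = (\<Prod>l\<in>{i..<N}. s l powi \<Phi> l v)"
            by (rule chr_zpt) (use coordsD(1)[OF c] s v in auto)
          also have "\<dots> = 1" by (rule prod.neutral) (use \<open>v \<in> flag N \<Phi> i\<close> in \<open>auto simp: flag_def\<close>)
          finally show "chr N ?z v = 1" .
        qed
        then show ?thesis
          unfolding s(2) using vanish_tpt[of \<alpha> f N D ?z] \<alpha> f by (simp add: toric_forms_def)
      qed
      then have "x \<in> zero_set N (toric_forms N L \<alpha> D)"
        using xt by (auto simp: zero_set_def vanish_def torus_part_def)
      then show "x \<in> ?V D" using xt by blast
    qed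
    from proj_dim_ge[OF c _ \<alpha> VP this] have "ereal (real (N - i)) \<le> proj_dim N (?V D)"
      using i kN by auto
    then have "ereal (real (N - i)) \<le> ereal (real N - real (Suc i))" using D by (rule order.trans)
    then show False using i kN by (simp add: of_nat_diff)
  qed
  show ?thesis
    unfolding obstruction_index_def ideal by (rule Least_equality) (use upper lower in auto)
qed

theorem proposition0p1:
  fixes N n :: nat and X :: "(nat \<Rightarrow> 'k::alg_closed_field) set set"
  assumes "projective_toric_variety N X"
    and "proj_dim N X = ereal (real n)"
  shows "proj_degree N X \<le> real (\<Prod>i=1..N-n. obstruction_index N X (torus_part N) i) \<and>
         real (\<Prod>i=1..N-n. obstruction_index N X (torus_part N) i)
           \<le> real ((N + 1) ^ (N - n)) * proj_degree N X"
proof -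
  obtain r A \<alpha> where \<alpha>: "\<And>i. i \<le> N \<Longrightarrow> \<alpha> i \<noteq> (0::'k)" and X: "X = toric_variety_of N r A \<alpha>"
    using assms(1) by (auto simp: projective_toric_variety_def)
  have \<alpha>0: "\<alpha> 0 \<noteq> 0" using \<alpha> by simp
  let ?B = "exponent_diffs N A"
  note B = additive_exponent_diffs[of N A]
  \<comment> \<open>The characters trivial on the image of the monomial map; a kernel of
    functionals, hence saturated.\<close>
  define L where "L = {v \<in> vecs N. \<forall>l\<in>{..<r}. ?B l v = 0}"
  have sg: "subgrp L" by (auto simp: L_def subgrp_def vecs_closed additiveD[OF B])
  have sat: "saturated L"
    by (auto simp: L_def saturated_def additiveD[OF B]) (auto simp: vecs_def zmul_apply)
  have Lv: "L \<subseteq> vecs N" by (auto simp: L_def)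
  obtain \<Phi> u k where m: "minima N L \<Phi> u k" and L: "L = flag N \<Phi> k"
    using minima_exist[OF sg sat Lv] by blast
  have c: "coords N \<Phi>" and kN: "k \<le> N" using m by (auto simp: minima_def)
  let ?Y = "orbit N \<alpha> ?B {..<r}"
  have XY: "X = zariski N closure_of ?Y"
    unfolding X toric_variety_of_def orbit_eq_image[of \<alpha>, OF \<alpha>0] ..
  have YP: "?Y \<subseteq> proj_space N" by (rule orbit_subset_proj_space[of \<alpha>, OF \<alpha>0])
  have XP: "X \<subseteq> proj_space N" unfolding XY by (rule closure_subset_proj_space)
  have van: "vanish X f \<longleftrightarrow> f \<in> toric_forms N L \<alpha> D" if "f \<in> forms N D" for f D
    unfolding XY vanish_closure[OF YP that] L_def
    using toric_forms_iff_vanish_orbit[of "{..<r}" ?B \<alpha> f N D] B \<alpha>0 that by blast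
  have ideal: "hom_ideal_part N X D = toric_forms N L \<alpha> D" for D
  proof -
    have "hom_ideal_part N X D = {f \<in> forms N D. vanish X f}"
      by (auto simp: hom_ideal_part_def hom_ideal_def vanish_def forms_def)
    then show ?thesis using van by (auto simp: toric_forms_def)
  qed
  have hilb: "hilbert_function N X D = ncls N L D" for D
  proof -
    have "mpoly_dim (toric_forms N L \<alpha> D) = card (mons N D) - ncls N L D"
      by (rule dim_toric_forms[OF sg \<alpha>])
    then show ?thesis
      using ncls_le_card_mons[of N L D] by (simp add: hilbert_function_def ideal dim_forms)
  qed
  obtain p :: "real poly" where p: "\<forall>\<^sub>F D in sequentially. real (ncls N L D) = poly p (real D)"
    "degree p = N - k" "fact (N - k) * coeff p (N - k) \<le> real (\<Prod>l<k. nrm N (u l))"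
    "real (\<Prod>l<k. nrm N (u l)) \<le> fact N * coeff p (N - k)"
    using ncls_flag_poly[OF m L] by blast
  have "hilbert_polynomial N X = p"
    unfolding hilbert_polynomial_def hilb
    by (rule the_equality) (use p(1) eventually_poly_unique in blast)+
  then have deg: "proj_degree N X = fact (N - k) * coeff p (N - k)"
    by (simp add: proj_degree_def p(2))
  have dim_le: "proj_dim N X \<le> ereal (real (N - k))"
  proof (rule proj_dim_le[OF sg XP _ p(1)])
    show "vanish X f" if "f \<in> toric_forms N L \<alpha> D" for f D
      using van[of f D] that by (simp add: toric_forms_def)
  qed (simp add: p(2))
  have dim_ge: "ereal (real (N - k)) \<le> proj_dim N X"
  proof (rule proj_dim_ge[OF c kN \<alpha> XP])
    \<comment> \<open>The orbit of the adapted cocharacters has the same forms vanishing on it as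
      the given one, both kernels being \<open>L\<close>; as \<open>X\<close> is closed, it contains
      that orbit.\<close>
    obtain F where F: "F \<subseteq> (\<Union>D. forms N D)" "X = zero_set N F"
      using closedin_closure_of[of "zariski N" ?Y] unfolding XY[symmetric] closedin_zariski by blast
    have Lk: "{v \<in> vecs N. \<forall>l\<in>{k..<N}. \<Phi> l v = 0} = L" by (auto simp: L flag_def)
    have OP: "orbit N \<alpha> \<Phi> {k..<N} \<subseteq> proj_space N" by (rule orbit_subset_proj_space[of \<alpha>, OF \<alpha>0])
    have "vanish (orbit N \<alpha> \<Phi> {k..<N}) f" if f: "f \<in> F" for f
    proof -
      obtain D where D: "f \<in> forms N D" using F(1) f by blast
      have "vanish X f" using f by (auto simp: F(2) vanish_def zero_set_def)
      then have "f \<in> toric_forms N L \<alpha> D" using van[OF D] by simp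
      then show ?thesis
        using toric_forms_iff_vanish_orbit[of "{k..<N}" \<Phi> \<alpha> f N D] coordsD(1)[OF c] \<alpha>0 D unfolding Lk by simp
    qed
    then show "orbit N \<alpha> \<Phi> {k..<N} \<subseteq> X"
      using OP unfolding F(2) by (auto simp: zero_set_def vanish_def)
  qed
  \<comment> \<open>The two dimension bounds identify the rank of \<open>L\<close> with the
    codimension of \<open>X\<close>.\<close>
  have "n = N - k" using dim_le dim_ge assms(2) by simp
  then have k: "N - n = k" using kN by simp
  have "(\<Prod>i=1..k. obstruction_index N X (torus_part N) i) = (\<Prod>i<k. obstruction_index N X (torus_part N) (Suc i))"
    by (simp add: prod.atLeast1_atMost_eq)
  also have "\<dots> = (\<Prod>l<k. nrm N (u l))"
    by (rule prod.cong) (use obstruction_index_toric[of N \<alpha> X, OF \<alpha> ideal m L] in auto)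
  finally have prod: "(\<Prod>i=1..k. obstruction_index N X (torus_part N) i) = (\<Prod>l<k. nrm N (u l))" .
  \<comment> \<open>The sign is needed to multiply the inequality between factorials by this
    coefficient.\<close>
  have "0 \<le> coeff p (N - k)"
  proof -
    have "0 \<le> fact N * coeff p (N - k)" by (rule order.trans[OF of_nat_0_le_iff p(4)])
    moreover have "0 < (fact N :: real)" by simp
    ultimately show ?thesis by (metis mult_pos_neg not_le)
  qed
  moreover have "(fact N :: real) \<le> real ((N + 1) ^ k) * fact (N - k)"
    using fact_le_power_mult_fact[OF kN] by (metis of_nat_fact of_nat_le_iff of_nat_mult)
  ultimately have "fact N * coeff p (N - k) \<le> real ((N + 1) ^ k) * fact (N - k) * coeff p (N - k)"
    by (rule mult_right_mono[rotated])
  then have "fact N * coeff p (N - k) \<le> real ((N + 1) ^ k) * (fact (N - k) * coeff p (N - k))"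
    by (simp only: mult.assoc)
  then show ?thesis
    unfolding k prod deg using p(3) order.trans[OF p(4)] by blast
qed

end
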